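(* Let $\Omega$ be a domain of $\mathbb R^{2n}$ with smooth boundary such that $\mathbb R^{2n}\setminus\overline\Omega$ is connected. Suppose that $f$ is the restriction to $\partial\Omega$ of a $C^2(\Omega,\mathbb S^+)$ function (also denoted $f$), with $\mathscr D_0f$ vanishing to the second order on $\partial\Omega$, and that $f$ satisfies the moment condition $$\int_{\partial\Omega}\langle f,\;n_0G_0+n_1G_1\rangle_{\mathbb S^+}\,{\rm d}S=0$$ for any $G=(G_0,G_1)^T\in\ker\mathscr D_0^*\subset\mathcal E(\mathbb R^{2n},\mathbb C^2\otimes\mathbb S^-)$, $\mathscr D_0^*G=0$ on $\overline\Omega$, where $n_A=\sum_{j=1}^n\gamma_jn_{Aj}$ for $A=0,1$, and $(n_{01},\dots,n_{0n},n_{11},\dots,n_{1n})$ is the unit outer normal vector to $\partial\Omega$. Then there exists a monogenic function $\tilde f\in\mathcal O(\Omega)$ such that $\tilde f=f$ on $\partial\Omega$.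
   Context: Let $n$ be a positive integer and $m=\lfloor n/2\rfloor$. Let $W$ be a complex vector space with basis $f_1,\dots,f_m$; for $\alpha=\{\alpha_1<\dots<\alpha_h\}\subset\{1,\dots,m\}$ put $f_\alpha=f_{\alpha_1}\wedge\cdots\wedge f_{\alpha_h}$ ($f_\emptyset=1$), a basis of $\wedge^\bullet W$. Let $\varepsilon_jv=f_j\wedge v$, and let $\iota_jf_\alpha=0$ if $j\notin\alpha$, $\iota_jf_\alpha=(-1)^{t+1}f_{\alpha\setminus\{j\}}$ if $j=\alpha_t$. The Dirac matrices are $\gamma_{2j-1}=\varepsilon_j-\iota_j$, $\gamma_{2j}=-\mathbf i(\varepsilon_j+\iota_j)$ for $1\le j\le m$ and, if $n=2m+1$, $\gamma_nf_\alpha=-\mathbf i(-1)^{\#\alpha}f_\alpha$. The spinor modules are $\mathbb S^+=\wedge^{\rm even}W$, $\mathbb S^-=\wedge^{\rm odd}W$ for $n$ even, and $\mathbb S^+=\mathbb S^-=\wedge^\bullet W$ for $n$ odd. Then $\gamma_j:\mathbb S^\pm\to\mathbb S^\mp$ and $\gamma_j\gamma_k+\gamma_k\gamma_j=-2\delta_{jk}\mathbf 1$. $\langle\cdot,\cdot\rangle_{\mathbb S^\pm}$ is the Hermitian inner product for which the $f_\alpha$ are orthonormal. Write points of $\mathbb R^{2n}$ as $\mathbf x=(\mathbf x_0,\mathbf x_1)$ with $\mathbf x_A=(x_{A1},\dots,x_{An})$, $A=0,1$; let $\partial_{Aj}=\partial/\partial x_{Aj}$ and $\nabla_A=\sum_{j=1}^n\gamma_j\partial_{Aj}$.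 For $u$ with values in $\mathbb S^+$, $\mathscr D_0u=(\nabla_0u,\nabla_1u)^T$, with values in $\mathbb C^2\otimes\mathbb S^-$. Its formal adjoint with respect to the $L^2$ inner products is $\mathscr D_0^*G=\nabla_0G_0+\nabla_1G_1$. $\mathcal E(\mathbb R^{2n},\mathbb C^2\otimes\mathbb S^-)$ is the space of smooth $\mathbb C^2\otimes\mathbb S^-$-valued functions on $\mathbb R^{2n}$, and ${\rm d}S$ is the surface measure. A function $u:\Omega\to\mathbb S^+$ is called monogenic on $\Omega$ if $\mathscr D_0u(\mathbf x)=0$ for every $\mathbf x\in\Omega$; $\mathcal O(\Omega)$ is the space of all monogenic functions on $\Omega$.
   Formalization: The domain Ω is assumed bounded: for noncompact boundary the moment integrals against arbitrary smooth G need not exist, and for exterior domains the claim fails (n=2, Ω={|z|>1}, f=χ/(z̄₀−2) with χ a cutoff equal to 1 near the sphere). *)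

theory Defs
  imports "HOL-Analysis.Analysis"
begin

section \<open>Spinors and Dirac matrices\<close>

text \<open>
  The integer \<open>n\<close> is \<open>CARD('n)\<close>, and \<open>m = CARD('n) div 2\<close>. The type \<open>'n multiindex\<close>
  consists of the subsets \<open>\<alpha>\<close> of \<open>{1..m}\<close>, so that \<open>'n spinor\<close> is the exterior algebra
  of \<open>W\<close>, written in the orthonormal basis \<open>f\<^sub>\<alpha>\<close>.
\<close>

typedef ('n::finite) multiindex = "Pow {1..CARD('n) div 2}"
  by blast

instance multiindex :: (finite) finite
proof
  have "finite (Rep_multiindex ` (UNIV :: 'a multiindex set))"
    by (rule finite_subset[of _ "Pow {1..CARD('a) div 2}"]) (use Rep_multiindex in auto)
  then show "finite (UNIV :: 'a multiindex set)"
    by (rule finite_imageD) (simp add: inj_on_def Rep_multiindex_inject)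
qed

type_synonym 'n spinor = "(complex, 'n multiindex) vec"

definition basis_spinor :: "nat set \<Rightarrow> ('n::finite) spinor" where
  "basis_spinor \<alpha> = axis (Abs_multiindex \<alpha>) 1"

definition linear_ext :: "(nat set \<Rightarrow> 'n spinor) \<Rightarrow> ('n::finite) spinor \<Rightarrow> 'n spinor" where
  "linear_ext T v = (\<Sum>\<alpha>\<in>UNIV. (v $ \<alpha>) *s T (Rep_multiindex \<alpha>))"

text \<open>
  The sign in \<open>wedge\<close> is that of the permutation which sorts \<open>f\<^sub>j \<and> f\<^sub>\<alpha>\<close>. In \<open>contract\<close>, the
  position \<open>t\<close> of \<open>j\<close> in \<open>\<alpha>\<close> is \<open>card {i \<in> \<alpha>. i \<le> j}\<close>. Both are used for
  \<open>j \<in> {1..m}\<close> only.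
\<close>

definition wedge :: "nat \<Rightarrow> ('n::finite) spinor \<Rightarrow> 'n spinor" where
  "wedge j = linear_ext (\<lambda>\<alpha>. if j \<in> \<alpha> then 0
     else (- 1) ^ card {i \<in> \<alpha>. i < j} *s basis_spinor (insert j \<alpha>))"

definition contract :: "nat \<Rightarrow> ('n::finite) spinor \<Rightarrow> 'n spinor" where
  "contract j = linear_ext (\<lambda>\<alpha>. if j \<notin> \<alpha> then 0
     else (- 1) ^ (card {i \<in> \<alpha>. i \<le> j} + 1) *s basis_spinor (\<alpha> - {j}))"

definition dirac_matrix :: "nat \<Rightarrow> ('n::finite) spinor \<Rightarrow> 'n spinor" where
  "dirac_matrix k v =
     (if odd CARD('n) \<and> k = CARD('n)
      then linear_ext (\<lambda>\<alpha>. (- \<i> * (- 1) ^ card \<alpha>) *s basis_spinor \<alpha>) v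
      else if odd k then wedge ((k + 1) div 2) v - contract ((k + 1) div 2) v
      else (- \<i>) *s (wedge (k div 2) v + contract (k div 2) v))"

definition spinors_plus :: "('n::finite) spinor set" where
  "spinors_plus =
     {v. even CARD('n) \<longrightarrow> (\<forall>\<alpha>. odd (card (Rep_multiindex \<alpha>)) \<longrightarrow> v $ \<alpha> = 0)}"

definition spinors_minus :: "('n::finite) spinor set" where
  "spinors_minus =
     {v. even CARD('n) \<longrightarrow> (\<forall>\<alpha>. even (card (Rep_multiindex \<alpha>)) \<longrightarrow> v $ \<alpha> = 0)}"

definition spinor_inner :: "('n::finite) spinor \<Rightarrow> 'n spinor \<Rightarrow> complex" where
  "spinor_inner u v = (\<Sum>\<alpha>\<in>UNIV. u $ \<alpha> * cnj (v $ \<alpha>))"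


section \<open>The operators\<close>

text \<open>
  A point of the domain space is a pair \<open>(x\<^sub>0, x\<^sub>1)\<close> of vectors in \<open>real ^ 'n\<close>. The linear
  order on \<open>'n\<close> only serves to number the coordinates by \<open>1, \<dots>, n\<close>.
\<close>

type_synonym 'n domain_space = "(real, 'n) vec \<times> (real, 'n) vec"

definition coord_number :: "'n::{finite,linorder} \<Rightarrow> nat" where
  "coord_number i = card {..i}"

definition nabla0 ::
    "(('n::{finite,linorder}) domain_space \<Rightarrow> 'n spinor) \<Rightarrow> 'n domain_space \<Rightarrow> 'n spinor"
  where "nabla0 u x =
    (\<Sum>i\<in>UNIV. dirac_matrix (coord_number i) (frechet_derivative u (at x) (axis i 1, 0)))"

definition nabla1 ::
    "(('n::{finite,linorder}) domain_space \<Rightarrow> 'n spinor) \<Rightarrow> 'n domain_space \<Rightarrow> 'n spinor"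
  where "nabla1 u x =
    (\<Sum>i\<in>UNIV. dirac_matrix (coord_number i) (frechet_derivative u (at x) (0, axis i 1)))"

text \<open>An element of \<open>\<complex>\<^sup>2 \<otimes> S\<close> is represented by the pair of its two components.\<close>

definition D0 ::
    "(('n::{finite,linorder}) domain_space \<Rightarrow> 'n spinor) \<Rightarrow>
     'n domain_space \<Rightarrow> 'n spinor \<times> 'n spinor"
  where "D0 u x = (nabla0 u x, nabla1 u x)"

definition D0_adj ::
    "(('n::{finite,linorder}) domain_space \<Rightarrow> 'n spinor \<times> 'n spinor) \<Rightarrow>
     'n domain_space \<Rightarrow> 'n spinor"
  where "D0_adj G x = nabla0 (\<lambda>y. fst (G y)) x + nabla1 (\<lambda>y. snd (G y)) x"

fun Ck_on :: "nat \<Rightarrow> 'a::euclidean_space set \<Rightarrow> ('a \<Rightarrow> 'b::real_normed_vector) \<Rightarrow> bool" where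
  "Ck_on 0 S f \<longleftrightarrow> continuous_on S f"
| "Ck_on (Suc k) S f \<longleftrightarrow>
     f differentiable_on S \<and> (\<forall>b\<in>Basis. Ck_on k S (\<lambda>x. frechet_derivative f (at x) b))"

text \<open>\<open>Ck_on\<close> and \<open>smooth_on\<close> are meant for open sets.\<close>

definition smooth_on :: "'a::euclidean_space set \<Rightarrow> ('a \<Rightarrow> 'b::real_normed_vector) \<Rightarrow> bool" where
  "smooth_on S f \<longleftrightarrow> (\<forall>k. Ck_on k S f)"

definition ker_D0_adj ::
    "(('n::{finite,linorder}) domain_space \<Rightarrow> 'n spinor \<times> 'n spinor) set" where
  "ker_D0_adj = {G. smooth_on UNIV G \<and> range G \<subseteq> spinors_minus \<times> spinors_minus \<and>
                    (\<forall>x. D0_adj G x = 0)}"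

definition monogenic_on ::
    "('n::{finite,linorder}) domain_space set \<Rightarrow> (('n::{finite,linorder}) domain_space \<Rightarrow> 'n spinor) \<Rightarrow> bool"
  where "monogenic_on \<Omega> u \<longleftrightarrow> Ck_on 1 \<Omega> u \<and> u ` \<Omega> \<subseteq> spinors_plus \<and> (\<forall>x\<in>\<Omega>. D0 u x = 0)"


section \<open>Boundary notions\<close>

definition local_defining_function ::
    "'a::euclidean_space set \<Rightarrow> 'a \<Rightarrow> 'a set \<Rightarrow> ('a \<Rightarrow> real) \<Rightarrow> bool" where
  "local_defining_function \<Omega> p V \<rho> \<longleftrightarrow>
     open V \<and> p \<in> V \<and> smooth_on V \<rho> \<and> (\<forall>x\<in>V. frechet_derivative \<rho> (at x) \<noteq> (\<lambda>h. 0)) \<and>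
     \<Omega> \<inter> V = {x \<in> V. \<rho> x < 0}"

definition smooth_boundary :: "'a::euclidean_space set \<Rightarrow> bool" where
  "smooth_boundary \<Omega> \<longleftrightarrow> (\<forall>p\<in>frontier \<Omega>. \<exists>V \<rho>. local_defining_function \<Omega> p V \<rho>)"

definition outer_normal :: "'a::euclidean_space set \<Rightarrow> 'a \<Rightarrow> 'a" where
  "outer_normal \<Omega> p =
     (THE \<nu>. \<exists>V \<rho> g. local_defining_function \<Omega> p V \<rho> \<and> (GDERIV \<rho> p :> g) \<and> \<nu> = g /\<^sub>R norm g)"

text \<open>Clifford multiplication by the normal: \<open>normal_action \<Omega> x G = n\<^sub>0 G\<^sub>0 + n\<^sub>1 G\<^sub>1\<close> at \<open>x\<close>.\<close>

definition normal_action ::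
    "('n::{finite,linorder}) domain_space set \<Rightarrow> 'n domain_space \<Rightarrow>
     'n spinor \<times> 'n spinor \<Rightarrow> 'n spinor" where
  "normal_action \<Omega> x G =
     (\<Sum>i\<in>UNIV. complex_of_real (fst (outer_normal \<Omega> x) $ i) *s dirac_matrix (coord_number i) (fst G))
   + (\<Sum>i\<in>UNIV. complex_of_real (snd (outer_normal \<Omega> x) $ i) *s dirac_matrix (coord_number i) (snd G))"

text \<open>
  The surface measure is the Hausdorff measure of codimension one, with the normalisation that
  agrees with Lebesgue measure on hyperplanes.
\<close>

definition hausdorff_content :: "nat \<Rightarrow> real \<Rightarrow> 'a::euclidean_space set \<Rightarrow> ennreal" where
  "hausdorff_content d \<delta> A =
     (INF C \<in> {C :: nat \<Rightarrow> 'a set. A \<subseteq> (\<Union>i. C i) \<and> (\<forall>i. bounded (C i) \<and> diameter (C i) \<le> \<delta>)}.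
        \<Sum>i. ennreal (unit_ball_vol (real d) * (diameter (C i) / 2) ^ d))"

definition hausdorff_measure :: "nat \<Rightarrow> 'a::euclidean_space measure" where
  "hausdorff_measure d =
     measure_of UNIV (sets borel) (\<lambda>A. SUP \<delta>\<in>{0<..}. hausdorff_content d \<delta> A)"

definition surface_measure :: "'a::euclidean_space set \<Rightarrow> 'a measure" where
  "surface_measure \<Omega> = restrict_space (hausdorff_measure (DIM('a) - 1)) (frontier \<Omega>)"

text \<open>
  For \<open>F\<close> defined on the open set \<open>\<Omega>\<close>: all partial derivatives of order less than \<open>k\<close> have the
  boundary value \<open>0\<close>.
\<close>

fun vanishes_on_boundary ::
    "nat \<Rightarrow> 'a::euclidean_space set \<Rightarrow> ('a \<Rightarrow> 'b::real_normed_vector) \<Rightarrow> bool" where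
  "vanishes_on_boundary 0 \<Omega> F \<longleftrightarrow> True"
| "vanishes_on_boundary (Suc k) \<Omega> F \<longleftrightarrow>
     (\<forall>p\<in>frontier \<Omega>. (F \<longlongrightarrow> 0) (at p within \<Omega>)) \<and>
     (\<forall>b\<in>Basis. vanishes_on_boundary k \<Omega> (\<lambda>x. frechet_derivative F (at x) b))"

end

theory Submission
  imports Defs
begin

text \<open>
  The monogenic extension is \<open>f - u\<close>, where \<open>u\<close> solves \<open>D\<^sub>0 u = D\<^sub>0 f\<close> in \<open>\<Omega>\<close> and vanishes on the boundary.
  To find \<open>u\<close>, let \<open>F = (F\<^sub>0, F\<^sub>1)\<close> be \<open>D\<^sub>0 f\<close> in \<open>\<Omega>\<close> and \<open>0\<close> elsewhere. Because \<open>D\<^sub>0 f\<close> vanishes to the second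
  order on the boundary, \<open>F\<close> is continuously differentiable on the whole space
  (\<open>C1_on_zero_extension\<close>) and has compact support. The equation \<open>D\<^sub>0 u = F\<close> is overdetermined. Since
  \<open>\<nabla>\<^sub>0 \<nabla>\<^sub>0 = - \<Delta>\<^sub>0\<close> is a scalar operator, it requires \<open>\<nabla>\<^sub>0 \<nabla>\<^sub>0 F\<^sub>1 = \<nabla>\<^sub>1 \<nabla>\<^sub>0 F\<^sub>0\<close>. This identity holds inside \<open>\<Omega>\<close>,
  and it survives, in the sense of distributions, the extension by zero: cutting off near the boundary
  costs a factor \<open>1 / \<epsilon>\<close>, the layer of width \<open>\<epsilon>\<close> at a smooth boundary has volume \<open>O(\<epsilon>)\<close>, and the first
  derivatives of \<open>F\<close> are small there (\<open>inner_layer_measure\<close>, \<open>boundary_cutoffs\<close>,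
  \<open>compatible_zero_extension\<close>).

  The equation \<open>\<nabla>\<^sub>0 u = F\<^sub>0\<close> alone involves \<open>x\<^sub>1\<close> only as a parameter. It is solved by convolution in the
  variable \<open>x\<^sub>0\<close> with the Cauchy kernel, a multiple of \<open>y / |y|\<^sup>n\<close> acting by Clifford multiplication
  (\<open>fund_integral_divergence\<close>). By the compatibility, \<open>h = \<nabla>\<^sub>1 u - F\<^sub>1\<close> is harmonic in \<open>x\<^sub>0\<close>; it is bounded, so
  it does not depend on \<open>x\<^sub>0\<close> by Liouville's theorem. As the kernel is odd, the values of \<open>h\<close> at \<open>x\<^sub>0\<close> and
  \<open>- x\<^sub>0\<close> cancel in the limit \<open>x\<^sub>0 \<rightarrow> \<infinity>\<close>, whence \<open>h = 0\<close> and \<open>D\<^sub>0 u = F\<close> (\<open>dirac_solution\<close>).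

  By its construction \<open>u\<close> vanishes for large \<open>|x\<^sub>1|\<close>. It is monogenic, hence harmonic, on the complement of
  the closure of \<open>\<Omega>\<close>, and this complement is connected. So \<open>u = 0\<close> there by unique continuation, and
  \<open>u = 0\<close> on the boundary by continuity (\<open>hartogs_correction\<close>). This is the Hartogs phenomenon.

  All functions are only finitely often differentiable, and harmonicity is used in the form of a mean
  value property with a polynomial weight on balls. It follows from the weak Laplace equation, is
  inherited by derivatives, and yields gradient estimates, Liouville's theorem and unique continuation.
\<close>

section \<open>Calculus with continuously differentiable functions\<close>

text \<open>
  The derivative is an argument of \<open>C1_on\<close>, because the derivatives of products, convolutions and test
  functions enter the integral identities below through explicit formulas.
\<close>

definition C1_on ::
    "'a::euclidean_space set \<Rightarrow> ('a \<Rightarrow> 'b::real_normed_vector) \<Rightarrow> ('a \<Rightarrow> 'a \<Rightarrow> 'b) \<Rightarrow> bool" where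
  "C1_on U f f' \<longleftrightarrow>
     (\<forall>x\<in>U. (f has_derivative f' x) (at x)) \<and> (\<forall>v. continuous_on U (\<lambda>x. f' x v))"

lemma C1_onI:
  assumes "\<And>x. x \<in> U \<Longrightarrow> (f has_derivative f' x) (at x)" "\<And>v. continuous_on U (\<lambda>x. f' x v)"
  shows "C1_on U f f'"
  using assms by (auto simp: C1_on_def)

lemma C1_onD:
  assumes "C1_on U f f'"
  shows "x \<in> U \<Longrightarrow> (f has_derivative f' x) (at x)" "continuous_on U (\<lambda>x. f' x v)"
    "x \<in> U \<Longrightarrow> linear (f' x)" "continuous_on U f"
  using assms has_derivative_linear has_derivative_continuous_on has_derivative_at_withinI
  unfolding C1_on_def by (blast, blast, blast, meson)

lemma C1_on_subset: "C1_on U f f' \<Longrightarrow> V \<subseteq> U \<Longrightarrow> C1_on V f f'"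
  unfolding C1_on_def using continuous_on_subset by blast

lemma C1_on_diff:
  assumes "C1_on U f f'" "C1_on U g g'"
  shows "C1_on U (\<lambda>x. f x - g x) (\<lambda>x v. f' x v - g' x v)"
  using assms unfolding C1_on_def by (auto intro!: derivative_eq_intros continuous_intros)

lemma C1_on_sum:
  assumes "\<And>i. i \<in> I \<Longrightarrow> C1_on U (f i) (f' i)"
  shows "C1_on U (\<lambda>x. \<Sum>i\<in>I. f i x) (\<lambda>x v. \<Sum>i\<in>I. f' i x v)"
  using assms unfolding C1_on_def by (auto intro!: derivative_intros continuous_intros)

lemma C1_on_linear_image:
  fixes f :: "'a::euclidean_space \<Rightarrow> 'b::euclidean_space"
  assumes "C1_on U f f'" "linear T"
  shows "C1_on U (\<lambda>x. T (f x)) (\<lambda>x v. T (f' x v))"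
proof -
  have T: "bounded_linear T" using assms(2) by (simp add: linear_conv_bounded_linear)
  show ?thesis
    using assms(1) unfolding C1_on_def
    by (auto intro!: bounded_linear.has_derivative[OF T] bounded_linear.continuous_on[OF T])
qed

lemma C1_on_scaleR:
  fixes p :: "'a::euclidean_space \<Rightarrow> real"
  assumes "C1_on U p p'" "C1_on U u u'"
  shows "C1_on U (\<lambda>x. p x *\<^sub>R u x) (\<lambda>x v. p x *\<^sub>R u' x v + p' x v *\<^sub>R u x)"
  using assms C1_onD(4)[OF assms(1)] C1_onD(4)[OF assms(2)] unfolding C1_on_def
  by (auto intro!: has_derivative_scaleR continuous_intros)

lemma C1_on_affine:
  fixes g :: "'b::euclidean_space \<Rightarrow> 'c::real_normed_vector"
  assumes "C1_on UNIV g g'" "linear (L :: 'a::euclidean_space \<Rightarrow> 'b)"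
  shows "C1_on UNIV (\<lambda>x. g (L x + t)) (\<lambda>x v. g' (L x + t) (L v))"
proof (rule C1_onI)
  have L: "bounded_linear L" using assms(2) by (simp add: linear_conv_bounded_linear)
  show "((\<lambda>x. g (L x + t)) has_derivative (\<lambda>v. g' (L x + t) (L v))) (at x)" for x
    by (rule has_derivative_compose[of "\<lambda>x. L x + t" L x UNIV g "g' (L x + t)"])
      (auto intro!: derivative_eq_intros bounded_linear.has_derivative[OF L] C1_onD(1)[OF assms(1)])
  show "continuous_on UNIV (\<lambda>x. g' (L x + t) (L v))" for v
    by (rule continuous_on_compose2[OF C1_onD(2)[OF assms(1), of "L v"]])
      (auto intro!: continuous_intros bounded_linear.continuous_on[OF L])
qed

lemma compact_norm_bound:
  assumes "compact (S :: 'a::real_normed_vector set)"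
  obtains R where "R > 0" "\<And>x. x \<in> S \<Longrightarrow> norm x \<le> R"
  using compact_imp_bounded[OF assms] bounded_pos by metis

lemma C1_on_zero_off:
  assumes "C1_on UNIV f f'" "closed S" "\<And>x. x \<notin> S \<Longrightarrow> f x = 0" "x \<notin> S"
  shows "f' x v = 0"
proof -
  have "(f has_derivative (\<lambda>v. 0)) (at x)"
    by (rule has_derivative_transform_within_open[where f = "\<lambda>x. 0" and s = "- S"]) (use assms in auto)
  with C1_onD(1)[OF assms(1)] show ?thesis
    using has_derivative_unique[of f _ x] by (metis UNIV_I)
qed

lemma linear_norm_le_sum_Basis:
  fixes T :: "'a::euclidean_space \<Rightarrow> 'b::real_normed_vector"
  assumes "linear T" "\<And>b. b \<in> Basis \<Longrightarrow> norm (T b) \<le> M"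
  shows "norm (T v) \<le> (real DIM('a) * M) * norm v"
proof -
  have "norm (T v) = norm (\<Sum>b\<in>Basis. (v \<bullet> b) *\<^sub>R T b)"
    by (subst euclidean_representation[of v, symmetric])
      (simp only: linear_sum[OF assms(1)] linear_scale[OF assms(1)])
  also have "\<dots> \<le> (\<Sum>b\<in>(Basis::'a set). norm v * M)"
    using assms(2) by (intro order_trans[OF norm_sum] sum_mono)
      (auto intro!: mult_mono simp: Basis_le_norm)
  finally show ?thesis by (simp add: mult_ac)
qed

lemma C1_on_bounded:
  fixes f :: "'a::euclidean_space \<Rightarrow> 'b::real_normed_vector"
  assumes "C1_on U f f'" "compact K" "K \<subseteq> U"
  obtains M where "M > 0" "\<And>x v. x \<in> K \<Longrightarrow> norm (f' x v) \<le> M * norm v"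
proof -
  have "\<exists>m. \<forall>x\<in>K. norm (f' x b) \<le> m" for b
  proof -
    have "compact ((\<lambda>x. f' x b) ` K)"
      using assms C1_onD(2)[OF assms(1)] by (meson compact_continuous_image continuous_on_subset)
    then show ?thesis using compact_imp_bounded bounded_iff by (metis imageI)
  qed
  then obtain m where m: "\<And>b x. x \<in> K \<Longrightarrow> norm (f' x b) \<le> m b" by metis
  define N where "N = (\<Sum>b\<in>(Basis::'a set). \<bar>m b\<bar>)"
  have "norm (f' x v) \<le> (real DIM('a) * N + 1) * norm v" if x: "x \<in> K" for x v
  proof -
    have "norm (f' x b) \<le> N" if "b \<in> Basis" for b
    proof -
      have "\<bar>m b\<bar> \<le> N" unfolding N_def by (rule member_le_sum) (use that in auto)
      with m[OF x, of b] show ?thesis by linarith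
    qed
    then have "norm (f' x v) \<le> (real DIM('a) * N) * norm v"
      using C1_onD(3)[OF assms(1), of x] x assms(3) by (intro linear_norm_le_sum_Basis) auto
    then show ?thesis by (simp add: distrib_right add_increasing2)
  qed
  moreover have "real DIM('a) * N + 1 > 0" unfolding N_def
    by (intro add_nonneg_pos mult_nonneg_nonneg sum_nonneg) auto
  ultimately show ?thesis using that by blast
qed

lemma C1_on_lipschitz:
  fixes f :: "'a::euclidean_space \<Rightarrow> 'b::real_normed_vector"
  assumes "C1_on U f f'" "convex K" "K \<subseteq> U" "\<And>x v. x \<in> K \<Longrightarrow> norm (f' x v) \<le> M * norm v"
    and "x \<in> K" "y \<in> K"
  shows "norm (f y - f x) \<le> M * norm (y - x)"
proof (rule differentiable_bound[OF assms(2) _ _ \<open>y \<in> K\<close> \<open>x \<in> K\<close>, of f f'])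
  show "(f has_derivative f' z) (at z within K)" if "z \<in> K" for z
    using C1_onD(1)[OF assms(1), of z] that assms(3) has_derivative_at_withinI by blast
  show "onorm (f' z) \<le> M" if "z \<in> K" for z
    using assms(4)[OF that] by (intro onorm_le) auto
qed

lemma C1_on_compact_bounded:
  fixes f :: "'a::euclidean_space \<Rightarrow> 'b::real_normed_vector"
  assumes "C1_on UNIV f f'" "compact S" "\<And>x. x \<notin> S \<Longrightarrow> f x = 0"
  obtains M where "M > 0" "\<And>x v. norm (f' x v) \<le> M * norm v"
    "\<And>x y. norm (f y - f x) \<le> M * norm (y - x)"
proof -
  obtain M where M: "M > 0" "\<And>x v. x \<in> S \<Longrightarrow> norm (f' x v) \<le> M * norm v"
    using C1_on_bounded[OF assms(1,2)] by auto
  have b: "norm (f' x v) \<le> M * norm v" for x v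
  proof (cases "x \<in> S")
    case False
    then have "f' x v = 0" using C1_on_zero_off[OF assms(1) _ assms(3)] assms(2) compact_imp_closed by blast
    then show ?thesis using M(1) by simp
  qed (use M in auto)
  show ?thesis by (rule that[OF M(1) b C1_on_lipschitz[OF assms(1) convex_UNIV]]) (use b in auto)
qed

lemma uniformly_continuous_compact_support:
  fixes g :: "'a::euclidean_space \<Rightarrow> 'b::real_normed_vector"
  assumes "continuous_on UNIV g" "compact S" "\<And>x. x \<notin> S \<Longrightarrow> g x = 0"
  shows "uniformly_continuous_on UNIV g"
  unfolding uniformly_continuous_on_def
proof (intro allI impI)
  fix \<epsilon> :: real assume "\<epsilon> > 0"
  obtain R where R: "R > 0" "\<And>x. x \<in> S \<Longrightarrow> norm x \<le> R" using compact_norm_bound[OF assms(2)] by blast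
  have "uniformly_continuous_on (cball 0 (R + 1)) g"
    by (intro compact_uniformly_continuous continuous_on_subset[OF assms(1)]) auto
  from uniformly_continuous_onE[OF this \<open>\<epsilon> > 0\<close>]
  obtain d where d: "d > 0" "\<And>x y. x \<in> cball 0 (R+1) \<Longrightarrow> y \<in> cball 0 (R+1) \<Longrightarrow> dist y x < d \<Longrightarrow> dist (g y) (g x) < \<epsilon>"
    by metis
  have "dist (g y) (g x) < \<epsilon>" if "dist y x < min d 1" for x y
  proof (cases "x \<in> cball 0 (R+1) \<and> y \<in> cball 0 (R+1)")
    case True
    then show ?thesis using d(2)[of x y] that by simp
  next
    case False
    have "norm x \<le> norm y + dist y x" "norm y \<le> norm x + dist y x"
      using norm_triangle_sub[of x y] norm_triangle_sub[of y x] by (auto simp: dist_norm norm_minus_commute)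
    moreover have "norm x > R + 1 \<or> norm y > R + 1" using False by auto
    moreover have "dist y x < 1" using that by simp
    ultimately have "norm x > R" "norm y > R" by linarith+
    then have "x \<notin> S" "y \<notin> S" using R(2)[of x] R(2)[of y] by auto
    then show ?thesis using assms(3) \<open>\<epsilon> > 0\<close> by simp
  qed
  then show "\<exists>d>0. \<forall>x\<in>UNIV. \<forall>y\<in>UNIV. dist y x < d \<longrightarrow> dist (g y) (g x) < \<epsilon>"
    using d(1) by (intro exI[of _ "min d 1"]) auto
qed

text \<open>Uniform differentiability is what allows to differentiate under an integral sign.\<close>

lemma C1_on_uniformly_differentiable:
  fixes f :: "'a::euclidean_space \<Rightarrow> 'b::real_normed_vector"
  assumes "C1_on UNIV f f'" "compact S" "\<And>x. x \<notin> S \<Longrightarrow> f x = 0" "e > 0"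
  obtains d where "d > 0" "\<And>z h. norm h < d \<Longrightarrow> norm (f (z + h) - f z - f' z h) \<le> e * norm h"
proof -
  define e' where "e' = e / (real DIM('a) + 1)"
  have e': "e' > 0" using assms(4) unfolding e'_def by (intro divide_pos_pos) auto
  have g0: "f' x b = 0" if "x \<notin> S" for x b
    by (rule C1_on_zero_off[OF assms(1) compact_imp_closed[OF assms(2)] _ that]) (rule assms(3))
  have "\<forall>b. \<exists>d. d > 0 \<and> (\<forall>x y. dist y x < d \<longrightarrow> dist (f' y b) (f' x b) < e')"
  proof
    fix b
    have "uniformly_continuous_on UNIV (\<lambda>x. f' x b)"
      by (rule uniformly_continuous_compact_support[OF C1_onD(2)[OF assms(1)] assms(2) g0])
    from this[unfolded uniformly_continuous_on_def, rule_format, OF e']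
    show "\<exists>d. d > 0 \<and> (\<forall>x y. dist y x < d \<longrightarrow> dist (f' y b) (f' x b) < e')" by simp
  qed
  from choice[OF this]
  obtain d where d: "\<And>b. d b > 0" "\<And>b x y. dist y x < d b \<Longrightarrow> dist (f' y b) (f' x b) < e'" by auto
  define D where "D = Min (d ` (Basis::'a set))"
  have D: "D > 0" "\<And>b. b \<in> Basis \<Longrightarrow> D \<le> d b" unfolding D_def using d(1) by auto
  have "norm (f (z + h) - f z - f' z h) \<le> e * norm h" if h: "norm h < D" for z h
  proof -
    have lin: "linear (f' w)" for w using C1_onD(3)[OF assms(1)] by simp
    have "C1_on UNIV (\<lambda>w. f w - f' z w) (\<lambda>w v. f' w v - f' z v)"
    proof (rule C1_on_diff[OF assms(1)], rule C1_onI)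
      show "(f' z has_derivative f' z) (at x)" for x
        using bounded_linear_imp_has_derivative has_derivative_bounded_linear[OF C1_onD(1)[OF assms(1)]] by blast
    qed auto
    then have "norm ((f (z + h) - f' z (z + h)) - (f z - f' z z)) \<le> e * norm (z + h - z)"
    proof (rule C1_on_lipschitz[where K = "ball z D"])
      fix w v assume w: "w \<in> ball z D"
      have "norm (f' w v - f' z v) \<le> (real DIM('a) * e') * norm v"
      proof (rule linear_norm_le_sum_Basis[where T = "\<lambda>v. f' w v - f' z v"])
        show "linear (\<lambda>v. f' w v - f' z v)" by (intro linear_compose_sub lin)
        fix b :: 'a assume "b \<in> Basis"
        then have "dist w z < d b" using w D(2)[of b] by (simp add: dist_commute)
        then show "norm (f' w b - f' z b) \<le> e'" using d(2)[of w z b] by (simp add: dist_norm)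
      qed
      also have "\<dots> \<le> e * norm v"
        using assms(4) unfolding e'_def by (intro mult_right_mono) (auto simp: field_simps)
      finally show "norm (f' w v - f' z v) \<le> e * norm v" .
    qed (use h D in \<open>auto simp: dist_norm\<close>)
    then show ?thesis using linear_add[OF lin[of z], of z h] by (simp add: algebra_simps)
  qed
  with D(1) show ?thesis using that by blast
qed

subsection \<open>Integrals over the whole space\<close>

lemma integrable_compact_support:
  fixes f :: "'a::euclidean_space \<Rightarrow> 'b::{banach, second_countable_topology}"
  assumes "continuous_on UNIV f" "compact S" "\<And>x. x \<notin> S \<Longrightarrow> f x = 0"
  shows "integrable lborel f"
proof -
  have "f = (\<lambda>x. indicator S x *\<^sub>R f x)" using assms(3) by (auto simp: indicator_def fun_eq_iff)
  with borel_integrable_compact[OF assms(2) continuous_on_subset[OF assms(1)]] show ?thesis by simp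
qed

lemma lborel_affine_integral:
  fixes f :: "'a::euclidean_space \<Rightarrow> 'b::{banach, second_countable_topology}"
  assumes "f \<in> borel_measurable borel" "c \<noteq> 0"
  shows "(LINT x|lborel. f x) = \<bar>c\<bar> ^ DIM('a) *\<^sub>R (LINT x|lborel. f (t + c *\<^sub>R x))"
    and "integrable lborel f \<longleftrightarrow> integrable lborel (\<lambda>x. f (t + c *\<^sub>R x))"
proof -
  have m: "(\<lambda>x. t + c *\<^sub>R x) \<in> lborel \<rightarrow>\<^sub>M borel" by simp
  have e: "(\<lambda>_::'a. ennreal \<bar>c\<bar> ^ DIM('a)) = (\<lambda>_. ennreal (\<bar>c\<bar> ^ DIM('a)))" by (simp add: ennreal_power)
  show "(LINT x|lborel. f x) = \<bar>c\<bar> ^ DIM('a) *\<^sub>R (LINT x|lborel. f (t + c *\<^sub>R x))"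
    using assms by (subst lborel_affine[OF assms(2), of t])
      (simp add: e integral_density integral_distr[OF m] del: ennreal_power)
  have "integrable lborel f \<longleftrightarrow> integrable lborel (\<lambda>x. \<bar>c\<bar> ^ DIM('a) *\<^sub>R f (t + c *\<^sub>R x))"
    using assms by (subst lborel_affine[OF assms(2), of t])
      (simp add: e integrable_density integrable_distr_eq[OF m] del: ennreal_power)
  also have "\<dots> \<longleftrightarrow> integrable lborel (\<lambda>x. f (t + c *\<^sub>R x))"
  proof
    assume "integrable lborel (\<lambda>x. \<bar>c\<bar> ^ DIM('a) *\<^sub>R f (t + c *\<^sub>R x))"
    then have "integrable lborel (\<lambda>x. inverse (\<bar>c\<bar> ^ DIM('a)) *\<^sub>R \<bar>c\<bar> ^ DIM('a) *\<^sub>R f (t + c *\<^sub>R x))"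
      by (rule integrable_scaleR_right)
    then show "integrable lborel (\<lambda>x. f (t + c *\<^sub>R x))" using assms(2) by simp
  qed simp
  finally show "integrable lborel f \<longleftrightarrow> integrable lborel (\<lambda>x. f (t + c *\<^sub>R x))" .
qed

lemma lborel_translate:
  fixes f :: "'a::euclidean_space \<Rightarrow> 'b::{banach, second_countable_topology}"
  assumes "f \<in> borel_measurable borel"
  shows "(LINT x|lborel. f (x + t)) = (LINT x|lborel. f x)"
  using lborel_affine_integral(1)[OF assms, of 1 t] by (simp add: add.commute)

lemma norm_quotient_le: "s > 0 \<Longrightarrow> norm x \<le> C * s \<Longrightarrow> norm (x /\<^sub>R s) \<le> C"
  by (simp add: field_simps)

lemma integrable_indicator_cball:
  "integrable lborel (indicator (cball (a :: 'a::euclidean_space) r) :: 'a \<Rightarrow> real)"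
  by (intro integrable_real_indicator emeasure_lborel_cball_finite) simp

lemma difference_quotient_tendsto:
  fixes g :: "'a::euclidean_space \<Rightarrow> 'b::real_normed_vector"
  assumes "(g has_derivative g') (at x)" "s \<longlonglongrightarrow> 0" "\<And>n. s n \<noteq> (0::real)"
  shows "(\<lambda>n. (g (x + s n *\<^sub>R v) - g x) /\<^sub>R s n) \<longlonglongrightarrow> g' v"
proof -
  have "((\<lambda>t. g (x + t *\<^sub>R v)) has_derivative (\<lambda>t. g' (t *\<^sub>R v))) (at 0)"
    by (rule has_derivative_compose[where g = g and g' = g'])
      (auto intro!: derivative_eq_intros assms)
  then have "((\<lambda>t. g (x + t *\<^sub>R v)) has_derivative (\<lambda>t. t *\<^sub>R g' v)) (at 0)"
    using linear_scale[OF has_derivative_linear[OF assms(1)]] by simp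
  then have "((\<lambda>t. norm (g (x + t *\<^sub>R v) - g x - t *\<^sub>R g' v) / norm t) \<longlongrightarrow> 0) (at 0)"
    unfolding has_derivative_at by simp
  moreover have "\<forall>\<^sub>F t in at 0. norm (g (x + t *\<^sub>R v) - g x - t *\<^sub>R g' v) / norm t
      = norm ((g (x + t *\<^sub>R v) - g x) /\<^sub>R t - g' v)"
  proof (rule eventually_at_topological[THEN iffD2], intro exI[of _ UNIV] conjI ballI impI)
    fix t :: real assume "t \<noteq> 0"
    then have "(g (x + t *\<^sub>R v) - g x) /\<^sub>R t - g' v = (g (x + t *\<^sub>R v) - g x - t *\<^sub>R g' v) /\<^sub>R t"
      by (simp add: scaleR_diff_right)
    then show "norm (g (x + t *\<^sub>R v) - g x - t *\<^sub>R g' v) / norm t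
      = norm ((g (x + t *\<^sub>R v) - g x) /\<^sub>R t - g' v)" by (simp add: divide_inverse mult.commute)
  qed auto
  ultimately have "((\<lambda>t. norm ((g (x + t *\<^sub>R v) - g x) /\<^sub>R t - g' v)) \<longlongrightarrow> 0) (at 0)"
    by (rule Lim_transform_eventually)
  then have "((\<lambda>t. (g (x + t *\<^sub>R v) - g x) /\<^sub>R t) \<longlongrightarrow> g' v) (at 0)"
    by (rule LIM_zero_cancel[OF tendsto_norm_zero_cancel])
  then show ?thesis
    by (rule filterlim_compose) (use assms in \<open>auto simp: filterlim_at intro!: always_eventually\<close>)
qed

text \<open>By translation invariance the difference quotients of \<open>g\<close> have integral \<open>0\<close>.\<close>

lemma integral_derivative_compact_support:
  fixes g :: "'a::euclidean_space \<Rightarrow> 'b::euclidean_space"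
  assumes "C1_on UNIV g g'" "compact S" "\<And>x. x \<notin> S \<Longrightarrow> g x = 0"
  shows "(LINT x|lborel. g' x v) = 0"
proof -
  obtain M where M: "M > 0" "\<And>x y. norm (g y - g x) \<le> M * norm (y - x)"
    using C1_on_compact_bounded[OF assms] by metis
  obtain R where R: "R > 0" "\<And>x. x \<in> S \<Longrightarrow> norm x \<le> R" using compact_norm_bound[OF assms(2)] by blast
  define s where "s n = inverse (real (Suc n))" for n
  have s: "s n > 0" "s n \<le> 1" for n unfolding s_def by (auto simp: inverse_le_1_iff)
  have s0: "s \<longlonglongrightarrow> 0" unfolding s_def by (rule LIMSEQ_inverse_real_of_nat)
  have meas: "g \<in> borel_measurable borel"
    using borel_measurable_continuous_onI C1_onD(4)[OF assms(1)] by blast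
  have gi: "integrable lborel g" using integrable_compact_support[OF C1_onD(4)[OF assms(1)] assms(2,3)] .
  have gi': "integrable lborel (\<lambda>x. g (x + t))" for t
    using gi lborel_affine_integral(2)[OF meas, of 1 t] by (simp add: add.commute)
  let ?D = "\<lambda>n x. (g (x + s n *\<^sub>R v) - g x) /\<^sub>R s n"
  have "(\<lambda>n. LINT x|lborel. ?D n x) \<longlonglongrightarrow> (LINT x|lborel. g' x v)"
  proof (rule integral_dominated_convergence)
    show "(\<lambda>x. g' x v) \<in> borel_measurable lborel"
      using borel_measurable_continuous_onI[OF C1_onD(2)[OF assms(1)]] by simp
    show "(\<lambda>x. ?D n x) \<in> borel_measurable lborel" for n using meas by simp
    show "integrable lborel (\<lambda>x. indicator (cball 0 (R + norm v)) x * (M * norm v))"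
      by (intro integrable_mult_left integrable_indicator_cball)
    show "AE x in lborel. (\<lambda>n. ?D n x) \<longlonglongrightarrow> g' x v"
      using s by (intro always_eventually allI difference_quotient_tendsto C1_onD(1)[OF assms(1)] s0)
        (auto simp: less_imp_neq[THEN not_sym])
    show "AE x in lborel. norm (?D n x) \<le> indicator (cball 0 (R + norm v)) x * (M * norm v)" for n
    proof (intro always_eventually allI)
      fix x
      show "norm (?D n x) \<le> indicator (cball 0 (R + norm v)) x * (M * norm v)"
      proof (cases "x \<in> cball 0 (R + norm v)")
        case True
        have "norm (?D n x) \<le> M * norm v"
          using M(2)[of "x + s n *\<^sub>R v" x] s[of n] by (intro norm_quotient_le) (simp_all add: mult_ac)
        then show ?thesis using True by simp
      next
        case False
        have "norm x \<le> norm (x + s n *\<^sub>R v) + norm (s n *\<^sub>R v)" 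
          using norm_triangle_ineq4[of "x + s n *\<^sub>R v" "s n *\<^sub>R v"] by simp
        moreover have "norm (s n *\<^sub>R v) \<le> norm v" using s[of n] by (simp add: mult_left_le_one_le)
        ultimately have "x + s n *\<^sub>R v \<notin> S" "x \<notin> S"
          using False R(1) R(2)[of x] R(2)[of "x + s n *\<^sub>R v"] norm_ge_zero[of v] by (auto simp del: norm_scaleR)
        then show ?thesis using assms(3) False by simp
      qed
    qed
  qed
  moreover have "(LINT x|lborel. ?D n x) = 0" for n
    by (simp add: Bochner_Integration.integral_diff[OF gi' gi] lborel_translate[OF meas])
  ultimately have "(\<lambda>n::nat. 0) \<longlonglongrightarrow> (LINT x|lborel. g' x v)" by (simp only:)
  then show ?thesis using LIMSEQ_unique[OF tendsto_const] by metis
qed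

lemma continuous_on_extend_zero:
  fixes q :: "'a::euclidean_space \<Rightarrow> real" and u :: "'a \<Rightarrow> 'b::real_normed_vector"
  assumes "continuous_on UNIV q" "closed S" "S \<subseteq> W" "open W" "\<And>x. x \<notin> S \<Longrightarrow> q x = 0"
    and "continuous_on W u"
  shows "continuous_on UNIV (\<lambda>x. q x *\<^sub>R u x)"
proof -
  have "continuous_on W (\<lambda>x. q x *\<^sub>R u x)"
    using assms by (intro continuous_intros continuous_on_subset[OF assms(1)]) auto
  moreover have "continuous_on (- S) (\<lambda>x. q x *\<^sub>R u x)"
    by (rule continuous_on_eq[where f = "\<lambda>x. 0"]) (use assms(5) in auto)
  ultimately have "continuous_on (W \<union> - S) (\<lambda>x. q x *\<^sub>R u x)"
    using assms by (intro continuous_on_open_Un) auto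
  moreover have "W \<union> - S = UNIV" using assms(3) by auto
  ultimately show ?thesis by simp
qed

lemma C1_on_extend_zero:
  fixes p :: "'a::euclidean_space \<Rightarrow> real" and u :: "'a \<Rightarrow> 'b::real_normed_vector"
  assumes "C1_on UNIV p p'" "closed S" "S \<subseteq> W" "open W" "\<And>x. x \<notin> S \<Longrightarrow> p x = 0"
    and "C1_on W u u'"
  shows "C1_on UNIV (\<lambda>x. p x *\<^sub>R u x) (\<lambda>x v. p x *\<^sub>R u' x v + p' x v *\<^sub>R u x)"
proof (rule C1_onI)
  have p0: "p' x v = 0" if "x \<notin> S" for x v
    by (rule C1_on_zero_off[OF assms(1,2) _ that]) (rule assms(5))
  show "((\<lambda>x. p x *\<^sub>R u x) has_derivative (\<lambda>v. p x *\<^sub>R u' x v + p' x v *\<^sub>R u x)) (at x)" for x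
  proof (cases "x \<in> W")
    case True
    then show ?thesis
      using C1_onD(1)[OF assms(1)] C1_onD(1)[OF assms(6)] by (intro has_derivative_scaleR) auto
  next
    case False
    then have x: "x \<notin> S" using assms(3) by auto
    have "((\<lambda>x. p x *\<^sub>R u x) has_derivative (\<lambda>v. 0)) (at x)"
      by (rule has_derivative_transform_within_open[where f = "\<lambda>x. 0" and s = "- S"])
        (use assms x in auto)
    then show ?thesis using x p0 assms(5) by simp
  qed
  show "continuous_on UNIV (\<lambda>x. p x *\<^sub>R u' x v + p' x v *\<^sub>R u x)" for v
    by (intro continuous_on_add continuous_on_extend_zero[where S = S and W = W])
      (use assms p0 C1_onD(4)[OF assms(1)] C1_onD(2)[OF assms(1)] C1_onD(4)[OF assms(6)]
        C1_onD(2)[OF assms(6)] in auto)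
qed

lemma integral_by_parts:
  fixes p :: "'a::euclidean_space \<Rightarrow> real" and u :: "'a \<Rightarrow> 'b::euclidean_space"
  assumes "C1_on UNIV p p'" "compact S" "S \<subseteq> W" "open W" "\<And>x. x \<notin> S \<Longrightarrow> p x = 0"
    and "C1_on W u u'"
  shows "(LINT x|lborel. p' x v *\<^sub>R u x) = - (LINT x|lborel. p x *\<^sub>R u' x v)"
proof -
  have p0: "p' x v = 0" if "x \<notin> S" for x
    by (rule C1_on_zero_off[OF assms(1) compact_imp_closed[OF assms(2)] _ that]) (rule assms(5))
  have "integrable lborel (\<lambda>x. p x *\<^sub>R u' x v)" "integrable lborel (\<lambda>x. p' x v *\<^sub>R u x)"
    by (auto intro!: integrable_compact_support[where S = S]
        continuous_on_extend_zero[where S = S and W = W] assms compact_imp_closed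
        simp: assms(5) p0 C1_onD(4)[OF assms(1)] C1_onD(2)[OF assms(1)] C1_onD(4)[OF assms(6)]
        C1_onD(2)[OF assms(6)])
  moreover have "(LINT x|lborel. p x *\<^sub>R u' x v + p' x v *\<^sub>R u x) = 0"
    by (rule integral_derivative_compact_support[OF C1_on_extend_zero[OF assms(1) _ assms(3,4,5,6)] assms(2)])
      (use assms(2,5) in \<open>auto intro: compact_imp_closed\<close>)
  ultimately show ?thesis by (simp add: add_eq_0_iff)
qed

text \<open>
  Two partial derivatives may be exchanged between the factors. For twice differentiable factors
  this is two integrations by parts; for difference quotients of merely continuously
  differentiable factors it is the invariance of Lebesgue measure under translations.
\<close>

lemma integral_swap_derivatives:
  fixes g :: "'a::euclidean_space \<Rightarrow> real" and u :: "'a \<Rightarrow> 'b::euclidean_space"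
  assumes g: "C1_on UNIV g g'" "compact S" "\<And>x. x \<notin> S \<Longrightarrow> g x = 0" and u: "C1_on UNIV u u'"
  shows "(LINT x|lborel. g' x a *\<^sub>R u' x b) = (LINT x|lborel. g' x b *\<^sub>R u' x a)"
proof -
  define s where "s n = inverse (real (Suc n))" for n
  have s: "s n > 0" "s n \<noteq> 0" "s n \<le> 1" for n unfolding s_def by (auto simp: inverse_le_1_iff)
  have s0: "s \<longlonglongrightarrow> 0" unfolding s_def by (rule LIMSEQ_inverse_real_of_nat)
  define G where "G v n x = (g (x + s n *\<^sub>R v) - g x) /\<^sub>R s n" for v n x
  define V where "V v n x = (u (x + s n *\<^sub>R v) - u x) /\<^sub>R s n" for v n x
  have cg: "continuous_on UNIV g" and cu: "continuous_on UNIV u"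
    using C1_onD(4) g(1) u by auto
  have meas: "g \<in> borel_measurable borel" "u \<in> borel_measurable borel"
    using borel_measurable_continuous_onI cg cu by auto
  obtain M where M: "M > 0" "\<And>x y. norm (g y - g x) \<le> M * norm (y - x)"
    using C1_on_compact_bounded[OF g] by metis
  obtain R where R: "R > 0" "\<And>x. x \<in> S \<Longrightarrow> norm x \<le> R" using compact_norm_bound[OF g(2)] by blast
  have lim: "(\<lambda>n. LINT x|lborel. G a n x *\<^sub>R V b n x) \<longlonglongrightarrow> (LINT x|lborel. g' x a *\<^sub>R u' x b)" for a b
  proof -
    obtain N where N: "N > 0" "\<And>x v. x \<in> cball 0 (R + norm a + norm b) \<Longrightarrow> norm (u' x v) \<le> N * norm v"
      using C1_on_bounded[OF u compact_cball subset_UNIV] by metis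
    show ?thesis
    proof (rule integral_dominated_convergence)
      show "(\<lambda>x. g' x a *\<^sub>R u' x b) \<in> borel_measurable lborel"
        using borel_measurable_continuous_onI[OF C1_onD(2)[OF g(1)]]
          borel_measurable_continuous_onI[OF C1_onD(2)[OF u]] by simp
      show "(\<lambda>x. G a n x *\<^sub>R V b n x) \<in> borel_measurable lborel" for n
        unfolding G_def V_def using meas by simp
      show "integrable lborel (\<lambda>x. indicator (cball 0 (R + norm a)) x * ((M * norm a) * (N * norm b)))"
        by (intro integrable_mult_left integrable_indicator_cball)
      show "AE x in lborel. (\<lambda>n. G a n x *\<^sub>R V b n x) \<longlonglongrightarrow> g' x a *\<^sub>R u' x b"
        unfolding G_def V_def using C1_onD(1)[OF g(1)] C1_onD(1)[OF u]
        by (intro always_eventually allI tendsto_scaleR difference_quotient_tendsto s0 s) auto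
      show "AE x in lborel. norm (G a n x *\<^sub>R V b n x)
          \<le> indicator (cball 0 (R + norm a)) x * ((M * norm a) * (N * norm b))" for n
      proof (intro always_eventually allI)
        fix x
        have sm: "norm (s n *\<^sub>R v) \<le> norm v" for v :: 'a
          using s[of n] by (simp add: mult_left_le_one_le)
        show "norm (G a n x *\<^sub>R V b n x)
          \<le> indicator (cball 0 (R + norm a)) x * ((M * norm a) * (N * norm b))"
        proof (cases "x \<in> cball 0 (R + norm a)")
          case True
          have 1: "norm (G a n x) \<le> M * norm a"
            unfolding G_def using M(2)[of "x + s n *\<^sub>R a" x] s[of n]
            by (intro norm_quotient_le) (simp_all add: mult_ac)
          have "norm (u (x + s n *\<^sub>R b) - u x) \<le> N * norm (x + s n *\<^sub>R b - x)"
          proof (rule C1_on_lipschitz[OF u convex_cball subset_UNIV N(2)])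
            show "x + s n *\<^sub>R b \<in> cball 0 (R + norm a + norm b)"
              using True sm[of b] norm_triangle_ineq[of x "s n *\<^sub>R b"] by simp
            show "x \<in> cball 0 (R + norm a + norm b)"
              using True norm_ge_zero[of b] by (simp del: norm_ge_zero)
          qed
          then have 2: "norm (V b n x) \<le> N * norm b"
            unfolding V_def using s[of n] by (intro norm_quotient_le) (simp_all add: mult_ac)
          have "norm (G a n x) * norm (V b n x) \<le> (M * norm a) * (N * norm b)"
            using M(1) by (intro mult_mono 1 2) auto
          then show ?thesis using True by simp
        next
          case False
          have "norm x \<le> norm (x + s n *\<^sub>R a) + norm (s n *\<^sub>R a)"
            using norm_triangle_ineq4[of "x + s n *\<^sub>R a" "s n *\<^sub>R a"] by simp
          then have "x + s n *\<^sub>R a \<notin> S" "x \<notin> S"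
            using False R(1) R(2)[of x] R(2)[of "x + s n *\<^sub>R a"] sm[of a] norm_ge_zero[of a] by (auto simp del: norm_scaleR)
          then show ?thesis using g(3) False by (simp add: G_def)
        qed
      qed
    qed
  qed
  define J where "J c d = (LINT x|lborel. g (x + c) *\<^sub>R u (x + d))" for c d
  have Jint: "integrable lborel (\<lambda>x. g (x + c) *\<^sub>R u (x + d))" for c d
  proof (rule integrable_compact_support[where S = "cball 0 (R + norm c)"])
    have "continuous_on UNIV (\<lambda>x::'a. g (x + c))" "continuous_on UNIV (\<lambda>x::'a. u (x + d))"
      by (rule continuous_on_compose2[OF cg] continuous_on_compose2[OF cu]; auto intro!: continuous_intros)+
    then show "continuous_on UNIV (\<lambda>x. g (x + c) *\<^sub>R u (x + d))" by (intro continuous_intros)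
    fix x :: 'a assume "x \<notin> cball 0 (R + norm c)"
    then have "x + c \<notin> S" using R(2)[of "x + c"] norm_triangle_ineq4[of "x + c" c] by auto
    then show "g (x + c) *\<^sub>R u (x + d) = 0" using g(3) by simp
  qed auto
  have Jt: "J (c + t) (d + t) = J c d" for c d t
  proof -
    have "(\<lambda>x. g (x + c) *\<^sub>R u (x + d)) \<in> borel_measurable borel"
      using borel_measurable_integrable[OF Jint] by simp
    from lborel_translate[OF this, of t] show ?thesis
      unfolding J_def by (simp add: add.assoc add.commute[of t])
  qed
  have GV: "(LINT x|lborel. G a n x *\<^sub>R V b n x)
      = (J (s n *\<^sub>R a) (s n *\<^sub>R b) - J (s n *\<^sub>R a) 0 - J 0 (s n *\<^sub>R b) + J 0 0) /\<^sub>R (s n * s n)" for a b n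
  proof -
    have "(\<lambda>x. G a n x *\<^sub>R V b n x) = (\<lambda>x. (g (x + s n *\<^sub>R a) *\<^sub>R u (x + s n *\<^sub>R b)
        - g (x + s n *\<^sub>R a) *\<^sub>R u (x + 0) - g (x + 0) *\<^sub>R u (x + s n *\<^sub>R b) + g (x + 0) *\<^sub>R u (x + 0)) /\<^sub>R (s n * s n))"
      unfolding G_def V_def by (auto simp: fun_eq_iff algebra_simps)
    then show ?thesis
      unfolding J_def
      by (simp only: integral_scaleR_right Bochner_Integration.integral_add
          Bochner_Integration.integral_diff Jint Bochner_Integration.integrable_diff)
  qed
  have "(LINT x|lborel. G a n x *\<^sub>R V b n x) = (LINT x|lborel. G (-b) n x *\<^sub>R V (-a) n x)" for n
    unfolding GV
    using Jt[of "- (s n *\<^sub>R b)" "s n *\<^sub>R a + s n *\<^sub>R b" "- (s n *\<^sub>R a)"]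
      Jt[of "- (s n *\<^sub>R b)" "s n *\<^sub>R b" 0] Jt[of 0 "s n *\<^sub>R a" "- (s n *\<^sub>R a)"]
    by (simp add: algebra_simps)
  then have "(LINT x|lborel. g' x a *\<^sub>R u' x b) = (LINT x|lborel. g' x (-b) *\<^sub>R u' x (-a))"
    using lim[of a b] lim[of "-b" "-a"] LIMSEQ_unique by simp
  also have "\<dots> = (LINT x|lborel. g' x b *\<^sub>R u' x a)"
    using linear_neg[OF C1_onD(3)[OF g(1)]] linear_neg[OF C1_onD(3)[OF u]] by simp
  finally show ?thesis .
qed

lemma continuous_on_convolution:
  fixes K :: "'v::euclidean_space \<Rightarrow> real" and G :: "'a::euclidean_space \<Rightarrow> 'b::euclidean_space"
  assumes "integrable lborel K" "continuous_on UNIV G" "compact S" "\<And>x. x \<notin> S \<Longrightarrow> G x = 0"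
    and "T \<in> borel_measurable borel"
  shows "continuous_on UNIV (\<lambda>x. LINT y|lborel. K y *\<^sub>R G (x + T y))"
    and "integrable lborel (\<lambda>y. K y *\<^sub>R G (x + T y))"
proof -
  obtain M where M: "\<And>x. norm (G x) \<le> M"
  proof -
    have "bounded (G ` S)"
      using assms by (meson compact_continuous_image compact_imp_bounded continuous_on_subset subset_UNIV)
    then obtain M where "M > 0" "\<And>x. x \<in> S \<Longrightarrow> norm (G x) \<le> M" unfolding bounded_pos by auto
    then show ?thesis using that[of M] assms(4) by (metis less_imp_le norm_zero)
  qed
  have [measurable]: "G \<in> borel_measurable borel" "T \<in> borel_measurable borel" "K \<in> borel_measurable borel"
    using assms borel_measurable_continuous_onI borel_measurable_integrable[OF assms(1)] by auto
  have b: "norm (K y *\<^sub>R G z) \<le> norm (M * K y)" for y z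
    using mult_left_mono[OF M[of z] abs_ge_zero[of "K y"]] order_trans[OF norm_ge_zero M[of z]]
    by (simp add: abs_mult mult.commute)
  show "integrable lborel (\<lambda>y. K y *\<^sub>R G (x + T y))"
    by (rule Bochner_Integration.integrable_bound[of _ "\<lambda>y. M * K y"]) (use assms(1) b in auto)
  show "continuous_on UNIV (\<lambda>x. LINT y|lborel. K y *\<^sub>R G (x + T y))"
    unfolding continuous_on_sequentially
  proof (intro allI ballI impI, unfold o_def)
    fix X :: "nat \<Rightarrow> 'a" and x assume X: "(\<forall>n. X n \<in> UNIV) \<and> X \<longlonglongrightarrow> x"
    show "(\<lambda>n. LINT y|lborel. K y *\<^sub>R G (X n + T y)) \<longlonglongrightarrow> (LINT y|lborel. K y *\<^sub>R G (x + T y))"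
    proof (rule integral_dominated_convergence[where w = "\<lambda>y. norm (M * K y)"])
      show "AE y in lborel. (\<lambda>n. K y *\<^sub>R G (X n + T y)) \<longlonglongrightarrow> K y *\<^sub>R G (x + T y)"
        using X by (intro always_eventually allI tendsto_intros
            continuous_on_tendsto_compose[OF assms(2)]) auto
    qed (use assms(1) b in auto)
  qed
qed

text \<open>
  All derivatives fall on the smooth factor, so that the kernel only has to be integrable. The shift \<open>T\<close> may
  lead into a larger space; this covers convolutions in one of two vector variables.
\<close>

lemma C1_on_convolution:
  fixes K :: "'v::euclidean_space \<Rightarrow> real" and g :: "'a::euclidean_space \<Rightarrow> 'b::euclidean_space"
  assumes "integrable lborel K" "C1_on UNIV g g'" "compact S" "\<And>x. x \<notin> S \<Longrightarrow> g x = 0"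
    and "T \<in> borel_measurable borel"
  shows "C1_on UNIV (\<lambda>x. LINT y|lborel. K y *\<^sub>R g (x + T y)) (\<lambda>x v. LINT y|lborel. K y *\<^sub>R g' (x + T y) v)"
proof (rule C1_onI)
  have g0: "g' x v = 0" if "x \<notin> S" for x v
    by (rule C1_on_zero_off[OF assms(2) compact_imp_closed[OF assms(3)] _ that]) (rule assms(4))
  note i0 = continuous_on_convolution(2)[OF assms(1) C1_onD(4)[OF assms(2)] assms(3,4,5)]
  note i1 = continuous_on_convolution(2)[OF assms(1) C1_onD(2)[OF assms(2)] assms(3) g0 assms(5)]
  show "continuous_on UNIV (\<lambda>x. LINT y|lborel. K y *\<^sub>R g' (x + T y) v)" for v
    by (rule continuous_on_convolution(1)[OF assms(1) C1_onD(2)[OF assms(2)] assms(3) g0 assms(5)])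
  fix x :: 'a
  have lin: "linear (g' z)" for z using C1_onD(3)[OF assms(2)] by simp
  let ?F = "\<lambda>x. LINT y|lborel. K y *\<^sub>R g (x + T y)" and ?D = "\<lambda>v. LINT y|lborel. K y *\<^sub>R g' (x + T y) v"
  have "linear ?D"
  proof (rule linearI)
    show "?D (r *\<^sub>R b) = r *\<^sub>R ?D b" for r b
      by (simp only: linear_scale[OF lin] scaleR_left_commute[of _ r] integral_scaleR_right)
  qed (simp add: linear_add[OF lin] scaleR_add_right i1)
  moreover have est: "\<exists>d>0. \<forall>h. norm h < d \<longrightarrow> norm (?F (x + h) - ?F x - ?D h) \<le> e * norm h" if "e > 0" for e
  proof -
    define A where "A = (LINT y|lborel. norm (K y)) + 1"
    have A: "A > 0" unfolding A_def by (intro add_nonneg_pos integral_nonneg_AE) auto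
    have "e / A > 0" using A that by simp
    from C1_on_uniformly_differentiable[OF assms(2) assms(3) assms(4) this]
    obtain d where d: "d > 0" "\<And>z h. norm h < d \<Longrightarrow> norm (g (z + h) - g z - g' z h) \<le> (e / A) * norm h"
      by blast
    have "norm (?F (x + h) - ?F x - ?D h) \<le> e * norm h" if h: "norm h < d" for h
    proof -
      have "?F (x + h) - ?F x - ?D h = (LINT y|lborel. K y *\<^sub>R (g (x + T y + h) - g (x + T y) - g' (x + T y) h))"
        using i0[of x] i0[of "x + h"] i1[of x h]
        by (simp add: scaleR_diff_right algebra_simps)
      also have "norm \<dots> \<le> (LINT y|lborel. norm (K y) * ((e / A) * norm h))"
      proof (rule Bochner_Integration.integral_norm_bound_integral)
        have "(\<lambda>y. K y *\<^sub>R (g (x + T y + h) - g (x + T y) - g' (x + T y) h))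
            = (\<lambda>y. K y *\<^sub>R g ((x + h) + T y) - K y *\<^sub>R g (x + T y) - K y *\<^sub>R g' (x + T y) h)"
          by (auto simp: scaleR_diff_right algebra_simps)
        then show "integrable lborel (\<lambda>y. K y *\<^sub>R (g (x + T y + h) - g (x + T y) - g' (x + T y) h))"
          using i0 i1 by simp
        show "norm (K y *\<^sub>R (g (x + T y + h) - g (x + T y) - g' (x + T y) h)) \<le> norm (K y) * ((e / A) * norm h)" for y
          using mult_left_mono[OF d(2)[OF h, of "x + T y"] norm_ge_zero[of "K y"]] by simp
      qed (use assms(1) in auto)
      also have "\<dots> = (A - 1) * ((e / A) * norm h)" unfolding A_def by simp
      also have "\<dots> \<le> A * ((e / A) * norm h)"
        using A \<open>e > 0\<close> by (intro mult_right_mono) auto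
      also have "\<dots> = e * norm h" using A by simp
      finally show ?thesis .
    qed
    with d(1) show ?thesis by blast
  qed
  moreover have "\<exists>d>0. \<forall>y. norm (y - x) < d \<longrightarrow> norm (?F y - ?F x - ?D (y - x)) \<le> e * norm (y - x)" if e: "e > 0" for e
  proof -
    obtain d where d: "d > 0" "\<And>h. norm h < d \<Longrightarrow> norm (?F (x + h) - ?F x - ?D h) \<le> e * norm h"
      using est[OF e] by blast
    have "x + (y - x) = y" for y by simp
    from d(2)[of "_ - x", unfolded this] d(1) show ?thesis by blast
  qed
  ultimately show "(?F has_derivative ?D) (at x)"
    unfolding has_derivative_at_alt by (simp add: linear_conv_bounded_linear)
qed

lemma C1_on_cong_open:
  assumes "C1_on U f f'" "open U" "\<And>x. x \<in> U \<Longrightarrow> f x = g x" "\<And>x v. x \<in> U \<Longrightarrow> f' x v = g' x v"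
  shows "C1_on U g g'"
proof (rule C1_onI)
  fix x assume x: "x \<in> U"
  have "f' x = g' x" using assms(4)[OF x] by auto
  then show "(g has_derivative g' x) (at x)"
    using has_derivative_transform_within_open[OF C1_onD(1)[OF assms(1) x] assms(2) x assms(3)] by simp
next
  show "continuous_on U (\<lambda>x. g' x v)" for v
    using C1_onD(2)[OF assms(1), of v] assms(4) by (rule continuous_on_eq)
qed

lemma C1_on_UN: "(\<And>i. open (U i)) \<Longrightarrow> (\<And>i. C1_on (U i) f f') \<Longrightarrow> C1_on (\<Union>i. U i) f f'"
  unfolding C1_on_def by (auto intro!: continuous_on_open_UN)

text \<open>
  As \<open>g\<close> has compact support, for \<open>x\<close> in a ball only a bounded part of the kernel contributes.
\<close>

lemma C1_on_convolution_local:
  fixes K :: "'v::euclidean_space \<Rightarrow> real" and g :: "'a::euclidean_space \<Rightarrow> 'b::euclidean_space"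
  assumes K: "\<And>R. integrable lborel (\<lambda>y. indicator (cball 0 R) y *\<^sub>R K y)"
    and g: "C1_on UNIV g g'" "compact S" "\<And>x. x \<notin> S \<Longrightarrow> g x = 0"
    and T: "T \<in> borel_measurable borel" "\<And>y. norm (T y) = norm y"
  shows "C1_on UNIV (\<lambda>x. LINT y|lborel. K y *\<^sub>R g (x + T y)) (\<lambda>x v. LINT y|lborel. K y *\<^sub>R g' (x + T y) v)"
proof -
  obtain R where R: "R > 0" "\<And>x. x \<in> S \<Longrightarrow> norm x \<le> R" using compact_norm_bound[OF g(2)] by blast
  define k where "k m y = indicator (cball 0 (real m + R)) y *\<^sub>R K y" for m y
  have g0: "g' x v = 0" if "x \<notin> S" for x v
    by (rule C1_on_zero_off[OF g(1) compact_imp_closed[OF g(2)] _ that]) (rule g(3))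
  have *: "x + T y \<notin> S" if "x \<in> ball 0 (real m)" "y \<notin> cball 0 (real m + R)" for x y m
  proof -
    have "norm (T y) \<le> norm (x + T y) + norm x" using norm_triangle_ineq4[of "x + T y" x] by simp
    then show ?thesis using that R(2)[of "x + T y"] T(2)[of y] by auto
  qed
  have e0: "k m y *\<^sub>R g (x + T y) = K y *\<^sub>R g (x + T y)"
    and e1: "k m y *\<^sub>R g' (x + T y) v = K y *\<^sub>R g' (x + T y) v" if "x \<in> ball 0 (real m)" for m x y v
    using *[OF that, of y] g(3) g0 by (cases "y \<in> cball 0 (real m + R)"; simp add: k_def)+
  have "C1_on (ball 0 (real m)) (\<lambda>x. LINT y|lborel. K y *\<^sub>R g (x + T y)) (\<lambda>x v. LINT y|lborel. K y *\<^sub>R g' (x + T y) v)" for m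
  proof (rule C1_on_cong_open[OF C1_on_subset[OF C1_on_convolution[OF _ g(1,2) _ T(1)] subset_UNIV]])
    show "integrable lborel (k m)" unfolding k_def by (rule K)
    show "g x = 0" if "x \<notin> S" for x using g(3)[OF that] .
  qed (simp_all add: e0 e1)
  note loc = this
  show "C1_on UNIV (\<lambda>x. LINT y|lborel. K y *\<^sub>R g (x + T y)) (\<lambda>x v. LINT y|lborel. K y *\<^sub>R g' (x + T y) v)"
  proof -
    have "(\<Union>m::nat. ball (0::'a) (real m)) = UNIV"
      using reals_Archimedean2 by (force simp: dist_norm)
    with C1_on_UN[of "\<lambda>m::nat. ball (0::'a) (real m)", OF _ loc] show ?thesis by simp
  qed
qed

lemma has_real_derivative_integral:
  fixes f :: "real \<Rightarrow> 'z \<Rightarrow> real"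
  assumes "r > 0" "\<And>s. \<bar>s - t\<bar> < r \<Longrightarrow> integrable M (f s)"
    and d: "\<And>s z. \<bar>s - t\<bar> < r \<Longrightarrow> ((\<lambda>s. f s z) has_real_derivative f' s z) (at s)"
    and b: "\<And>s z. \<bar>s - t\<bar> < r \<Longrightarrow> \<bar>f' s z\<bar> \<le> w z" and "integrable M w"
  shows "((\<lambda>s. LINT z|M. f s z) has_real_derivative (LINT z|M. f' t z)) (at t)"
  unfolding DERIV_def tendsto_at_iff_sequentially
proof (intro allI impI, unfold o_def)
  fix X :: "nat \<Rightarrow> real" assume X: "\<forall>i. X i \<in> UNIV - {0}" "X \<longlonglongrightarrow> 0"
  let ?Q = "\<lambda>n z. (f (t + X n) z - f t z) / X n"
  obtain N where N: "\<And>n. n \<ge> N \<Longrightarrow> \<bar>X n\<bar> < r"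
    using X(2) assms(1) unfolding LIMSEQ_iff by (metis diff_zero real_norm_def)
  have int: "integrable M (f (t + X (n + N)))" "integrable M (f t)" for n
    using assms(2)[of "t + X (n + N)"] assms(2)[of t] N[of "n + N"] assms(1) by auto
  have lim: "(\<lambda>n. ?Q (n + N) z) \<longlonglongrightarrow> f' t z" for z
  proof -
    have "((\<lambda>h. (f (t + h) z - f t z) / h) \<longlongrightarrow> f' t z) (at 0)"
      using d[of t z] assms(1) by (simp add: DERIV_def)
    then have "(\<lambda>n. ?Q n z) \<longlonglongrightarrow> f' t z"
      unfolding tendsto_at_iff_sequentially o_def using X by blast
    then show ?thesis by (rule LIMSEQ_ignore_initial_segment)
  qed
  have "(\<lambda>n. LINT z|M. ?Q (n + N) z) \<longlonglongrightarrow> (LINT z|M. f' t z)"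
  proof (rule integral_dominated_convergence[OF _ _ assms(5)])
    show m: "(\<lambda>z. ?Q (n + N) z) \<in> borel_measurable M" for n using int by auto
    show "f' t \<in> borel_measurable M" by (rule borel_measurable_LIMSEQ_real[OF _ m]) (rule lim)
    show "AE z in M. norm (?Q (n + N) z) \<le> w z" for n
    proof (intro always_eventually allI)
      fix z
      have "norm (f (t + X (n + N)) z - f t z) \<le> w z * norm (t + X (n + N) - t)"
      proof (rule field_differentiable_bound[of "{s. \<bar>s - t\<bar> < r}" "\<lambda>s. f s z" "\<lambda>s. f' s z"])
        have "{s. \<bar>s - t\<bar> < r} = ball t r" by (auto simp: dist_real_def)
        then show "convex {s. \<bar>s - t\<bar> < r}" by simp
      qed (use d b N[of "n + N"] assms(1) in \<open>auto intro: has_field_derivative_at_within\<close>)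
      then show "norm (?Q (n + N) z) \<le> w z" using X(1) by (simp add: field_simps)
    qed
  qed (use lim in auto)
  then have "(\<lambda>n. ((LINT z|M. f (t + X (n + N)) z) - (LINT z|M. f t z)) / X (n + N)) \<longlonglongrightarrow> (LINT z|M. f' t z)"
    using int by simp
  then show "(\<lambda>n. ((LINT z|M. f (t + X n) z) - (LINT z|M. f t z)) / X n) \<longlonglongrightarrow> (LINT z|M. f' t z)"
    by (rule LIMSEQ_offset)
qed

section \<open>Functions with the mean value property\<close>

text \<open>
  These polynomial bumps are of class \<open>C\<^sup>k\<^sup>-\<^sup>1\<close>, and their derivatives are polynomials times bumps of smaller
  exponent. So all test functions and their derivatives are explicit.
\<close>

definition bump :: "nat \<Rightarrow> 'a::euclidean_space \<Rightarrow> real" where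
  "bump k y = max 0 (1 - y \<bullet> y) ^ k"

lemma has_real_derivative_max_power:
  fixes s :: real
  assumes "k \<ge> 2"
  shows "((\<lambda>s. max 0 s ^ k) has_real_derivative real k * max 0 s ^ (k - 1)) (at s)"
proof -
  obtain j where k: "k = Suc (Suc j)" using assms by (metis add_2_eq_Suc le_Suc_ex)
  consider "s > 0" | "s < 0" | "s = 0" by linarith
  then show ?thesis
  proof cases
    case 1
    have "((\<lambda>s. s ^ k) has_real_derivative real k * s ^ (k - 1)) (at s)"
      by (auto intro!: derivative_eq_intros)
    then have "((\<lambda>s. max 0 s ^ k) has_real_derivative real k * s ^ (k - 1)) (at s)"
      by (rule has_field_derivative_transform_within_open[where S = "{0<..}"]) (use 1 in auto)
    then show ?thesis using 1 by simp
  next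
    case 2
    have "((\<lambda>s. 0) has_real_derivative 0) (at s)" by simp
    then have "((\<lambda>s. max 0 s ^ k) has_real_derivative 0) (at s)"
      by (rule has_field_derivative_transform_within_open[where S = "{..<0}"]) (use 2 k in auto)
    then show ?thesis using 2 k by simp
  next
    case 3
    have "((\<lambda>h. max 0 h ^ k / h) \<longlongrightarrow> 0) (at (0::real))"
    proof (rule Lim_null_comparison)
      have "norm (max 0 h ^ k / h) \<le> \<bar>h\<bar> ^ Suc j" if "h \<noteq> 0" for h :: real
      proof (cases "h > 0")
        case False
        then have "max 0 h ^ k / h = 0" using k by simp
        then have "norm (max 0 h ^ k / h) = 0" by (simp only: norm_zero)
        then show ?thesis by (simp only: zero_le_power abs_ge_zero)
      next
        case True
        then have "max 0 h = h" by simp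
        then show ?thesis using True by (simp add: k)
      qed
      then show "\<forall>\<^sub>F h in at (0::real). norm (max 0 h ^ k / h) \<le> \<bar>h\<bar> ^ Suc j"
        by (auto simp: eventually_at intro!: exI[of _ 1])
      show "((\<lambda>h. \<bar>h\<bar> ^ Suc j) \<longlongrightarrow> 0) (at (0::real))"
        by (rule tendsto_eq_intros | simp)+
    qed
    then show ?thesis using 3 k by (simp add: DERIV_def)
  qed
qed

lemma bump_nonneg: "bump k y \<ge> 0" and bump_le_1: "bump k y \<le> 1"
  unfolding bump_def by (auto intro!: power_le_one)

lemma bump_eq_0: "k > 0 \<Longrightarrow> norm y \<ge> 1 \<Longrightarrow> bump k y = 0"
  using power_mono[of 1 "norm y" 2] by (simp add: bump_def power2_norm_eq_inner)

lemma continuous_on_bump: "continuous_on UNIV (bump k)"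
  unfolding bump_def by (intro continuous_intros)

lemma C1_on_bump:
  assumes "k \<ge> 2"
  shows "C1_on UNIV (bump k :: 'a::euclidean_space \<Rightarrow> real) (\<lambda>y v. - (2 * real k) * (y \<bullet> v) * bump (k - 1) y)"
proof (rule C1_onI)
  fix y :: 'a
  have "((\<lambda>y. max 0 (1 - y \<bullet> y) ^ k) has_derivative
      (\<lambda>v. (real k * max 0 (1 - y \<bullet> y) ^ (k - 1)) * (- (2 * (y \<bullet> v))))) (at y)"
    by (rule has_derivative_compose[of "\<lambda>y. 1 - y \<bullet> y" "\<lambda>v. - (2 * (y \<bullet> v))" y UNIV "\<lambda>s. max 0 s ^ k"])
      (use has_real_derivative_max_power[OF assms] in
        \<open>auto intro!: derivative_eq_intros simp: has_field_derivative_def inner_commute fun_eq_iff\<close>)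
  then show "(bump k has_derivative (\<lambda>v. - (2 * real k) * (y \<bullet> v) * bump (k - 1) y)) (at y)"
    by (simp add: bump_def[abs_def] mult_ac)
qed (intro continuous_intros continuous_on_bump)

lemma bump_at_eq_0:
  assumes "k > 0" "t > 0" "z \<notin> cball x t"
  shows "bump k ((z - x) /\<^sub>R t) = 0"
proof (rule bump_eq_0[OF assms(1)])
  have "t < norm (z - x)" using assms(3) by (simp add: dist_norm norm_minus_commute)
  then have "1 \<le> norm (z - x) / t" using assms(2) by (simp del: norm_le_zero_iff)
  then show "1 \<le> norm ((z - x) /\<^sub>R t)" using assms(2) by (simp add: divide_inverse mult.commute)
qed

lemma continuous_on_bump_at: "continuous_on UNIV (\<lambda>z. bump k ((z - x) /\<^sub>R t))"
  by (rule continuous_on_compose2[OF continuous_on_bump]) (auto intro!: continuous_intros)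

lemma C1_on_bump_at:
  assumes "k \<ge> 2"
  shows "C1_on UNIV (\<lambda>z::'a::euclidean_space. bump k ((z - x) /\<^sub>R t))
    (\<lambda>z v. - (2 * real k / t\<^sup>2) * ((z - x) \<bullet> v) * bump (k - 1) ((z - x) /\<^sub>R t))"
proof -
  have "C1_on UNIV (\<lambda>z. bump k (z /\<^sub>R t + - x /\<^sub>R t))
    (\<lambda>z v. - (2 * real k) * ((z /\<^sub>R t + - x /\<^sub>R t) \<bullet> (v /\<^sub>R t)) * bump (k - 1) (z /\<^sub>R t + - x /\<^sub>R t))"
    by (rule C1_on_affine[OF C1_on_bump[OF assms], of "\<lambda>z. z /\<^sub>R t"]) (auto intro!: linearI simp: scaleR_add_right)
  moreover have "z /\<^sub>R t + - x /\<^sub>R t = (z - x) /\<^sub>R t" for z by (simp add: scaleR_diff_right)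
  ultimately show ?thesis by (simp add: power2_eq_square divide_inverse mult_ac)
qed

text \<open>
  The second derivatives, written in a form which is visibly symmetric in the two directions.
\<close>

lemma C1_on_bump_at_derivative:
  assumes "k \<ge> 3"
  shows "C1_on UNIV (\<lambda>z::'a::euclidean_space. - (2 * real k / t\<^sup>2) * ((z - x) \<bullet> v) * bump (k - 1) ((z - x) /\<^sub>R t))
    (\<lambda>z w. - (2 * real k / t\<^sup>2) * ((w \<bullet> v) * bump (k - 1) ((z - x) /\<^sub>R t)
      - (2 * (real k - 1) / t\<^sup>2) * ((z - x) \<bullet> v) * ((z - x) \<bullet> w) * bump (k - 2) ((z - x) /\<^sub>R t)))"
proof -
  have "C1_on UNIV (\<lambda>z. - (2 * real k / t\<^sup>2) * ((z - x) \<bullet> v)) (\<lambda>z w. - (2 * real k / t\<^sup>2) * (w \<bullet> v))"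
  proof (rule C1_onI)
    show "((\<lambda>z. c * ((z - x) \<bullet> v)) has_derivative (\<lambda>w. c * (w \<bullet> v))) (at z)" for c z
      by (intro has_derivative_mult_right) (auto intro!: derivative_eq_intros)
  qed auto
  moreover have k: "k - 1 \<ge> 2" "k - 1 - 1 = k - 2" "real (k - 1) = real k - 1" using assms by auto
  note C1_on_bump_at[OF k(1), where x = x and t = t, unfolded k]
  ultimately have "C1_on UNIV (\<lambda>z. (- (2 * real k / t\<^sup>2) * ((z - x) \<bullet> v)) *\<^sub>R bump (k - 1) ((z - x) /\<^sub>R t))
    (\<lambda>z w. (- (2 * real k / t\<^sup>2) * ((z - x) \<bullet> v)) *\<^sub>R (- (2 * (real k - 1) / t\<^sup>2) * ((z - x) \<bullet> w) * bump (k - 2) ((z - x) /\<^sub>R t))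
      + (- (2 * real k / t\<^sup>2) * (w \<bullet> v)) *\<^sub>R bump (k - 1) ((z - x) /\<^sub>R t))"
    by (intro C1_on_scaleR)
  moreover have "(- c * a) * (- m * b * p) + (- c * w) * q = - c * (w * q - m * a * b * p)"
    for a b c m p q w :: real by (simp add: algebra_simps)
  ultimately show ?thesis by (simp only: real_scaleR_def)
qed

definition bump_mass :: "'a::euclidean_space itself \<Rightarrow> nat \<Rightarrow> real" where
  "bump_mass _ k = (LINT y|lborel. bump k (y::'a))"

lemma bump_mass_pos:
  assumes "k > 0"
  shows "bump_mass TYPE('a::euclidean_space) k > 0"
proof -
  have i: "integrable lborel (bump k :: 'a \<Rightarrow> real)"
    by (rule integrable_compact_support[OF continuous_on_bump, of "cball 0 1"]) (simp_all add: assms bump_eq_0)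
  have "0 < (3/4) ^ k * measure lborel (cball (0::'a) (1/2))"
    using content_cball_pos[of "1/2" "0::'a"] by simp
  also have "\<dots> = (LINT y|lborel. indicator (cball (0::'a) (1/2)) y * (3/4) ^ k)" by simp
  also have "\<dots> \<le> (LINT y|lborel. bump k (y::'a))"
  proof (rule integral_mono[OF _ i])
    show "integrable lborel (\<lambda>y. indicator (cball (0::'a) (1/2)) y * (3/4) ^ k :: real)"
      by (intro integrable_mult_left integrable_indicator_cball)
    show "indicator (cball 0 (1/2)) y * (3/4) ^ k \<le> bump k y" for y :: 'a
    proof (cases "y \<in> cball 0 (1/2)")
      case True
      then have "norm y ^ 2 \<le> (1/2) ^ 2" by (intro power_mono) auto
      then have "y \<bullet> y \<le> 1 / 4" unfolding power2_norm_eq_inner by (simp add: power2_eq_square)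
      then have "(3/4) ^ k \<le> max 0 (1 - y \<bullet> y) ^ k" by (intro power_mono) auto
      then show ?thesis using True by (simp add: bump_def)
    qed (simp add: bump_nonneg)
  qed
  finally show ?thesis by (simp add: bump_mass_def)
qed

lemma integral_bump_at:
  fixes x :: "'a::euclidean_space"
  assumes "t > 0"
  shows "(LINT z|lborel. bump k ((z - x) /\<^sub>R t)) = t ^ DIM('a) * bump_mass TYPE('a) k"
proof -
  have "(\<lambda>z. bump k ((z - x) /\<^sub>R t)) \<in> borel_measurable borel"
    using borel_measurable_continuous_onI[OF continuous_on_bump_at] .
  from lborel_affine_integral(1)[OF this, of t x] show ?thesis
    using assms by (simp add: bump_mass_def)
qed

lemma integrable_bump_times:
  fixes h :: "'a::euclidean_space \<Rightarrow> real"
  assumes "open U" "continuous_on U h" "cball x t \<subseteq> U" "t > 0" "k > 0"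
  shows "integrable lborel (\<lambda>z. bump k ((z - x) /\<^sub>R t) * h z)"
proof (rule integrable_compact_support[of _ "cball x t"])
  have "continuous_on UNIV (\<lambda>z. bump k ((z - x) /\<^sub>R t) *\<^sub>R h z)"
    by (rule continuous_on_extend_zero[OF continuous_on_bump_at _ assms(3,1) _ assms(2)])
      (use bump_at_eq_0 assms in auto)
  then show "continuous_on UNIV (\<lambda>z. bump k ((z - x) /\<^sub>R t) * h z)" by simp
  show "bump k ((z - x) /\<^sub>R t) * h z = 0" if "z \<notin> cball x t" for z
    using bump_at_eq_0[OF assms(5,4) that] by simp
qed simp

text \<open>
  The bumps are an approximate identity, so an identity that holds on average for all small bumps holds
  pointwise.
\<close>

lemma bump_average_tendsto:
  fixes h :: "'a::euclidean_space \<Rightarrow> real"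
  assumes "open U" "x \<in> U" "continuous_on U h" "k > 0"
  shows "((\<lambda>s. (LINT z|lborel. bump k ((z - x) /\<^sub>R s) * h z) / s ^ DIM('a)) \<longlongrightarrow> bump_mass TYPE('a) k * h x) (at_right 0)"
proof (rule tendstoI)
  fix e :: real assume e: "e > 0"
  define c where "c = bump_mass TYPE('a) k"
  have c: "c > 0" unfolding c_def by (rule bump_mass_pos[OF assms(4)])
  obtain r where r: "r > 0" "cball x r \<subseteq> U" using assms(1,2) open_contains_cball by blast
  have "isCont h x" using assms continuous_on_eq_continuous_at by blast
  then obtain d where d: "d > 0" "\<And>z. dist z x < d \<Longrightarrow> dist (h z) (h x) < e / (2 * c)"
    unfolding continuous_at_eps_delta using e c by (metis divide_pos_pos mult_pos_pos zero_less_numeral)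
  have "dist ((LINT z|lborel. bump k ((z - x) /\<^sub>R s) * h z) / s ^ DIM('a)) (c * h x) < e"
    if s: "s > 0" "s < min r d" for s
  proof -
    have sU: "cball x s \<subseteq> U" using r s by (auto simp: subset_iff)
    have i1: "integrable lborel (\<lambda>z. bump k ((z - x) /\<^sub>R s) * h z)"
      by (rule integrable_bump_times[OF assms(1,3) sU s(1) assms(4)])
    have i0: "integrable lborel (\<lambda>z. bump k ((z - x) /\<^sub>R s))"
      using integrable_bump_times[OF open_UNIV continuous_on_const, of x s k 1] s assms(4) by simp
    have "(LINT z|lborel. bump k ((z - x) /\<^sub>R s) * h z) - s ^ DIM('a) * c * h x
        = (LINT z|lborel. bump k ((z - x) /\<^sub>R s) * h z - bump k ((z - x) /\<^sub>R s) * h x)"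
      using i0 i1 s by (simp add: integral_bump_at c_def)
    also have "\<bar>\<dots>\<bar> \<le> (LINT z|lborel. bump k ((z - x) /\<^sub>R s) * (e / (2 * c)))"
    proof (rule integral_abs_bound_integral)
      show "\<bar>bump k ((z - x) /\<^sub>R s) * h z - bump k ((z - x) /\<^sub>R s) * h x\<bar> \<le> bump k ((z - x) /\<^sub>R s) * (e / (2 * c))" for z
      proof (cases "z \<in> cball x s")
        case True
        then have "dist (h z) (h x) < e / (2 * c)" using d(2)[of z] s by (auto simp: dist_commute)
        then have "bump k ((z - x) /\<^sub>R s) * \<bar>h z - h x\<bar> \<le> bump k ((z - x) /\<^sub>R s) * (e / (2 * c))"
          by (intro mult_left_mono bump_nonneg) (auto simp: dist_real_def)
        then show ?thesis by (simp add: right_diff_distrib[symmetric] abs_mult bump_nonneg)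
      qed (simp add: bump_at_eq_0 assms(4) s)
    qed (use i0 i1 in auto)
    also have "\<dots> = s ^ DIM('a) * (e / 2)" using s c by (simp add: integral_bump_at c_def[symmetric])
    finally have "\<bar>(LINT z|lborel. bump k ((z - x) /\<^sub>R s) * h z) - s ^ DIM('a) * c * h x\<bar> / s ^ DIM('a) \<le> e / 2"
      using s by (simp add: field_simps)
    moreover have "\<bar>(LINT z|lborel. bump k ((z - x) /\<^sub>R s) * h z) - s ^ DIM('a) * c * h x\<bar> / s ^ DIM('a)
        = dist ((LINT z|lborel. bump k ((z - x) /\<^sub>R s) * h z) / s ^ DIM('a)) (c * h x)"
    proof -
      have "\<bar>A - S * c * H\<bar> / S = dist (A / S) (c * H)" if "S > 0" for A S H :: real
      proof -
        have "A / S - c * H = (A - S * c * H) / S" using that by (simp add: field_simps)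
        then show ?thesis using that by (simp only: dist_real_def abs_divide abs_of_pos)
      qed
      then show ?thesis using s by simp
    qed
    ultimately show ?thesis using e by linarith
  qed
  then show "\<forall>\<^sub>F s in at_right 0. dist ((LINT z|lborel. bump k ((z - x) /\<^sub>R s) * h z) / s ^ DIM('a)) (bump_mass TYPE('a) k * h x) < e"
    unfolding eventually_at_right_field c_def[symmetric] using r(1) d(1) by (intro exI[of _ "min r d"]) auto
qed

lemma zero_if_bump_averages_zero:
  fixes h :: "'a::euclidean_space \<Rightarrow> real"
  assumes "open U" "x \<in> U" "continuous_on U h" "r > 0"
    and zero: "\<And>s. 0 < s \<Longrightarrow> s \<le> r \<Longrightarrow> (LINT z|lborel. bump 2 ((z - x) /\<^sub>R s) * h z) = 0"
  shows "h x = 0"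
proof -
  have "((\<lambda>s. (LINT z|lborel. bump 2 ((z - x) /\<^sub>R s) * h z) / s ^ DIM('a)) \<longlongrightarrow> bump_mass TYPE('a) 2 * h x) (at_right 0)"
    by (rule bump_average_tendsto[OF assms(1-3)]) simp
  moreover have "\<forall>\<^sub>F s in at_right 0. (LINT z|lborel. bump 2 ((z - x) /\<^sub>R s) * h z) / s ^ DIM('a) = 0"
    unfolding eventually_at_right_field using zero assms(4) by (intro exI[of _ r]) auto
  ultimately have "((\<lambda>s. 0) \<longlongrightarrow> bump_mass TYPE('a) 2 * h x) (at_right (0::real))"
    by (rule Lim_transform_eventually)
  then have "bump_mass TYPE('a) 2 * h x = 0" by (simp add: tendsto_const_iff)
  then show ?thesis using bump_mass_pos[of 2, where 'a = 'a] by simp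
qed

text \<open>
  Up to the factor \<open>6\<close>, this is the Laplacian of \<open>bump 3\<close>.
\<close>

definition lap_bump :: "'a::euclidean_space \<Rightarrow> real" where
  "lap_bump y = 4 * (y \<bullet> y) * bump 1 y - real DIM('a) * bump 2 y"

text \<open>
  The classical mean value property, averaged over the radii with a weight that makes the average
  continuously differentiable in the centre.
\<close>

definition mean_value_on :: "'a::euclidean_space set \<Rightarrow> ('a \<Rightarrow> real) \<Rightarrow> bool" where
  "mean_value_on U h \<longleftrightarrow> continuous_on U h \<and> (\<forall>x t. t > 0 \<longrightarrow> cball x t \<subseteq> U \<longrightarrow>
     (LINT z|lborel. bump 2 ((z - x) /\<^sub>R t) * h z) = bump_mass TYPE('a) 2 * t ^ DIM('a) * h x)"

lemma lap_bump_bound: "\<bar>lap_bump (y :: 'a::euclidean_space)\<bar> \<le> 4 + real DIM('a)"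
proof (cases "norm y \<ge> 1")
  case False
  then have "norm y ^ 2 \<le> 1" by (simp add: power_le_one)
  then have y: "y \<bullet> y \<le> 1" by (simp add: power2_norm_eq_inner)
  have "(y \<bullet> y) * bump 1 y \<le> 1 * 1" by (intro mult_mono y bump_le_1 bump_nonneg) auto
  moreover have "(y \<bullet> y) * bump 1 y \<ge> 0" by (simp add: bump_nonneg)
  moreover have "real DIM('a) * bump 2 y \<le> real DIM('a)" "real DIM('a) * bump 2 y \<ge> 0"
    by (simp_all add: bump_nonneg bump_le_1 mult_left_le)
  ultimately show ?thesis unfolding lap_bump_def by linarith
qed (simp add: lap_bump_def bump_eq_0)

lemma cball_enlarge:
  assumes "open U" "cball (x::'a::euclidean_space) t \<subseteq> U" "t > 0"
  obtains e where "e > 0" "cball x (t + e) \<subseteq> U"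
proof -
  obtain e where e: "e > 0" "(\<Union>y\<in>cball x t. ball y e) \<subseteq> U"
    using compact_subset_open_imp_ball_epsilon_subset[OF compact_cball assms(1,2)] by blast
  have "cball x (t + e / 2) \<subseteq> U"
  proof
    fix y assume y: "y \<in> cball x (t + e / 2)"
    show "y \<in> U"
    proof (cases "dist x y \<le> t")
      case False
      define z where "z = x + (t / dist x y) *\<^sub>R (y - x)"
      have xy: "dist x y > t" "x \<noteq> y" using False assms(3) by auto
      then have "dist x z = t" using assms(3) by (auto simp: z_def dist_norm norm_minus_commute)
      moreover have "y - z = (1 - t / dist x y) *\<^sub>R (y - x)" unfolding z_def by (simp add: algebra_simps)
      then have "norm (y - z) = \<bar>1 - t / dist x y\<bar> * norm (y - x)" by (simp only: norm_scaleR)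
      then have "dist z y = (1 - t / dist x y) * dist x y"
        using xy assms(3) by (simp add: dist_norm norm_minus_commute)
      then have "dist z y = dist x y - t" using xy assms(3) by (simp add: left_diff_distrib)
      ultimately have "z \<in> cball x t" "y \<in> ball z e" using y e(1) by auto
      then show ?thesis using e(2) by blast
    qed (use assms(2) in auto)
  qed
  then show ?thesis using that[of "e / 2"] e(1) by simp
qed

text \<open>
  The derivative of the average of \<open>h\<close> against the rescaled bump with respect to the scale is the
  integral of \<open>h\<close> against the Laplacian of a bump. So the mean value property already follows from
  the weak form of Laplace's equation, tested with these Laplacians only.
\<close>

lemma mean_value_onI:
  fixes h :: "'a::euclidean_space \<Rightarrow> real"
  assumes "open U" "continuous_on U h"
    and weak: "\<And>x t. t > 0 \<Longrightarrow> cball x t \<subseteq> U \<Longrightarrow> (LINT z|lborel. lap_bump ((z - x) /\<^sub>R t) * h z) = 0"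
  shows "mean_value_on U h"
  unfolding mean_value_on_def
proof (intro conjI allI impI assms(2))
  fix x :: 'a and t :: real assume t: "t > 0" "cball x t \<subseteq> U"
  obtain e where e: "e > 0" "cball x (t + e) \<subseteq> U" using cball_enlarge[OF assms(1) t(2,1)] by blast
  define K where "K z = indicator (cball x (t + e)) z * h z" for z
  have Ki: "integrable lborel K"
    unfolding K_def using borel_integrable_compact[OF compact_cball continuous_on_subset[OF assms(2) e(2)]] by simp
  define d where "d = DIM('a)"
  have Kh: "q z * K z = q z * h z" if "q z = 0 \<or> z \<in> cball x (t + e)" for q z
    using that by (auto simp: K_def)
  define N where "N s = (LINT z|lborel. (1 / s ^ d) * bump 2 ((z - x) /\<^sub>R s) * K z)" for s
  have meas: "(\<lambda>z. bump 2 ((z - x) /\<^sub>R s)) \<in> borel_measurable borel" for s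
    using borel_measurable_continuous_onI[OF continuous_on_bump_at] .
  have "(N has_real_derivative 0) (at s)" if s: "s > 0" "s < t + e" for s
  proof -
    have "(N has_real_derivative (LINT z|lborel. (1 / s ^ (d + 1)) * lap_bump ((z - x) /\<^sub>R s) * K z)) (at s)"
      unfolding N_def[abs_def]
    proof (rule has_real_derivative_integral[where r = "s / 2" and w = "\<lambda>z. (2 / s) ^ (d + 1) * (4 + real d) * \<bar>K z\<bar>"
          and f' = "\<lambda>s z. (1 / s ^ (d + 1)) * lap_bump ((z - x) /\<^sub>R s) * K z"])
      fix q assume q: "\<bar>q - s\<bar> < s / 2"
      then have q0: "q > 0" "q \<ge> s / 2" using s by (auto simp: abs_if split: if_splits)
      have "integrable lborel (\<lambda>z. (1 / q ^ d) * (bump 2 ((z - x) /\<^sub>R q) * K z))"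
      proof (intro integrable_mult_right Bochner_Integration.integrable_bound[OF Ki])
        show "AE z in lborel. norm (bump 2 ((z - x) /\<^sub>R q) * K z) \<le> norm (K z)"
          by (auto simp: abs_mult bump_nonneg bump_le_1 mult_left_le_one_le)
      qed (use meas Ki in auto)
      then show "integrable lborel (\<lambda>z. (1 / q ^ d) * bump 2 ((z - x) /\<^sub>R q) * K z)" by (simp add: mult.assoc)
      fix z
      let ?S = "(z - x) \<bullet> (z - x)"
      have b: "bump k ((z - x) /\<^sub>R q) = max 0 (1 - ?S / q\<^sup>2) ^ k" for k q
        unfolding bump_def by (simp add: power2_eq_square divide_inverse mult_ac)
      have "((\<lambda>q. max 0 (1 - ?S / q\<^sup>2) ^ 2) has_real_derivative
          (2 * max 0 (1 - ?S / q\<^sup>2) ^ 1) * (2 * ?S / q ^ 3)) (at q)"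
      proof (rule DERIV_chain2[where f = "\<lambda>s. max 0 s ^ 2"])
        show "((\<lambda>s. max 0 s ^ 2) has_real_derivative 2 * max 0 (1 - ?S / q\<^sup>2) ^ 1) (at (1 - ?S / q\<^sup>2))"
          using has_real_derivative_max_power[of 2 "1 - ?S / q\<^sup>2"] by simp
        show "((\<lambda>q. 1 - ?S / q\<^sup>2) has_real_derivative 2 * ?S / q ^ 3) (at q)"
          using q0 by (auto intro!: derivative_eq_intros simp: power2_eq_square power3_eq_cube field_simps)
      qed
      moreover have "((\<lambda>q. 1 / q ^ d) has_real_derivative - real d / q ^ (d + 1)) (at q)"
      proof -
        have "d > 0" unfolding d_def by simp
        then obtain m where m: "d = Suc m" by (metis gr0_implies_Suc)
        have "((\<lambda>q. inverse (q ^ d)) has_real_derivative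
            - (inverse (q ^ d) * (real d * q ^ (d - Suc 0)) * inverse (q ^ d))) (at q)"
          by (rule DERIV_inverse'[OF DERIV_pow]) (use q0 in simp)
        moreover have "- (inverse (q ^ d) * (real d * q ^ (d - Suc 0)) * inverse (q ^ d)) = - real d / q ^ (d + 1)"
          using q0 by (simp add: m field_simps)
        ultimately show ?thesis by (simp add: inverse_eq_divide)
      qed
      ultimately have "((\<lambda>q. (1 / q ^ d) * max 0 (1 - ?S / q\<^sup>2) ^ 2 * K z) has_real_derivative
          ((- real d / q ^ (d + 1)) * max 0 (1 - ?S / q\<^sup>2) ^ 2
            + (2 * max 0 (1 - ?S / q\<^sup>2) ^ 1) * (2 * ?S / q ^ 3) * (1 / q ^ d)) * K z) (at q)"
        by (intro DERIV_cmult_right DERIV_mult)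
      moreover have "((- real d / q ^ (d + 1)) * max 0 (1 - ?S / q\<^sup>2) ^ 2
            + (2 * max 0 (1 - ?S / q\<^sup>2) ^ 1) * (2 * ?S / q ^ 3) * (1 / q ^ d)) * K z
          = (1 / q ^ (d + 1)) * lap_bump ((z - x) /\<^sub>R q) * K z"
      proof -
        have "((z - x) /\<^sub>R q) \<bullet> ((z - x) /\<^sub>R q) = ?S / q\<^sup>2"
          by (simp add: power2_eq_square divide_inverse mult_ac)
        then show ?thesis unfolding lap_bump_def b d_def[symmetric] using q0
          by (simp add: power2_eq_square power3_eq_cube field_simps)
      qed
      ultimately show "((\<lambda>q. (1 / q ^ d) * bump 2 ((z - x) /\<^sub>R q) * K z) has_real_derivative
          (1 / q ^ (d + 1)) * lap_bump ((z - x) /\<^sub>R q) * K z) (at q)"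
        unfolding b by simp
      have "1 / q \<le> 2 / s" using q0 s by (simp add: field_simps)
      then have "(1 / q) ^ (d + 1) * \<bar>lap_bump ((z - x) /\<^sub>R q)\<bar> * \<bar>K z\<bar> \<le> (2 / s) ^ (d + 1) * (4 + real d) * \<bar>K z\<bar>"
        using q0 s lap_bump_bound[of "(z - x) /\<^sub>R q"] unfolding d_def
        by (intro mult_mono power_mono mult_nonneg_nonneg) auto
      then show "\<bar>(1 / q ^ (d + 1)) * lap_bump ((z - x) /\<^sub>R q) * K z\<bar> \<le> (2 / s) ^ (d + 1) * (4 + real d) * \<bar>K z\<bar>"
        using q0 by (simp add: abs_mult power_divide)
    qed (use s Ki in auto)
    also have "(LINT z|lborel. (1 / s ^ (d + 1)) * lap_bump ((z - x) /\<^sub>R s) * K z)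
        = (LINT z|lborel. (1 / s ^ (d + 1)) * (lap_bump ((z - x) /\<^sub>R s) * h z))"
    proof (rule Bochner_Integration.integral_cong)
      fix z
      have "lap_bump ((z - x) /\<^sub>R s) = 0 \<or> z \<in> cball x (t + e)"
        using s bump_at_eq_0[of 1 s z x] bump_at_eq_0[of 2 s z x] by (auto simp: lap_bump_def)
      then show "(1 / s ^ (d + 1)) * lap_bump ((z - x) /\<^sub>R s) * K z = (1 / s ^ (d + 1)) * (lap_bump ((z - x) /\<^sub>R s) * h z)"
        using Kh[of "\<lambda>z. lap_bump ((z - x) /\<^sub>R s)" z] by (simp add: mult.assoc)
    qed simp
    also have "\<dots> = 0"
    proof -
      have "cball x s \<subseteq> U" using e(2) s by (auto simp: subset_iff)
      then show ?thesis using weak[OF s(1)] by simp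
    qed
    finally show ?thesis .
  qed
  then have N: "N s = N t" if "s > 0" "s < t" for s
    using that t e by (intro DERIV_isconst3[of 0 "t + e" s t N]) auto
  have Neq: "N s = (LINT z|lborel. bump 2 ((z - x) /\<^sub>R s) * h z) / s ^ d" if s: "s > 0" "s \<le> t" for s
  proof -
    have "bump 2 ((z - x) /\<^sub>R s) = 0 \<or> z \<in> cball x (t + e)" for z
      using s e bump_at_eq_0[of 2 s z x] by auto
    note Kh' = Kh[of "\<lambda>z. bump 2 ((z - x) /\<^sub>R s)", OF this]
    have "N s = (LINT z|lborel. (1 / s ^ d) * (bump 2 ((z - x) /\<^sub>R s) * h z))"
      unfolding N_def by (simp only: mult.assoc Kh')
    then show ?thesis by simp
  qed
  have "((\<lambda>s. (LINT z|lborel. bump 2 ((z - x) /\<^sub>R s) * h z) / s ^ d) \<longlongrightarrow> bump_mass TYPE('a) 2 * h x) (at_right 0)"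
    unfolding d_def using t by (intro bump_average_tendsto[OF assms(1) _ assms(2)]) auto
  moreover have "\<forall>\<^sub>F s in at_right 0. (LINT z|lborel. bump 2 ((z - x) /\<^sub>R s) * h z) / s ^ d = N t"
    unfolding eventually_at_right_field using t N Neq by (intro exI[of _ t]) auto
  ultimately have "((\<lambda>s. N t) \<longlongrightarrow> bump_mass TYPE('a) 2 * h x) (at_right (0::real))"
    by (rule Lim_transform_eventually)
  then have "N t = bump_mass TYPE('a) 2 * h x"
    by (simp add: tendsto_const_iff)
  then show "(LINT z|lborel. bump 2 ((z - x) /\<^sub>R t) * h z) = bump_mass TYPE('a) 2 * t ^ DIM('a) * h x"
    using Neq[of t] t by (simp add: d_def field_simps)
qed

lemma mean_value_on_continuous: "mean_value_on U h \<Longrightarrow> continuous_on U h"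
  and mean_value_onD: "mean_value_on (U :: 'a::euclidean_space set) h \<Longrightarrow> t > 0 \<Longrightarrow> cball x t \<subseteq> U \<Longrightarrow>
     (LINT z|lborel. bump 2 ((z - x) /\<^sub>R t) * h z) = bump_mass TYPE('a) 2 * t ^ DIM('a) * h x"
  by (auto simp: mean_value_on_def)

text \<open>
  By the mean value property \<open>h\<close> is locally a convolution with a bump, and the derivative falls on the bump.
  The ball \<open>cball x0 (t + e)\<close> leaves room to move the centre at fixed radius.
\<close>

lemma mean_value_on_local_derivative:
  fixes h :: "'a::euclidean_space \<Rightarrow> real"
  assumes "open U" "mean_value_on U h" "t > 0" "cball x0 t \<subseteq> U"
  obtains e where "e > 0" "C1_on (ball x0 e) h
    (\<lambda>x v. (LINT z|lborel. (4 / t\<^sup>2) * ((z - x) \<bullet> v) * bump 1 ((z - x) /\<^sub>R t) * h z) / (bump_mass TYPE('a) 2 * t ^ DIM('a)))"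
proof -
  obtain e where e: "e > 0" "cball x0 (t + e) \<subseteq> U" using cball_enlarge[OF assms(1,4,3)] by blast
  define K where "K z = indicator (cball x0 (t + e)) z * h z" for z
  have Ki: "integrable lborel K"
    unfolding K_def using borel_integrable_compact[OF compact_cball
        continuous_on_subset[OF mean_value_on_continuous[OF assms(2)] e(2)]] by simp
  define A where "A = bump_mass TYPE('a) 2 * t ^ DIM('a)"
  have A: "A > 0" unfolding A_def using bump_mass_pos[of 2, where 'a = 'a] assms(3) by simp
  have sub: "cball x t \<subseteq> cball x0 (t + e)" if "x \<in> ball x0 e" for x
  proof
    fix z assume "z \<in> cball x t"
    then show "z \<in> cball x0 (t + e)" using that dist_triangle[of x0 z x] by simp
  qed
  have ev: "bump k (- y) = bump k y" for k and y :: 'a by (simp add: bump_def)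
  have flip: "bump k ((x + - z) /\<^sub>R t - 0) = bump k ((z - x) /\<^sub>R t)" for k and x z :: 'a
    using ev[of k "(z - x) /\<^sub>R t"] by (simp add: scaleR_minus_right[symmetric])
  have Kh: "q z * K z = q z * h z" if "x \<in> ball x0 e" "\<And>z. z \<notin> cball x t \<Longrightarrow> q z = 0" for q x z
    using sub[OF that(1)] that(2)[of z] by (cases "z \<in> cball x t") (auto simp: K_def)
  have "C1_on UNIV (\<lambda>x. LINT y|lborel. K y *\<^sub>R bump 2 ((x + - y - 0) /\<^sub>R t))
    (\<lambda>x v. LINT y|lborel. K y *\<^sub>R (- (2 * real 2 / t\<^sup>2) * ((x + - y - 0) \<bullet> v) * bump (2 - 1) ((x + - y - 0) /\<^sub>R t)))"
    by (rule C1_on_convolution[OF Ki C1_on_bump_at compact_cball[of 0 t]]) (use bump_at_eq_0[of 2 t _ 0] assms(3) in auto)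
  from C1_on_linear_image[OF C1_on_subset[OF this subset_UNIV[of "ball x0 e"]], of "\<lambda>r. r / A"]
  have "C1_on (ball x0 e) h
    (\<lambda>x v. (LINT z|lborel. (4 / t\<^sup>2) * ((z - x) \<bullet> v) * bump 1 ((z - x) /\<^sub>R t) * h z) / A)"
  proof (rule C1_on_cong_open)
    show "linear (\<lambda>r. r / A)" by (rule linearI) (auto simp: add_divide_distrib)
    fix x assume x: "x \<in> ball x0 e"
    have "K y *\<^sub>R bump 2 ((x + - y - 0) /\<^sub>R t) = bump 2 ((y - x) /\<^sub>R t) * h y" for y
      using Kh[OF x, of "\<lambda>z. bump 2 ((z - x) /\<^sub>R t)" y] bump_at_eq_0[of 2 t _ x] assms(3) flip[of 2 x y] by (simp add: mult.commute)
    then have "(LINT y|lborel. K y *\<^sub>R bump 2 ((x + - y - 0) /\<^sub>R t)) = A * h x"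
      using mean_value_onD[OF assms(2,3), of x] sub[OF x] e(2) by (simp add: A_def)
    then show "(LINT y|lborel. K y *\<^sub>R bump 2 ((x + - y - 0) /\<^sub>R t)) / A = h x" using A by simp
    fix v
    have "K y *\<^sub>R (- (2 * real 2 / t\<^sup>2) * ((x + - y - 0) \<bullet> v) * bump (2 - 1) ((x + - y - 0) /\<^sub>R t))
      = (4 / t\<^sup>2) * ((y - x) \<bullet> v) * bump 1 ((y - x) /\<^sub>R t) * h y" for y
    proof -
      have "(4 / t\<^sup>2) * ((y - x) \<bullet> v) * bump 1 ((y - x) /\<^sub>R t) * K y = (4 / t\<^sup>2) * ((y - x) \<bullet> v) * bump 1 ((y - x) /\<^sub>R t) * h y"
        by (rule Kh[OF x, where q = "\<lambda>z. (4 / t\<^sup>2) * ((z - x) \<bullet> v) * bump 1 ((z - x) /\<^sub>R t)"])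
          (use bump_at_eq_0[of 1 t _ x] assms(3) in simp)
      moreover have "(x + - y - 0) \<bullet> v = - ((y - x) \<bullet> v)" by (simp add: inner_diff_left)
      ultimately show ?thesis using flip[of 1 x y] by (simp add: mult_ac)
    qed
    then show "(LINT y|lborel. K y *\<^sub>R (- (2 * real 2 / t\<^sup>2) * ((x + - y - 0) \<bullet> v) * bump (2 - 1) ((x + - y - 0) /\<^sub>R t))) / A
      = (LINT z|lborel. (4 / t\<^sup>2) * ((z - x) \<bullet> v) * bump 1 ((z - x) /\<^sub>R t) * h z) / A" by presburger
  qed simp
  then show ?thesis using that e(1) unfolding A_def by blast
qed

abbreviation dirder :: "'a::euclidean_space \<Rightarrow> ('a \<Rightarrow> real) \<Rightarrow> 'a \<Rightarrow> real" where
  "dirder v h \<equiv> \<lambda>x. frechet_derivative h (at x) v"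

lemma mean_value_on_C1:
  fixes h :: "'a::euclidean_space \<Rightarrow> real"
  assumes "open U" "mean_value_on U h"
  shows "C1_on U h (\<lambda>x v. dirder v h x)"
    and "t > 0 \<Longrightarrow> cball x t \<subseteq> U \<Longrightarrow> bump_mass TYPE('a) 2 * t ^ DIM('a) * dirder v h x =
      (LINT z|lborel. (4 / t\<^sup>2) * ((z - x) \<bullet> v) * bump 1 ((z - x) /\<^sub>R t) * h z)"
proof -
  have loc: "\<exists>e>0. C1_on (ball x e) h (\<lambda>x v. dirder v h x)" if xU: "x \<in> U" for x
  proof -
    obtain t where t: "t > 0" "cball x t \<subseteq> U" using open_contains_cball[THEN iffD1, OF assms(1)] xU by blast
    obtain e where e: "e > 0" "C1_on (ball x e) h
      (\<lambda>x v. (LINT z|lborel. (4 / t\<^sup>2) * ((z - x) \<bullet> v) * bump 1 ((z - x) /\<^sub>R t) * h z) / (bump_mass TYPE('a) 2 * t ^ DIM('a)))"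
      using mean_value_on_local_derivative[OF assms t] by blast
    show ?thesis
    proof (intro exI conjI)
      show "C1_on (ball x e) h (\<lambda>x v. dirder v h x)"
        by (rule C1_on_cong_open[OF e(2) open_ball refl])
          (rule fun_cong[OF frechet_derivative_at[OF C1_onD(1)[OF e(2)]]])
    qed fact
  qed
  then obtain e where e: "\<And>x. x \<in> U \<Longrightarrow> e x > 0 \<and> C1_on (ball x (e x)) h (\<lambda>x v. dirder v h x)" by metis
  show C1: "C1_on U h (\<lambda>x v. dirder v h x)"
  proof (rule C1_onI)
    show "(h has_derivative (\<lambda>v. dirder v h x)) (at x)" if "x \<in> U" for x
      using C1_onD(1)[OF conjunct2[OF e[OF that]], of x] e[OF that] by simp
    show "continuous_on U (dirder v h)" for v
    proof (rule continuous_at_imp_continuous_on, rule ballI)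
      fix x assume "x \<in> U"
      then have "x \<in> ball x (e x)" "continuous_on (ball x (e x)) (dirder v h)"
        using e[of x] C1_onD(2)[OF conjunct2[OF e[of x]], of v] by auto
      then show "isCont (dirder v h) x" using continuous_on_eq_continuous_at[OF open_ball] by blast
    qed
  qed
  assume t: "t > 0" "cball x t \<subseteq> U"
  obtain e where e: "e > 0" "C1_on (ball x e) h
      (\<lambda>x v. (LINT z|lborel. (4 / t\<^sup>2) * ((z - x) \<bullet> v) * bump 1 ((z - x) /\<^sub>R t) * h z) / (bump_mass TYPE('a) 2 * t ^ DIM('a)))"
    using mean_value_on_local_derivative[OF assms t] by blast
  have "dirder v h x = (LINT z|lborel. (4 / t\<^sup>2) * ((z - x) \<bullet> v) * bump 1 ((z - x) /\<^sub>R t) * h z) / (bump_mass TYPE('a) 2 * t ^ DIM('a))"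
    by (rule fun_cong[OF frechet_derivative_at[OF C1_onD(1)[OF e(2)]], symmetric]) (use e(1) in simp)
  then show "bump_mass TYPE('a) 2 * t ^ DIM('a) * dirder v h x =
      (LINT z|lborel. (4 / t\<^sup>2) * ((z - x) \<bullet> v) * bump 1 ((z - x) /\<^sub>R t) * h z)"
    using bump_mass_pos[of 2, where 'a = 'a] t by simp
qed

text \<open>
  Integration by parts moves the derivative from the bump back to \<open>h\<close>.
\<close>

lemma mean_value_on_dirder:
  fixes h :: "'a::euclidean_space \<Rightarrow> real"
  assumes "open U" "mean_value_on U h"
  shows "mean_value_on U (dirder v h)"
  unfolding mean_value_on_def
proof (intro conjI allI impI)
  note C1 = mean_value_on_C1(1)[OF assms]
  show "continuous_on U (dirder v h)" by (rule C1_onD(2)[OF C1])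
  fix x :: 'a and t :: real assume t: "t > 0" "cball x t \<subseteq> U"
  have "(LINT z|lborel. (- (2 * real 2 / t\<^sup>2) * ((z - x) \<bullet> v) * bump (2 - 1) ((z - x) /\<^sub>R t)) *\<^sub>R h z)
    = - (LINT z|lborel. bump 2 ((z - x) /\<^sub>R t) *\<^sub>R dirder v h z)"
    by (rule integral_by_parts[OF C1_on_bump_at compact_cball[of x t] t(2) assms(1) _ C1])
      (use bump_at_eq_0[of 2 t] t in auto)
  moreover have "(LINT z|lborel. (4 / t\<^sup>2) * ((z - x) \<bullet> v) * bump 1 ((z - x) /\<^sub>R t) * h z)
    = - (LINT z|lborel. (- (2 * real 2 / t\<^sup>2) * ((z - x) \<bullet> v) * bump (2 - 1) ((z - x) /\<^sub>R t)) *\<^sub>R h z)"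
    unfolding Bochner_Integration.integral_minus[symmetric] by simp
  ultimately show "(LINT z|lborel. bump 2 ((z - x) /\<^sub>R t) * dirder v h z) = bump_mass TYPE('a) 2 * t ^ DIM('a) * dirder v h x"
    using mean_value_on_C1(2)[OF assms t, of v] by simp
qed

text \<open>
  The summand \<open>1\<close> only makes the constant at least \<open>1\<close>.
\<close>

definition gradient_const :: "'a::euclidean_space itself \<Rightarrow> real" where
  "gradient_const _ = 1 + 4 * measure lborel (cball (0::'a) 1) / bump_mass TYPE('a) 2"

lemma gradient_const_ge_1: "gradient_const TYPE('a::euclidean_space) \<ge> 1"
  unfolding gradient_const_def using bump_mass_pos[of 2, where 'a = 'a] by simp

lemma mean_value_on_gradient_estimate:
  fixes h :: "'a::euclidean_space \<Rightarrow> real"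
  assumes "open U" "mean_value_on U h" "t > 0" "cball x t \<subseteq> U"
    and M: "\<And>z. z \<in> cball x t \<Longrightarrow> \<bar>h z\<bar> \<le> M"
  shows "\<bar>dirder v h x\<bar> \<le> gradient_const TYPE('a) / t * norm v * M"
proof -
  define c where "c = bump_mass TYPE('a) 2"
  define V where "V = measure lborel (cball (0::'a) 1)"
  have c: "c > 0" unfolding c_def by (rule bump_mass_pos) simp
  have "\<bar>h x\<bar> \<le> M" using M[of x] assms(3) by simp
  then have M0: "M \<ge> 0" by linarith
  have Vt: "measure lborel (cball x t) = t ^ DIM('a) * V"
    unfolding V_def using assms(3) by (simp add: content_cball)
  have "c * t ^ DIM('a) * \<bar>dirder v h x\<bar> = \<bar>c * t ^ DIM('a) * dirder v h x\<bar>"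
    using c assms(3) by (simp add: abs_mult)
  also have "\<dots> = \<bar>LINT z|lborel. (4 / t\<^sup>2) * ((z - x) \<bullet> v) * bump 1 ((z - x) /\<^sub>R t) * h z\<bar>"
    unfolding c_def by (simp only: mean_value_on_C1(2)[OF assms(1-4)])
  also have "\<dots> \<le> (LINT z|lborel. indicator (cball x t) z * (4 / t * norm v * M))"
  proof (rule integral_abs_bound_integral)
    have "continuous_on UNIV (\<lambda>z. (4 / t\<^sup>2 * ((z - x) \<bullet> v) * bump 1 ((z - x) /\<^sub>R t)) *\<^sub>R h z)"
      by (rule continuous_on_extend_zero[OF _ closed_cball assms(4,1) _ mean_value_on_continuous[OF assms(2)]])
        (use bump_at_eq_0[of 1 t] assms(3) in \<open>auto intro!: continuous_intros continuous_on_bump_at\<close>)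
    then have "integrable lborel (\<lambda>z. (4 / t\<^sup>2 * ((z - x) \<bullet> v) * bump 1 ((z - x) /\<^sub>R t)) *\<^sub>R h z)"
      by (rule integrable_compact_support[OF _ compact_cball[of x t]]) (use bump_at_eq_0[of 1 t] assms(3) in auto)
    then show "integrable lborel (\<lambda>z. (4 / t\<^sup>2) * ((z - x) \<bullet> v) * bump 1 ((z - x) /\<^sub>R t) * h z)" by simp
    show "integrable lborel (\<lambda>z. indicator (cball x t) z * (4 / t * norm v * M))"
      by (intro integrable_mult_left integrable_indicator_cball)
    fix z :: 'a
    show "\<bar>(4 / t\<^sup>2) * ((z - x) \<bullet> v) * bump 1 ((z - x) /\<^sub>R t) * h z\<bar> \<le> indicator (cball x t) z * (4 / t * norm v * M)"
    proof (cases "z \<in> cball x t")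
      case True
      have "\<bar>(z - x) \<bullet> v\<bar> \<le> norm (z - x) * norm v" by (rule Cauchy_Schwarz_ineq2)
      also have "\<dots> \<le> t * norm v" using True by (intro mult_right_mono) (auto simp: dist_norm norm_minus_commute)
      finally have "4 / t\<^sup>2 * \<bar>(z - x) \<bullet> v\<bar> * bump 1 ((z - x) /\<^sub>R t) * \<bar>h z\<bar> \<le> 4 / t\<^sup>2 * (t * norm v) * 1 * M"
        using assms(3) M[OF True] M0 by (intro mult_mono bump_le_1 mult_nonneg_nonneg bump_nonneg) auto
      also have "\<dots> = 4 / t * norm v * M" using assms(3) by (simp add: power2_eq_square)
      finally show ?thesis using True by (simp add: abs_mult bump_nonneg)
    qed (simp add: bump_at_eq_0 assms(3))
  qed
  also have "\<dots> = t ^ DIM('a) * (V * (4 / t * norm v * M))" using Vt by simp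
  finally have "\<bar>dirder v h x\<bar> \<le> V * (4 / t * norm v * M) / c"
    using c assms(3) by (simp add: field_simps)
  also have "\<dots> = (4 * V / c) / t * norm v * M" by (simp add: mult_ac)
  also have "\<dots> \<le> gradient_const TYPE('a) / t * norm v * M"
    unfolding gradient_const_def c_def[symmetric] V_def[symmetric] using M0 assms(3)
    by (intro mult_right_mono divide_right_mono) auto
  finally show ?thesis .
qed

lemma mean_value_on_iterated_dirder:
  assumes "open U" "mean_value_on U h"
  shows "mean_value_on U ((dirder v ^^ k) h)"
  using assms(2) by (induction k) (auto intro: mean_value_on_dirder[OF assms(1)])

text \<open>
  Applying the gradient estimate \<open>k\<close> times, each time on balls of radius \<open>R / k\<close>, gives the bound
  which makes the Taylor series on lines converge.
\<close>

lemma mean_value_on_iterated_estimate: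
  fixes h :: "'a::euclidean_space \<Rightarrow> real"
  assumes "open U" "mean_value_on U h" "R > 0" "cball p (2 * R) \<subseteq> U"
    and M: "\<And>z. z \<in> cball p (2 * R) \<Longrightarrow> \<bar>h z\<bar> \<le> M" and k: "k > 0" and x: "x \<in> cball p R"
  shows "\<bar>(dirder v ^^ k) h x\<bar> \<le> (gradient_const TYPE('a) * real k * norm v / R) ^ k * M"
proof -
  let ?C = "gradient_const TYPE('a) * real k * norm v / R"
  have "\<forall>x\<in>cball p (2 * R - real j * (R / real k)). \<bar>(dirder v ^^ j) h x\<bar> \<le> ?C ^ j * M" if "j \<le> k" for j
    using that
  proof (induction j)
    case 0
    then show ?case using M by simp
  next
    case (Suc j)
    show ?case
    proof
      fix x assume x: "x \<in> cball p (2 * R - real (Suc j) * (R / real k))"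
      let ?t = "R / real k"
      have t: "?t > 0" using assms(3) k by simp
      have sub: "cball x ?t \<subseteq> cball p (2 * R - real j * ?t)"
      proof
        fix z assume z: "z \<in> cball x ?t"
        have "dist p z \<le> dist p x + dist x z" by (rule dist_triangle)
        also have "\<dots> \<le> 2 * R - real (Suc j) * ?t + ?t" using x z by (intro add_mono) auto
        also have "\<dots> = 2 * R - real j * ?t" by (simp add: algebra_simps add_divide_distrib)
        finally show "z \<in> cball p (2 * R - real j * ?t)" by simp
      qed
      have "0 \<le> real j * ?t" using t by (intro mult_nonneg_nonneg) auto
      then have "cball p (2 * R - real j * ?t) \<subseteq> cball p (2 * R)" by (intro subset_cball) linarith
      then have "cball x ?t \<subseteq> U" using sub assms(4) by blast
      moreover have "\<bar>(dirder v ^^ j) h z\<bar> \<le> ?C ^ j * M" if "z \<in> cball x ?t" for z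
        using Suc sub that by auto
      ultimately have "\<bar>dirder v ((dirder v ^^ j) h) x\<bar> \<le> gradient_const TYPE('a) / ?t * norm v * (?C ^ j * M)"
        by (intro mean_value_on_gradient_estimate[OF assms(1) mean_value_on_iterated_dirder[OF assms(1,2)] t])
      then show "\<bar>(dirder v ^^ Suc j) h x\<bar> \<le> ?C ^ Suc j * M" by (simp add: mult_ac)
    qed
  qed
  from this[of k] show ?thesis using x k by auto
qed

lemma power_self_le_fact_exp: "real k ^ k \<le> fact k * exp 1 ^ k"
proof -
  have "(\<Sum>n\<in>{k}. real k ^ n /\<^sub>R fact n) \<le> (\<Sum>n. real k ^ n /\<^sub>R fact n)"
    by (rule sum_le_suminf) (auto simp: summable_exp)
  then have "real k ^ k / fact k \<le> exp (real k)" by (simp add: exp_def divide_inverse mult.commute)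
  then show ?thesis by (simp add: exp_of_nat_mult[symmetric] divide_le_eq mult.commute)
qed

text \<open>
  The radius of the ball on which \<open>h\<close> vanishes is a fixed fraction of \<open>R\<close>, however small \<open>r\<close> may be. On a
  line through \<open>p\<close> all derivatives vanish at \<open>p\<close>, and the remainder of order \<open>k\<close> in Taylor's formula is at
  most \<open>M\<close> times the \<open>k\<close>-th power of a number below \<open>1\<close>, because \<open>k\<^sup>k / k! \<le> e\<^sup>k\<close>.
\<close>

lemma mean_value_on_zero_ball:
  fixes h :: "'a::euclidean_space \<Rightarrow> real"
  assumes "open U" "mean_value_on U h" "R > 0" "cball p (2 * R) \<subseteq> U"
    and "r > 0" and zero: "\<And>x. x \<in> ball p r \<Longrightarrow> h x = 0"
    and x: "x \<in> ball p (R / (gradient_const TYPE('a) * exp 1))"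
  shows "h x = 0"
proof -
  define C where "C = gradient_const TYPE('a) * exp 1"
  define v where "v = x - p"
  have C: "C \<ge> 1" unfolding C_def using gradient_const_ge_1[where 'a='a] mult_mono[of 1 "gradient_const TYPE('a)" 1 "exp 1"] by simp
  have v: "norm v < R / C" using x unfolding v_def C_def by (simp add: dist_norm norm_minus_commute)
  have "R / C \<le> R" using C assms(3) by (simp add: divide_le_eq)
  with v have vR: "norm v \<le> R" by linarith
  have "compact (h ` cball p (2 * R))"
    by (intro compact_continuous_image continuous_on_subset[OF mean_value_on_continuous[OF assms(2)] assms(4)]) simp
  then obtain M where M: "\<And>z. z \<in> cball p (2 * R) \<Longrightarrow> \<bar>h z\<bar> \<le> M"
    using compact_norm_bound[of "h ` cball p (2 * R)"] by (metis imageI real_norm_def)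
  define D where "D m = (dirder v ^^ m) h" for m
  have line: "p + s *\<^sub>R v \<in> cball p R" if "0 \<le> s" "s \<le> 1" for s
    using that vR mult_left_le_one_le[of "norm v" s] by (simp add: dist_norm) 
  have D0: "D m y = 0" if "y \<in> ball p r" for m y
    using that
  proof (induction m arbitrary: y)
    case (Suc m)
    have "(D m has_derivative (\<lambda>_. 0)) (at y)"
      by (rule has_derivative_transform_within_open[where f = "\<lambda>_. 0" and s = "ball p r"])
        (use Suc in auto)
    from fun_cong[OF frechet_derivative_at[OF this], of v] show ?case by (simp add: D_def)
  qed (simp add: D_def zero)
  have "\<bar>h x\<bar> \<le> (C * norm v / R) ^ k * M" if k: "k > 0" for k
  proof -
    have "\<exists>t>0. t < 1 \<and> h (p + 1 *\<^sub>R v) = (\<Sum>m<k. D m (p + 0 *\<^sub>R v) / fact m * 1 ^ m) + D k (p + t *\<^sub>R v) / fact k * 1 ^ k"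
    proof (rule Maclaurin[where f = "\<lambda>s. h (p + s *\<^sub>R v)" and diff = "\<lambda>m s. D m (p + s *\<^sub>R v)"])
      show "\<forall>m t. m < k \<and> 0 \<le> t \<and> t \<le> 1 \<longrightarrow> DERIV (\<lambda>s. D m (p + s *\<^sub>R v)) t :> D (Suc m) (p + t *\<^sub>R v)"
      proof (intro allI impI)
        fix m t assume "m < k \<and> 0 \<le> t \<and> t \<le> (1::real)"
        then have "p + t *\<^sub>R v \<in> cball p (2 * R)" using line[of t] assms(3) by simp
        then have "(D m has_derivative (\<lambda>w. dirder w (D m) (p + t *\<^sub>R v))) (at (p + t *\<^sub>R v))"
          using C1_onD(1)[OF mean_value_on_C1(1)[OF assms(1) mean_value_on_iterated_dirder[OF assms(1,2)]]] assms(4)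
          unfolding D_def by blast
        then have "((\<lambda>s. D m (p + s *\<^sub>R v)) has_derivative (\<lambda>s. dirder (s *\<^sub>R v) (D m) (p + t *\<^sub>R v))) (at t)"
          by (intro has_derivative_compose[where g = "D m" and f = "\<lambda>s. p + s *\<^sub>R v"]) (auto intro!: derivative_eq_intros)
        moreover have "dirder (s *\<^sub>R v) (D m) (p + t *\<^sub>R v) = s * dirder v (D m) (p + t *\<^sub>R v)" for s
          using linear_scale[OF has_derivative_linear[OF \<open>(D m has_derivative _) _\<close>], of s v] by simp
        moreover have "(\<lambda>s. s * c) = (*) c" for c :: real by (auto simp: mult.commute)
        ultimately show "DERIV (\<lambda>s. D m (p + s *\<^sub>R v)) t :> D (Suc m) (p + t *\<^sub>R v)"
          by (simp add: has_field_derivative_def D_def)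
      qed
    qed (use k in \<open>auto simp: D_def\<close>)
    then obtain t where t: "0 < t" "t < 1" "h x = (\<Sum>m<k. D m p / fact m) + D k (p + t *\<^sub>R v) / fact k"
      by (auto simp: v_def)
    have "D m p = 0" for m using D0[of p] assms(5) by simp
    then have "\<bar>h x\<bar> = \<bar>D k (p + t *\<^sub>R v)\<bar> / fact k" using t(3) by simp
    also have "\<dots> \<le> (gradient_const TYPE('a) * real k * norm v / R) ^ k * M / fact k"
      unfolding D_def using t line[of t]
      by (intro divide_right_mono mean_value_on_iterated_estimate[OF assms(1-4) M k]) auto
    also have "\<dots> = (gradient_const TYPE('a) * norm v / R) ^ k * M * (real k ^ k / fact k)"
      by (simp add: power_mult_distrib power_divide)
    also have "\<dots> \<le> (gradient_const TYPE('a) * norm v / R) ^ k * M * exp 1 ^ k"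
    proof (rule mult_left_mono)
      show "real k ^ k / fact k \<le> exp 1 ^ k" using power_self_le_fact_exp[of k] by (simp add: divide_le_eq mult.commute)
      have "\<bar>h p\<bar> \<le> M" using M[of p] assms(3) by simp
      then show "0 \<le> (gradient_const TYPE('a) * norm v / R) ^ k * M"
        using gradient_const_ge_1[where 'a='a] assms(3) by (intro mult_nonneg_nonneg zero_le_power) auto
    qed
    also have "\<dots> = (C * norm v / R) ^ k * M" by (simp add: C_def power_mult_distrib power_divide)
    finally show ?thesis .
  qed
  then have b: "\<forall>\<^sub>F k in sequentially. \<bar>h x\<bar> \<le> (C * norm v / R) ^ k * M"
    using eventually_gt_at_top[of "0::nat"] by (rule eventually_mono[rotated]) auto
  have "C * norm v / R < 1" using v C assms(3) by (simp add: field_simps)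
  moreover have "0 \<le> C * norm v / R" using C assms(3) by simp
  ultimately have "(\<lambda>k. (C * norm v / R) ^ k * M) \<longlonglongrightarrow> 0 * M"
    by (intro tendsto_mult tendsto_const LIMSEQ_realpow_zero)
  from tendsto_le[OF _ this tendsto_const b] show "h x = 0" by simp
qed

text \<open>
  The set of points near which \<open>h\<close> vanishes is closed in \<open>U\<close>: a point of \<open>U\<close> that is close to it, compared
  with the distance to the complement of \<open>U\<close>, lies in one of the balls of the previous lemma.
\<close>

lemma mean_value_on_unique_continuation:
  fixes h :: "'a::euclidean_space \<Rightarrow> real"
  assumes "open U" "connected U" "mean_value_on U h"
    and V: "open V" "V \<noteq> {}" "V \<subseteq> U" "\<And>x. x \<in> V \<Longrightarrow> h x = 0" and x: "x \<in> U"
  shows "h x = 0"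
proof (rule ccontr)
  assume hx: "h x \<noteq> 0"
  define Z where "Z = {y. \<exists>r>0. \<forall>z\<in>ball y r. h z = 0}"
  define N where "N = {y. \<exists>r>0. ball y r \<inter> Z = {}}"
  define \<rho> where "\<rho> = 1 / (gradient_const TYPE('a) * exp 1)"
  have "gradient_const TYPE('a) * exp 1 \<ge> 1"
    using gradient_const_ge_1[where 'a='a] mult_mono[of 1 "gradient_const TYPE('a)" 1 "exp 1"] by simp
  then have \<rho>: "\<rho> > 0" "\<rho> \<le> 1" unfolding \<rho>_def by auto
  have Zo: "open Z" unfolding open_contains_ball
  proof
    fix y assume "y \<in> Z"
    then obtain r where r: "r > 0" "\<forall>z\<in>ball y r. h z = 0" unfolding Z_def by auto
    have "ball y r \<subseteq> Z"
    proof
      fix w assume "w \<in> ball y r"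
      then obtain s where "s > 0" "ball w s \<subseteq> ball y r" using open_ball open_contains_ball by blast
      then show "w \<in> Z" using r(2) unfolding Z_def by blast
    qed
    then show "\<exists>e>0. ball y e \<subseteq> Z" using r by blast
  qed
  have No: "open N" unfolding open_contains_ball
  proof
    fix y assume "y \<in> N"
    then obtain r where r: "r > 0" "ball y r \<inter> Z = {}" unfolding N_def by auto
    have "ball y r \<subseteq> N"
    proof
      fix w assume "w \<in> ball y r"
      then obtain s where "s > 0" "ball w s \<subseteq> ball y r" using open_ball open_contains_ball by blast
      then show "w \<in> N" using r(2) unfolding N_def by blast
    qed
    then show "\<exists>e>0. ball y e \<subseteq> N" using r by blast
  qed
  have cov: "y \<in> Z \<union> N" if yU: "y \<in> U" for y
  proof (rule ccontr)
    assume n: "y \<notin> Z \<union> N"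
    obtain R0 where R0: "R0 > 0" "cball y R0 \<subseteq> U" using open_contains_cball[THEN iffD1, OF assms(1)] yU by blast
    define R where "R = R0 / 3"
    have R: "R > 0" "cball y (3 * R) \<subseteq> U" using R0 by (auto simp: R_def)
    have "\<not> (\<exists>r>0. ball y r \<inter> Z = {})" using n by (simp add: N_def)
    then have "ball y (\<rho> * R) \<inter> Z \<noteq> {}" using mult_pos_pos[OF \<rho>(1) R(1)] by blast
    then obtain p where p: "p \<in> Z" "dist y p < \<rho> * R" by auto
    have "\<rho> * R \<le> R" using \<rho> R by simp
    then have yp: "dist y p \<le> R" using p by linarith
    have "cball p (2 * R) \<subseteq> cball y (3 * R)"
    proof
      fix z assume "z \<in> cball p (2 * R)"
      then show "z \<in> cball y (3 * R)" using dist_triangle[of y z p] yp by simp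
    qed
    then have sub: "cball p (2 * R) \<subseteq> U" using R by blast
    obtain r where r: "r > 0" "\<And>z. z \<in> ball p r \<Longrightarrow> h z = 0" using p unfolding Z_def by blast
    have "h z = 0" if "z \<in> ball p (\<rho> * R)" for z
      using mean_value_on_zero_ball[OF assms(1,3) R(1) sub r, of z] that by (simp add: \<rho>_def)
    moreover have "y \<in> ball p (\<rho> * R)" using p by (simp add: dist_commute)
    then obtain s where "s > 0" "ball y s \<subseteq> ball p (\<rho> * R)" using open_ball open_contains_ball by blast
    ultimately have "y \<in> Z" unfolding Z_def by blast
    then show False using n by simp
  qed
  have "False" if yZ: "y \<in> Z" and yN: "y \<in> N" for y
  proof -
    obtain r where "r > 0" "ball y r \<inter> Z = {}" using yN unfolding N_def by auto
    then show False using yZ centre_in_ball[of y r] by blast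
  qed
  then have "Z \<inter> N = {}" by blast
  moreover have "Z \<inter> U \<noteq> {}"
  proof -
    obtain y where "y \<in> V" using V(2) by auto
    moreover then obtain r where "r > 0" "ball y r \<subseteq> V" using V(1) open_contains_ball by blast
    ultimately show ?thesis using V unfolding Z_def by blast
  qed
  moreover have "x \<in> N"
  proof -
    have "x \<notin> Z" using hx unfolding Z_def by (auto dest: centre_in_ball[THEN iffD2])
    then show ?thesis using cov[OF x] by simp
  qed
  ultimately show False using connectedD[OF assms(2) Zo No] cov x by blast
qed

text \<open>
  The gradient estimate on balls of growing radius shows that the gradient is \<open>0\<close>.
\<close>

lemma mean_value_on_Liouville:
  fixes h :: "'a::euclidean_space \<Rightarrow> real"
  assumes "mean_value_on UNIV h" "\<And>x. \<bar>h x\<bar> \<le> M"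
  shows "h x = h y"
proof -
  note C1 = mean_value_on_C1(1)[OF open_UNIV assms(1)]
  have "dirder v h x = 0" for x v
  proof -
    have b: "\<bar>dirder v h x\<bar> \<le> (gradient_const TYPE('a) * norm v * M) / t" if "t > 0" for t
      using mean_value_on_gradient_estimate[OF open_UNIV assms(1) that subset_UNIV assms(2), of x v] by simp
    have "((\<lambda>t. (gradient_const TYPE('a) * norm v * M) / t) \<longlongrightarrow> 0) at_top"
      by (intro tendsto_divide_0[OF tendsto_const] filterlim_at_top_imp_at_infinity filterlim_ident)
    moreover have "\<forall>\<^sub>F t in at_top. \<bar>dirder v h x\<bar> \<le> (gradient_const TYPE('a) * norm v * M) / t"
      using eventually_gt_at_top[of 0] by (rule eventually_mono) (rule b)
    ultimately have "\<bar>dirder v h x\<bar> \<le> 0"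
      by (intro tendsto_le[OF _ _ tendsto_const]) auto
    then show ?thesis by simp
  qed
  then have "(h has_derivative (\<lambda>v. 0)) (at z within UNIV)" for z
    using C1_onD(1)[OF C1, of z] by simp
  then obtain c where "\<And>x. x \<in> UNIV \<Longrightarrow> h x = c" using has_derivative_zero_constant[OF convex_UNIV] by metis
  then show ?thesis by simp
qed

section \<open>Cutoff functions\<close>

text \<open>
  The convolution of an indicator function with a bump of radius \<open>\<epsilon>\<close>. What matters is the bound of order
  \<open>1 / \<epsilon>\<close> for its gradient.
\<close>

lemma mollified_indicator:
  fixes P :: "'a::euclidean_space set"
  assumes "P \<in> sets borel" "bounded P" "\<epsilon> > 0"
  obtains \<eta> \<eta>' where "C1_on UNIV \<eta> \<eta>'" "\<And>x. 0 \<le> \<eta> x" "\<And>x. \<eta> x \<le> (1::real)"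
    "\<And>x v. \<bar>\<eta>' x v\<bar> \<le> gradient_const TYPE('a) / \<epsilon> * norm v"
    "\<And>x. cball x \<epsilon> \<subseteq> P \<Longrightarrow> \<eta> x = 1" "\<And>x. cball x \<epsilon> \<inter> P = {} \<Longrightarrow> \<eta> x = 0"
proof -
  define c where "c = bump_mass TYPE('a) 2"
  define V where "V = measure lborel (cball (0::'a) 1)"
  define A where "A = \<epsilon> ^ DIM('a) * c"
  have c: "c > 0" unfolding c_def by (rule bump_mass_pos) simp
  then have A: "A > 0" unfolding A_def using assms(3) by simp
  have ev: "bump k (- y) = bump k y" for k and y :: 'a by (simp add: bump_def)
  have flip: "bump k ((x + - z - 0) /\<^sub>R \<epsilon>) = bump k ((z - x) /\<^sub>R \<epsilon>)" for k and x z :: 'a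
    using ev[of k "(z - x) /\<^sub>R \<epsilon>"] by (simp add: scaleR_minus_right[symmetric])
  obtain R where "R > 0" "\<forall>x\<in>P. norm x \<le> R" using assms(2) bounded_pos by metis
  then have "P \<subseteq> cball 0 R" by auto
  then have "emeasure lborel P \<le> emeasure lborel (cball (0::'a) R)" by (rule emeasure_mono) simp
  then have fin: "emeasure lborel P < \<infinity>" using emeasure_lborel_cball_finite by (rule order_le_less_trans)
  then have Ki: "integrable lborel (indicator P :: 'a \<Rightarrow> real)" using assms(1) by (intro integrable_real_indicator) auto
  define \<eta> where "\<eta> x = (LINT y|lborel. indicator P y *\<^sub>R bump 2 ((x + - y - 0) /\<^sub>R \<epsilon>)) / A" for x :: 'a
  define \<eta>' where "\<eta>' x v = (LINT y|lborel. indicator P y *\<^sub>R (- (2 * real 2 / \<epsilon>\<^sup>2) * ((x + - y - 0) \<bullet> v) * bump (2 - 1) ((x + - y - 0) /\<^sub>R \<epsilon>))) / A" for x v :: 'a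
  have conv: "C1_on UNIV (\<lambda>x. LINT y|lborel. indicator P y *\<^sub>R bump 2 ((x + - y - 0) /\<^sub>R \<epsilon>))
    (\<lambda>x v. LINT y|lborel. indicator P y *\<^sub>R (- (2 * real 2 / \<epsilon>\<^sup>2) * ((x + - y - 0) \<bullet> v) * bump (2 - 1) ((x + - y - 0) /\<^sub>R \<epsilon>)))"
    by (rule C1_on_convolution[OF Ki C1_on_bump_at compact_cball[of 0 \<epsilon>]]) (use bump_at_eq_0[of 2 \<epsilon> _ 0] assms(3) in auto)
  have C1: "C1_on UNIV \<eta> \<eta>'"
    unfolding \<eta>_def[abs_def] \<eta>'_def[abs_def]
    by (rule C1_on_linear_image[OF conv, of "\<lambda>r. r / A"]) (auto intro!: linearI simp: add_divide_distrib)
  have \<eta>: "\<eta> x = (LINT y|lborel. indicator P y * bump 2 ((y - x) /\<^sub>R \<epsilon>)) / A" for x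
    unfolding \<eta>_def flip by simp
  have bi: "integrable lborel (\<lambda>y. bump 2 ((y - x) /\<^sub>R \<epsilon>))" for x :: 'a
    by (rule integrable_compact_support[OF continuous_on_bump_at compact_cball[of x \<epsilon>]])
      (use bump_at_eq_0[of 2 \<epsilon>] assms(3) in auto)
  have bA: "(LINT y|lborel. bump 2 ((y - x) /\<^sub>R \<epsilon>)) = A" for x :: 'a
    unfolding A_def c_def by (rule integral_bump_at[OF assms(3)])
  have pi: "integrable lborel (\<lambda>y. indicator P y * bump 2 ((y - x) /\<^sub>R \<epsilon>))" for x :: 'a
    by (rule Bochner_Integration.integrable_bound[OF bi[of x]])
      (use assms(1) bi[of x] in \<open>auto simp: indicator_def\<close>)
  show ?thesis
  proof (rule that[OF C1])
    fix x :: 'a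
    show "0 \<le> \<eta> x" unfolding \<eta> using A by (intro divide_nonneg_pos integral_nonneg_AE) (auto simp: bump_nonneg)
    have "(LINT y|lborel. indicator P y * bump 2 ((y - x) /\<^sub>R \<epsilon>)) \<le> A"
      unfolding bA[of x, symmetric] by (rule integral_mono[OF pi bi]) (auto simp: indicator_def bump_nonneg)
    then show "\<eta> x \<le> 1" unfolding \<eta> using A by simp
    show "\<eta> x = 1" if P: "cball x \<epsilon> \<subseteq> P"
    proof -
      have "indicator P y * bump 2 ((y - x) /\<^sub>R \<epsilon>) = bump 2 ((y - x) /\<^sub>R \<epsilon>)" for y
        using subsetD[OF P, of y] bump_at_eq_0[of 2 \<epsilon> y x] assms(3) by (cases "y \<in> P") auto
      then have "(LINT y|lborel. indicator P y * bump 2 ((y - x) /\<^sub>R \<epsilon>)) = A" by (simp only: bA)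
      then show ?thesis unfolding \<eta> using A by simp
    qed
    show "\<eta> x = 0" if P: "cball x \<epsilon> \<inter> P = {}"
    proof -
      have "indicator P y * bump 2 ((y - x) /\<^sub>R \<epsilon>) = 0" for y
        using disjoint_iff[THEN iffD1, OF P] bump_at_eq_0[of 2 \<epsilon> y x] assms(3) by (cases "y \<in> P") auto
      then have "(LINT y|lborel. indicator P y * bump 2 ((y - x) /\<^sub>R \<epsilon>)) = 0" by (simp only: Bochner_Integration.integral_zero)
      then show ?thesis unfolding \<eta> by simp
    qed
    fix v
    have "\<bar>LINT y|lborel. indicator P y *\<^sub>R (- (2 * real 2 / \<epsilon>\<^sup>2) * ((x + - y - 0) \<bullet> v) * bump (2 - 1) ((x + - y - 0) /\<^sub>R \<epsilon>))\<bar>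
      \<le> (LINT y|lborel. indicator (cball x \<epsilon>) y * (4 / \<epsilon> * norm v))"
    proof (rule integral_abs_bound_integral)
      have "continuous_on UNIV (\<lambda>y. - (2 * real 2 / \<epsilon>\<^sup>2) * ((x + - y - 0) \<bullet> v) * bump (2 - 1) ((y - x) /\<^sub>R \<epsilon>))"
        by (intro continuous_intros continuous_on_bump_at)
      from integrable_compact_support[OF this compact_cball[of x \<epsilon>]]
      have i: "integrable lborel (\<lambda>y. - (2 * real 2 / \<epsilon>\<^sup>2) * ((x + - y - 0) \<bullet> v) * bump (2 - 1) ((x + - y - 0) /\<^sub>R \<epsilon>))"
        unfolding flip using bump_at_eq_0[of 1 \<epsilon> _ x] assms(3) by simp
      show "integrable lborel (\<lambda>y. indicator P y *\<^sub>R (- (2 * real 2 / \<epsilon>\<^sup>2) * ((x + - y - 0) \<bullet> v) * bump (2 - 1) ((x + - y - 0) /\<^sub>R \<epsilon>)))"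
      proof (rule Bochner_Integration.integrable_bound[OF i])
        show "(\<lambda>y. indicator P y *\<^sub>R (- (2 * real 2 / \<epsilon>\<^sup>2) * ((x + - y - 0) \<bullet> v) * bump (2 - 1) ((x + - y - 0) /\<^sub>R \<epsilon>))) \<in> borel_measurable lborel"
          by (intro borel_measurable_scaleR borel_measurable_indicator borel_measurable_integrable[OF i])
            (use assms(1) in simp)
      qed (auto simp: indicator_def)
      show "integrable lborel (\<lambda>y. indicator (cball x \<epsilon>) y * (4 / \<epsilon> * norm v))"
        by (intro integrable_mult_left integrable_indicator_cball)
      fix y :: 'a
      show "\<bar>indicator P y *\<^sub>R (- (2 * real 2 / \<epsilon>\<^sup>2) * ((x + - y - 0) \<bullet> v) * bump (2 - 1) ((x + - y - 0) /\<^sub>R \<epsilon>))\<bar>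
        \<le> indicator (cball x \<epsilon>) y * (4 / \<epsilon> * norm v)"
      proof (cases "y \<in> cball x \<epsilon>")
        case True
        have "\<bar>(x - y) \<bullet> v\<bar> \<le> norm (x - y) * norm v" by (rule Cauchy_Schwarz_ineq2)
        also have "\<dots> \<le> \<epsilon> * norm v" using True by (intro mult_right_mono) (auto simp: dist_norm)
        finally have "indicator P y * (4 / \<epsilon>\<^sup>2 * \<bar>(x - y) \<bullet> v\<bar> * bump 1 ((y - x) /\<^sub>R \<epsilon>)) \<le> 1 * (4 / \<epsilon>\<^sup>2 * (\<epsilon> * norm v) * 1)"
          using assms(3) by (intro mult_mono bump_le_1 mult_nonneg_nonneg bump_nonneg) (auto simp: indicator_def)
        also have "\<dots> = 4 / \<epsilon> * norm v" using assms(3) by (simp add: power2_eq_square)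
        finally show ?thesis unfolding flip using True by (simp add: abs_mult bump_nonneg)
      next
        case False
        then have "bump (2 - 1) ((y - x) /\<^sub>R \<epsilon>) = 0" using bump_at_eq_0[of 1 \<epsilon> y x] assms(3) by simp
        then show ?thesis unfolding flip using False by simp
      qed
    qed
    also have "\<dots> = \<epsilon> ^ DIM('a) * V * (4 / \<epsilon> * norm v)"
      using assms(3) by (simp add: content_cball V_def)
    finally have "\<bar>\<eta>' x v\<bar> \<le> \<epsilon> ^ DIM('a) * V * (4 / \<epsilon> * norm v) / A"
      unfolding \<eta>'_def abs_divide abs_of_pos[OF A] using A by (intro divide_right_mono) auto
    also have "\<dots> = (4 * V / c) / \<epsilon> * norm v" unfolding A_def using assms(3) c by (simp add: mult_ac)
    also have "\<dots> \<le> gradient_const TYPE('a) / \<epsilon> * norm v"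
      unfolding gradient_const_def c_def[symmetric] V_def[symmetric] using assms(3)
      by (intro mult_right_mono divide_right_mono) auto
    finally show "\<bar>\<eta>' x v\<bar> \<le> gradient_const TYPE('a) / \<epsilon> * norm v" .
  qed
qed

lemma plateau_function:
  fixes S :: "'a::euclidean_space set"
  assumes "compact S" "open W" "S \<subseteq> W"
  obtains \<eta> \<eta>' T where "C1_on UNIV \<eta> \<eta>'" "compact T" "T \<subseteq> W" "\<And>x. x \<notin> T \<Longrightarrow> \<eta> x = (0::real)"
    "\<And>x. x \<in> S \<Longrightarrow> \<eta> x = 1" "\<And>x v. x \<in> S \<Longrightarrow> \<eta>' x v = 0"
proof -
  obtain e where e: "e > 0" "(\<Union>x\<in>S. ball x e) \<subseteq> W"
    using compact_subset_open_imp_ball_epsilon_subset[OF assms] by blast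
  define P where "P = (\<Union>x\<in>S. ball x (e / 2))"
  define T where "T = (\<Union>x\<in>S. \<Union>y\<in>cball 0 (3 * e / 4). {x + y})"
  obtain R where R: "R > 0" "\<And>x. x \<in> S \<Longrightarrow> norm x \<le> R" using compact_norm_bound[OF assms(1)] by blast
  have "norm z \<le> R + e" if zP: "z \<in> P" for z
  proof -
    obtain x where "x \<in> S" "dist x z < e / 2" using zP unfolding P_def by auto
    then show ?thesis using R(2)[of x] norm_triangle_sub[of z x] e(1) by (simp add: dist_norm norm_minus_commute)
  qed
  then have "bounded P" unfolding bounded_iff by blast
  moreover have "P \<in> sets borel" unfolding P_def by (intro borel_open open_UN) auto
  ultimately obtain \<eta> \<eta>' where \<eta>: "C1_on UNIV \<eta> \<eta>'" "\<And>x. cball x (e / 8) \<subseteq> P \<Longrightarrow> \<eta> x = (1::real)"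
    "\<And>x. cball x (e / 8) \<inter> P = {} \<Longrightarrow> \<eta> x = 0"
    using mollified_indicator[of P "e / 8"] e(1) by (metis divide_pos_pos zero_less_numeral)
  have one: "\<eta> z = 1" if "x \<in> S" "z \<in> ball x (e / 4)" for x z
  proof (rule \<eta>(2), rule subsetI)
    fix y assume "y \<in> cball z (e / 8)"
    then have "dist x y < e / 2" using dist_triangle[of x y z] that(2) e(1) by simp
    then show "y \<in> P" unfolding P_def using that(1) by auto
  qed
  show ?thesis
  proof (rule that[OF \<eta>(1)])
    have "T = (\<Union>x\<in>S. \<Union>y\<in>cball 0 (3 * e / 4). {x + y})" by (simp add: T_def)
    then show "compact T" using compact_sums'[OF assms(1) compact_cball] by simp
    show "T \<subseteq> W"
    proof
      fix z assume "z \<in> T"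
      then obtain x y where xy: "x \<in> S" "norm y \<le> 3 * e / 4" "z = x + y" unfolding T_def by auto
      then have "z \<in> ball x e" using e(1) by (simp add: dist_norm)
      then show "z \<in> W" using e(2) xy(1) by blast
    qed
    show "\<eta> z = 0" if z: "z \<notin> T" for z
    proof (rule \<eta>(3), rule ccontr)
      assume "cball z (e / 8) \<inter> P \<noteq> {}"
      then obtain y x where xy: "dist z y \<le> e / 8" "x \<in> S" "dist x y < e / 2" unfolding P_def by auto
      then have "dist x z \<le> 3 * e / 4" using dist_triangle[of x z y] e(1) by (simp add: dist_commute)
      then have "z - x \<in> cball 0 (3 * e / 4)" by (simp add: dist_norm norm_minus_commute)
      then have "z \<in> T" unfolding T_def using xy(2) by (intro UN_I[of x] UN_I[of "z - x"]) auto
      then show False using z by simp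
    qed
    show "\<eta> x = 1" if "x \<in> S" for x using one[OF that] e(1) by simp
    show "\<eta>' x v = 0" if x: "x \<in> S" for x v
    proof -
      have "(\<eta> has_derivative (\<lambda>v. 0)) (at x)"
        by (rule has_derivative_transform_within_open[where f = "\<lambda>x. 1" and s = "ball x (e / 4)"])
          (use one[OF x] e(1) in auto)
      then have "\<eta>' x = (\<lambda>v. 0)" by (rule has_derivative_unique[OF C1_onD(1)[OF \<eta>(1) UNIV_I]])
      then show ?thesis by simp
    qed
  qed
qed

text \<open>
  Multiplication with a plateau function makes \<open>u\<close> global without changing it on the support of \<open>g\<close>.
\<close>

lemma integral_swap_derivatives_local:
  fixes g :: "'a::euclidean_space \<Rightarrow> real" and u :: "'a \<Rightarrow> 'b::euclidean_space"
  assumes g: "C1_on UNIV g g'" "compact S" "\<And>x. x \<notin> S \<Longrightarrow> g x = 0"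
    and u: "C1_on W u u'" "open W" "S \<subseteq> W"
  shows "(LINT x|lborel. g' x a *\<^sub>R u' x b) = (LINT x|lborel. g' x b *\<^sub>R u' x a)"
proof -
  obtain \<eta> \<eta>' T where \<eta>: "C1_on UNIV \<eta> \<eta>'" "compact T" "T \<subseteq> W" "\<And>x. x \<notin> T \<Longrightarrow> \<eta> x = (0::real)"
    "\<And>x. x \<in> S \<Longrightarrow> \<eta> x = 1" "\<And>x v. x \<in> S \<Longrightarrow> \<eta>' x v = 0"
    using plateau_function[OF g(2) u(2,3)] by metis
  have g0: "g' x v = 0" if "x \<notin> S" for x v
    by (rule C1_on_zero_off[OF g(1) compact_imp_closed[OF g(2)] _ that]) (rule g(3))
  have e: "g' x a *\<^sub>R (\<eta> x *\<^sub>R u' x b + \<eta>' x b *\<^sub>R u x) = g' x a *\<^sub>R u' x b" for a b x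
    using g0 \<eta>(5,6) by (cases "x \<in> S") auto
  have "C1_on UNIV (\<lambda>x. \<eta> x *\<^sub>R u x) (\<lambda>x v. \<eta> x *\<^sub>R u' x v + \<eta>' x v *\<^sub>R u x)"
    by (rule C1_on_extend_zero[OF \<eta>(1) compact_imp_closed[OF \<eta>(2)] \<eta>(3) u(2) _ u(1)]) (rule \<eta>(4))
  from integral_swap_derivatives[OF g(1,2) _ this, of a b] show ?thesis
    unfolding e using g(3) by simp
qed

section \<open>The fundamental solution\<close>

text \<open>
  Up to a constant, \<open>fund\<close> is the gradient of the fundamental solution of the Laplacian. In dimension \<open>1\<close>
  it is the sign function.
\<close>

definition fund :: "'v::euclidean_space \<Rightarrow> 'v" where
  "fund y = y /\<^sub>R norm y ^ DIM('v)"

lemma norm_fund: "norm (fund (y :: 'v::euclidean_space)) = norm y / norm y ^ DIM('v)"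
  by (simp add: fund_def divide_inverse mult.commute)

lemma norm_fund_le_1: "norm y \<ge> 1 \<Longrightarrow> norm (fund (y :: 'v::euclidean_space)) \<le> 1"
proof -
  assume y: "norm y \<ge> 1"
  have "norm y ^ 1 \<le> norm y ^ DIM('v)" using y DIM_positive[where 'a='v] by (intro power_increasing) auto
  then show ?thesis unfolding norm_fund using y by (simp add: divide_le_eq_1)
qed

lemma fund_minus: "fund (- y) = - fund y"
  by (simp add: fund_def)

lemma measurable_cball [measurable]: "cball (a::'v::euclidean_space) r \<in> sets borel"
  by simp

lemma measurable_fund [measurable]: "fund \<in> borel_measurable borel"
  unfolding fund_def[abs_def] by measurable

text \<open>
  The singularity is integrable: on the shell between the radii \<open>2\<^sup>-\<^sup>k\<^sup>-\<^sup>1\<close> and \<open>2\<^sup>-\<^sup>k\<close> the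
  contribution is at most a constant times \<open>2\<^sup>-\<^sup>k\<close>.
\<close>

lemma integrable_fund_unit_ball:
  "integrable lborel (\<lambda>y::'v::euclidean_space. indicator (cball 0 1) y *\<^sub>R norm (fund y))"
proof -
  define d where "d = DIM('v)"
  have d: "d > 0" unfolding d_def by simp
  define V where "V = measure lborel (cball (0::'v) 1)"
  define a where "a k y = ((2::real) ^ (k + 1)) ^ (d - 1) * indicator (cball (0::'v) ((1/2) ^ k)) y" for k y
  have bound: "ennreal (indicator (cball 0 1) y *\<^sub>R norm (fund y)) \<le> (\<Sum>k. ennreal (a k y))" for y :: 'v
  proof (cases "norm y \<le> 1 \<and> y \<noteq> 0")
    case True
    define n where "n = (LEAST n. (1/2) ^ n < norm y)"
    have "\<exists>n. (1/2) ^ n < norm y" by (rule real_arch_pow_inv) (use True in auto)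
    then have n: "(1/2) ^ n < norm y" unfolding n_def by (rule LeastI_ex)
    have "n \<noteq> 0" using n True by (intro notI) simp
    then obtain k where k: "n = Suc k" by (cases n) auto
    have "\<not> (1/2) ^ k < norm y" using not_less_Least[of k "\<lambda>n. (1/2) ^ n < norm y"] k unfolding n_def by simp
    then have yk: "norm y \<le> (1/2) ^ k" by simp
    have "norm (fund y) = 1 / norm y ^ (d - 1)"
      unfolding norm_fund d_def[symmetric] using d True by (cases d) auto
    also have "\<dots> \<le> 1 / ((1/2) ^ (k + 1)) ^ (d - 1)"
      using n k True by (intro divide_left_mono power_mono mult_pos_pos zero_less_power) auto
    also have "\<dots> = (2 ^ (k + 1)) ^ (d - 1)" by (simp add: power_divide)
    finally have "indicator (cball 0 1) y *\<^sub>R norm (fund y) \<le> a k y" using yk True by (simp add: a_def)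
    then have "ennreal (indicator (cball 0 1) y *\<^sub>R norm (fund y)) \<le> ennreal (a k y)" by (rule ennreal_leI)
    also have "\<dots> \<le> (\<Sum>k. ennreal (a k y))" using sum_le_suminf[of "\<lambda>k. ennreal (a k y)" "{k}"] by simp
    finally show ?thesis .
  qed (auto simp: fund_def)
  have "(\<integral>\<^sup>+ y. ennreal (indicator (cball 0 1) y *\<^sub>R norm (fund (y::'v))) \<partial>lborel) \<le> (\<integral>\<^sup>+ y. (\<Sum>k. ennreal (a k y)) \<partial>lborel)"
    by (rule nn_integral_mono) (rule bound)
  also have "\<dots> = (\<Sum>k. \<integral>\<^sup>+ y. ennreal (a k y) \<partial>lborel)"
    by (rule nn_integral_suminf) (unfold a_def, measurable)
  also have "\<dots> = (\<Sum>k. ennreal ((2 ^ (d - 1) * V) * (1/2) ^ k))"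
  proof (rule arg_cong[of _ _ suminf], rule ext)
    fix k
    have "(\<integral>\<^sup>+ y. ennreal (a k y) \<partial>lborel) = ennreal ((2 ^ (k + 1)) ^ (d - 1)) * emeasure lborel (cball (0::'v) ((1/2) ^ k))"
      unfolding a_def by (simp add: ennreal_mult' ennreal_indicator nn_integral_cmult_indicator)
    also have "emeasure lborel (cball (0::'v) ((1/2) ^ k)) = ennreal (measure lborel (cball (0::'v) ((1/2) ^ k)))"
      using emeasure_lborel_cball_finite[of "0::'v" "(1/2) ^ k"] by (intro emeasure_eq_ennreal_measure) auto
    also have "measure lborel (cball (0::'v) ((1/2) ^ k)) = ((1/2) ^ k) ^ d * V"
      by (simp add: content_cball V_def d_def)
    also have "ennreal ((2 ^ (k + 1)) ^ (d - 1)) * ennreal (((1/2) ^ k) ^ d * V)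
        = ennreal ((2 ^ (k + 1)) ^ (d - 1) * (((1/2) ^ k) ^ d * V))"
      by (rule ennreal_mult'[symmetric]) simp
    also have "(2 ^ (k + 1)) ^ (d - 1) * (((1/2) ^ k) ^ d * V) = (2 ^ (d - 1) * V) * (1/2) ^ k"
    proof -
      obtain m where m: "d = Suc m" using d by (cases d) auto
      have "(2 ^ (k + 1)) ^ m * (((1/2) ^ k) ^ Suc m) = 2 ^ m * ((2::real) ^ k * (1/2) ^ k) ^ m * (1/2) ^ k"
        by (simp add: power_mult_distrib mult_ac)
      also have "(2::real) ^ k * (1/2) ^ k = 1" by (simp add: power_mult_distrib[symmetric])
      finally show ?thesis by (simp add: m mult_ac)
    qed
    finally show "(\<integral>\<^sup>+ y. ennreal (a k y) \<partial>lborel) = ennreal ((2 ^ (d - 1) * V) * (1/2) ^ k)" .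
  qed
  also have "\<dots> < \<infinity>"
  proof -
    have "summable (\<lambda>k. (2 ^ (d - 1) * V) * (1/2) ^ k)" by (intro summable_mult summable_geometric) simp
    then have "(\<Sum>k. ennreal ((2 ^ (d - 1) * V) * (1/2) ^ k)) \<noteq> top"
      by (rule ennreal_suminf_neq_top) (simp add: V_def)
    then show ?thesis by (simp only: infinity_ennreal_def less_top)
  qed
  finally show ?thesis by (intro integrableI_nonneg) simp_all
qed

lemma integrable_fund_cball:
  "integrable lborel (\<lambda>y::'v::euclidean_space. indicator (cball 0 R) y *\<^sub>R norm (fund y))"
proof (rule Bochner_Integration.integrable_bound)
  show "integrable lborel (\<lambda>y::'v. indicator (cball 0 1) y *\<^sub>R norm (fund y) + indicator (cball 0 R) y)"
    by (intro Bochner_Integration.integrable_add integrable_fund_unit_ball integrable_indicator_cball)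
  show "AE y in lborel. norm (indicator (cball 0 R) y *\<^sub>R norm (fund (y::'v)))
      \<le> norm (indicator (cball 0 1) y *\<^sub>R norm (fund y) + indicator (cball 0 R) y :: real)"
    using norm_fund_le_1[where 'v = 'v] by (intro AE_I2) (auto simp: indicator_def)
qed measurable

lemma integrable_fund_component:
  "integrable lborel (\<lambda>y::'v::euclidean_space. indicator (cball 0 R) y *\<^sub>R (fund y \<bullet> w))"
proof (rule Bochner_Integration.integrable_bound[OF integrable_mult_right[OF integrable_fund_cball[of R], of "norm w"]])
  show "AE y in lborel. norm (indicator (cball 0 R) y *\<^sub>R (fund (y::'v) \<bullet> w)) \<le> norm (norm w * (indicator (cball 0 R) y *\<^sub>R norm (fund y)))"
  proof (rule AE_I2)
    fix y :: 'v
    show "norm (indicator (cball 0 R) y *\<^sub>R (fund y \<bullet> w)) \<le> norm (norm w * (indicator (cball 0 R) y *\<^sub>R norm (fund y)))"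
      using Cauchy_Schwarz_ineq2[of "fund y" w] by (simp add: indicator_def mult.commute)
  qed
qed measurable

lemma inner_self_powr:
  assumes "y \<noteq> 0"
  shows "(y \<bullet> y) powr r = norm y powr (2 * r)"
proof -
  have "y \<bullet> y = norm y powr 2" using assms by (simp add: power2_norm_eq_inner)
  then show ?thesis by (simp only: powr_powr)
qed

text \<open>
  A smooth gradient field that replaces \<open>|y|\<^sup>2\<close> by \<open>\<delta>\<^sup>2 + |y|\<^sup>2\<close>. Its Jacobian matrix is symmetric, and its divergence is
  positive and concentrates at the origin as \<open>\<delta>\<close> tends to \<open>0\<close>. It is dominated by \<open>fund\<close>, so that both
  properties pass to the limit.
\<close>

definition fund_eps :: "real \<Rightarrow> 'v::euclidean_space \<Rightarrow> 'v" where
  "fund_eps \<delta> y = ((\<delta>\<^sup>2 + y \<bullet> y) powr (- real DIM('v) / 2)) *\<^sub>R y"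

definition fund_eps_deriv :: "real \<Rightarrow> 'v::euclidean_space \<Rightarrow> 'v \<Rightarrow> 'v \<Rightarrow> real" where
  "fund_eps_deriv \<delta> v w y = (v \<bullet> w) * (\<delta>\<^sup>2 + y \<bullet> y) powr (- real DIM('v) / 2)
     - real DIM('v) * (y \<bullet> v) * (y \<bullet> w) * (\<delta>\<^sup>2 + y \<bullet> y) powr (- real DIM('v) / 2 - 1)"

lemma C1_on_fund_eps:
  fixes w :: "'v::euclidean_space"
  assumes "\<delta> > 0"
  shows "C1_on UNIV (\<lambda>y. fund_eps \<delta> y \<bullet> w) (\<lambda>y v. fund_eps_deriv \<delta> v w y)"
proof (rule C1_onI)
  fix y :: 'v
  define r where "r = - real DIM('v) / 2"
  have pos: "\<delta>\<^sup>2 + y \<bullet> y > 0" for y :: 'v using assms by (intro add_pos_nonneg) auto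
  have d1: "((\<lambda>s. s powr r) has_derivative (\<lambda>h. (r * (\<delta>\<^sup>2 + y \<bullet> y) powr (r - 1)) * h)) (at (\<delta>\<^sup>2 + y \<bullet> y))"
    using has_real_derivative_powr[OF pos[of y], of r] by (simp add: has_field_derivative_def)
  have d2: "((\<lambda>y. \<delta>\<^sup>2 + y \<bullet> y) has_derivative (\<lambda>v. 2 * (y \<bullet> v))) (at y)"
    by (auto intro!: derivative_eq_intros simp: inner_commute)
  have "((\<lambda>y. (\<delta>\<^sup>2 + y \<bullet> y) powr r) has_derivative (\<lambda>v. (r * (\<delta>\<^sup>2 + y \<bullet> y) powr (r - 1)) * (2 * (y \<bullet> v)))) (at y)"
    by (rule has_derivative_compose[OF d2 d1])
  moreover have "((\<lambda>y. y \<bullet> w) has_derivative (\<lambda>v. v \<bullet> w)) (at y)" by (auto intro!: derivative_eq_intros)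
  ultimately have "((\<lambda>y. (\<delta>\<^sup>2 + y \<bullet> y) powr r * (y \<bullet> w)) has_derivative
      (\<lambda>v. (\<delta>\<^sup>2 + y \<bullet> y) powr r * (v \<bullet> w) + (r * (\<delta>\<^sup>2 + y \<bullet> y) powr (r - 1)) * (2 * (y \<bullet> v)) * (y \<bullet> w))) (at y)"
    by (rule has_derivative_mult)
  moreover have "(\<delta>\<^sup>2 + y \<bullet> y) powr r * (v \<bullet> w) + (r * (\<delta>\<^sup>2 + y \<bullet> y) powr (r - 1)) * (2 * (y \<bullet> v)) * (y \<bullet> w)
      = fund_eps_deriv \<delta> v w y" for v
    unfolding fund_eps_deriv_def r_def[symmetric] by (simp add: r_def)
  ultimately show "((\<lambda>y. fund_eps \<delta> y \<bullet> w) has_derivative (\<lambda>v. fund_eps_deriv \<delta> v w y)) (at y)"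
    by (simp add: fund_eps_def r_def)
next
  have "\<delta>\<^sup>2 + y \<bullet> y \<noteq> 0" for y :: 'v using assms by (smt (verit) inner_ge_zero zero_less_power)
  then show "continuous_on UNIV (\<lambda>y. fund_eps_deriv \<delta> v w y)" for v
    unfolding fund_eps_deriv_def by (intro continuous_intros) auto
qed

lemma fund_eps_divergence:
  assumes "\<delta> > 0"
  shows "(\<Sum>b\<in>Basis. fund_eps_deriv \<delta> b b (y::'v::euclidean_space))
    = real DIM('v) * \<delta>\<^sup>2 * (\<delta>\<^sup>2 + y \<bullet> y) powr (- real DIM('v) / 2 - 1)"
proof -
  define r where "r = - real DIM('v) / 2"
  have pos: "\<delta>\<^sup>2 + y \<bullet> y > 0" using assms by (intro add_pos_nonneg) auto
  have "(\<delta>\<^sup>2 + y \<bullet> y) powr r = (\<delta>\<^sup>2 + y \<bullet> y) * (\<delta>\<^sup>2 + y \<bullet> y) powr (r - 1)"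
    using pos by (simp add: powr_mult_base)
  moreover have "(\<Sum>b\<in>(Basis::'v set). b \<bullet> b) = real DIM('v)" by simp
  moreover have "(\<Sum>b\<in>Basis. (y \<bullet> b) * (y \<bullet> b)) = y \<bullet> y" using euclidean_inner[of y y] by simp
  moreover have "(\<Sum>b\<in>Basis. fund_eps_deriv \<delta> b b y)
      = (\<Sum>b\<in>(Basis::'v set). b \<bullet> b) * (\<delta>\<^sup>2 + y \<bullet> y) powr r - real DIM('v) * (\<Sum>b\<in>Basis. (y \<bullet> b) * (y \<bullet> b)) * (\<delta>\<^sup>2 + y \<bullet> y) powr (r - 1)"
    unfolding fund_eps_deriv_def r_def[symmetric] sum_subtractf sum_distrib_right sum_distrib_left
    by (simp add: mult.assoc)
  ultimately show ?thesis unfolding r_def[symmetric] by (simp add: algebra_simps)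
qed

lemma fund_eps_le:
  assumes "\<delta> > 0"
  shows "\<bar>fund_eps \<delta> y \<bullet> w\<bar> \<le> norm (fund (y::'v::euclidean_space)) * norm w"
    and "\<delta>\<^sup>2 * (\<delta>\<^sup>2 + y \<bullet> y) powr (- real DIM('v) / 2 - 1) * norm y \<le> norm (fund y)"
proof -
  define r where "r = - real DIM('v) / 2"
  have a: "(\<delta>\<^sup>2 + y \<bullet> y) powr r * norm y \<le> norm (fund y)"
  proof (cases "y = 0")
    case False
    then have y: "y \<bullet> y > 0" by simp
    have "(\<delta>\<^sup>2 + y \<bullet> y) powr r \<le> (y \<bullet> y) powr r"
      using y by (intro powr_mono2') (auto simp: r_def)
    also have "(y \<bullet> y) powr r = 1 / norm y ^ DIM('v)"
    proof -
      have "(y \<bullet> y) powr r = norm y powr - real DIM('v)" using inner_self_powr[OF False, of r] by (simp add: r_def)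
      also have "\<dots> = 1 / norm y ^ DIM('v)" using False by (simp add: powr_minus powr_realpow divide_inverse)
      finally show ?thesis .
    qed
    finally have "(\<delta>\<^sup>2 + y \<bullet> y) powr r * norm y \<le> 1 / norm y ^ DIM('v) * norm y" by (rule mult_right_mono) simp
    then show ?thesis by (simp add: norm_fund)
  qed (simp add: fund_def)
  have "\<bar>fund_eps \<delta> y \<bullet> w\<bar> \<le> norm (fund_eps \<delta> y) * norm w" by (rule Cauchy_Schwarz_ineq2)
  also have "\<dots> \<le> norm (fund y) * norm w"
    using a by (intro mult_right_mono) (auto simp: fund_eps_def r_def)
  finally show "\<bar>fund_eps \<delta> y \<bullet> w\<bar> \<le> norm (fund y) * norm w" .
  have pos: "\<delta>\<^sup>2 + y \<bullet> y > 0" using assms by (intro add_pos_nonneg) auto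
  have "\<delta>\<^sup>2 * (\<delta>\<^sup>2 + y \<bullet> y) powr (r - 1) \<le> (\<delta>\<^sup>2 + y \<bullet> y) * (\<delta>\<^sup>2 + y \<bullet> y) powr (r - 1)"
    by (intro mult_right_mono) auto
  also have "\<dots> = (\<delta>\<^sup>2 + y \<bullet> y) powr r" using pos by (simp add: powr_mult_base)
  finally have "\<delta>\<^sup>2 * (\<delta>\<^sup>2 + y \<bullet> y) powr (r - 1) * norm y \<le> (\<delta>\<^sup>2 + y \<bullet> y) powr r * norm y"
    by (rule mult_right_mono) simp
  with a show "\<delta>\<^sup>2 * (\<delta>\<^sup>2 + y \<bullet> y) powr (- real DIM('v) / 2 - 1) * norm y \<le> norm (fund y)"
    unfolding r_def[symmetric] by linarith
qed

lemma fund_eps_tendsto: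
  fixes y :: "'v::euclidean_space"
  assumes "s \<longlonglongrightarrow> 0"
  shows "(\<lambda>n. fund_eps (s n) y \<bullet> w) \<longlonglongrightarrow> fund y \<bullet> w"
    and "y \<noteq> 0 \<Longrightarrow> (\<lambda>n. (s n)\<^sup>2 * ((s n)\<^sup>2 + y \<bullet> y) powr (- real DIM('v) / 2 - 1)) \<longlonglongrightarrow> 0"
proof -
  have t: "(\<lambda>n. ((s n)\<^sup>2 + y \<bullet> y) powr r) \<longlonglongrightarrow> (y \<bullet> y) powr r" if "y \<noteq> 0" for r
  proof -
    have "(\<lambda>n. ((s n)\<^sup>2 + y \<bullet> y) powr r) \<longlonglongrightarrow> (0\<^sup>2 + y \<bullet> y) powr r"
      by (intro tendsto_intros assms) (use that in auto)
    then show ?thesis by simp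
  qed
  show "(\<lambda>n. fund_eps (s n) y \<bullet> w) \<longlonglongrightarrow> fund y \<bullet> w"
  proof (cases "y = 0")
    case False
    have "(y \<bullet> y) powr (- real DIM('v) / 2) = norm y powr - real DIM('v)"
      using inner_self_powr[OF False, of "- real DIM('v) / 2"] by simp
    also have "\<dots> = inverse (norm y ^ DIM('v))" using False by (simp add: powr_minus powr_realpow)
    finally show ?thesis
      using tendsto_mult[OF t[OF False, of "- real DIM('v) / 2"] tendsto_const[of "y \<bullet> w"]]
      by (simp add: fund_eps_def fund_def)
  qed (simp add: fund_eps_def fund_def)
  show "(\<lambda>n. (s n)\<^sup>2 * ((s n)\<^sup>2 + y \<bullet> y) powr (- real DIM('v) / 2 - 1)) \<longlonglongrightarrow> 0" if "y \<noteq> 0"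
    using tendsto_mult[OF tendsto_power[OF assms, of 2] t[OF that, of "- real DIM('v) / 2 - 1"]] by simp
qed

lemma bounded_compact_support:
  fixes \<psi> :: "'a::euclidean_space \<Rightarrow> 'b::real_normed_vector"
  assumes "continuous_on UNIV \<psi>" "compact S" "\<And>x. x \<notin> S \<Longrightarrow> \<psi> x = 0"
  obtains M where "M > 0" "\<And>x. norm (\<psi> x) \<le> M"
proof -
  have "compact (\<psi> ` S)" using assms by (meson compact_continuous_image continuous_on_subset subset_UNIV)
  then obtain M where M: "M > 0" "\<And>y. y \<in> \<psi> ` S \<Longrightarrow> norm y \<le> M" using compact_norm_bound by blast
  have "norm (\<psi> x) \<le> M" for x using M assms(3)[of x] by (cases "x \<in> S") auto
  then show ?thesis using that M(1) by blast
qed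

lemma fund_integral:
  fixes \<psi> :: "'v::euclidean_space \<Rightarrow> 'b::euclidean_space"
  assumes "continuous_on UNIV \<psi>" "compact S" "\<And>x. x \<notin> S \<Longrightarrow> \<psi> x = 0"
  shows "integrable lborel (\<lambda>y. (fund y \<bullet> w) *\<^sub>R \<psi> y)"
    and "s \<longlonglongrightarrow> 0 \<Longrightarrow> (\<And>n. s n > 0) \<Longrightarrow> (\<lambda>n. LINT y|lborel. (fund_eps (s n) y \<bullet> w) *\<^sub>R \<psi> y) \<longlonglongrightarrow> (LINT y|lborel. (fund y \<bullet> w) *\<^sub>R \<psi> y)"
proof -
  obtain M where M: "M > 0" "\<And>x. norm (\<psi> x) \<le> M" using bounded_compact_support[OF assms] by blast
  obtain R where R: "R > 0" "\<And>x. x \<in> S \<Longrightarrow> norm x \<le> R" using compact_norm_bound[OF assms(2)] by blast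
  have [measurable]: "\<psi> \<in> borel_measurable borel" using borel_measurable_continuous_onI[OF assms(1)] .
  define W where "W y = (norm w * M) * (indicator (cball 0 R) y *\<^sub>R norm (fund y))" for y :: 'v
  have Wi: "integrable lborel W" unfolding W_def by (intro integrable_mult_right integrable_fund_cball)
  have b: "norm (r *\<^sub>R \<psi> y) \<le> W y" if r: "\<bar>r\<bar> \<le> norm (fund y) * norm w" for r y
  proof (cases "y \<in> S")
    case True
    have "\<bar>r\<bar> * norm (\<psi> y) \<le> (norm (fund y) * norm w) * M" using r M by (intro mult_mono) auto
    then show ?thesis using True R(2) by (simp add: W_def mult_ac)
  qed (use assms(3) M in \<open>simp add: W_def\<close>)
  show "integrable lborel (\<lambda>y. (fund y \<bullet> w) *\<^sub>R \<psi> y)"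
  proof (rule Bochner_Integration.integrable_bound[OF Wi])
    show "AE y in lborel. norm ((fund y \<bullet> w) *\<^sub>R \<psi> y) \<le> norm (W y)"
    proof (rule AE_I2)
      fix y
      have "norm ((fund y \<bullet> w) *\<^sub>R \<psi> y) \<le> W y" by (rule b[OF Cauchy_Schwarz_ineq2])
      also have "\<dots> \<le> norm (W y)" by simp
      finally show "norm ((fund y \<bullet> w) *\<^sub>R \<psi> y) \<le> norm (W y)" .
    qed
  qed measurable
  assume s: "s \<longlonglongrightarrow> 0" "\<And>n. s n > 0"
  show "(\<lambda>n. LINT y|lborel. (fund_eps (s n) y \<bullet> w) *\<^sub>R \<psi> y) \<longlonglongrightarrow> (LINT y|lborel. (fund y \<bullet> w) *\<^sub>R \<psi> y)"
  proof (rule integral_dominated_convergence[OF _ _ Wi])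
    show "AE y in lborel. (\<lambda>n. (fund_eps (s n) y \<bullet> w) *\<^sub>R \<psi> y) \<longlonglongrightarrow> (fund y \<bullet> w) *\<^sub>R \<psi> y"
      by (intro AE_I2 tendsto_intros fund_eps_tendsto(1)[OF s(1)])
    show "AE y in lborel. norm ((fund_eps (s n) y \<bullet> w) *\<^sub>R \<psi> y) \<le> W y" for n
      by (intro AE_I2 b fund_eps_le(1) s(2))
    show "(\<lambda>y. (fund_eps (s n) y \<bullet> w) *\<^sub>R \<psi> y) \<in> borel_measurable lborel" for n
      using borel_measurable_continuous_onI[OF C1_onD(4)[OF C1_on_fund_eps[OF s(2)[of n], of w]]] by simp
  qed measurable
qed

lemma fund_eps_by_parts:
  fixes \<phi> :: "'v::euclidean_space \<Rightarrow> 'b::euclidean_space"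
  assumes "C1_on UNIV \<phi> \<phi>'" "compact S" "\<And>x. x \<notin> S \<Longrightarrow> \<phi> x = 0" "\<delta> > 0"
  shows "(LINT y|lborel. (fund_eps \<delta> y \<bullet> w) *\<^sub>R \<phi>' y v) = - (LINT y|lborel. fund_eps_deriv \<delta> v w y *\<^sub>R \<phi> y)"
    and "integrable lborel (\<lambda>y. fund_eps_deriv \<delta> v w y *\<^sub>R \<phi> y)"
proof -
  note E = C1_on_fund_eps[OF assms(4), of w]
  have \<phi>0: "\<phi>' x v = 0" if "x \<notin> S" for x
    by (rule C1_on_zero_off[OF assms(1) compact_imp_closed[OF assms(2)] _ that]) (rule assms(3))
  have 1: "integrable lborel (\<lambda>y. (fund_eps \<delta> y \<bullet> w) *\<^sub>R \<phi>' y v)"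
    by (rule integrable_compact_support[OF _ assms(2)])
      (use C1_onD(4)[OF E] C1_onD(2)[OF assms(1)] \<phi>0 in \<open>auto intro!: continuous_on_scaleR\<close>)
  show 2: "integrable lborel (\<lambda>y. fund_eps_deriv \<delta> v w y *\<^sub>R \<phi> y)"
    by (rule integrable_compact_support[OF _ assms(2)])
      (use C1_onD(2)[OF E] C1_onD(4)[OF assms(1)] assms(3) in \<open>auto intro!: continuous_on_scaleR\<close>)
  have "(LINT y|lborel. (fund_eps \<delta> y \<bullet> w) *\<^sub>R \<phi>' y v + fund_eps_deriv \<delta> v w y *\<^sub>R \<phi> y) = 0"
    by (rule integral_derivative_compact_support[OF C1_on_scaleR[OF E assms(1)] assms(2)]) (use assms(3) in auto)
  then show "(LINT y|lborel. (fund_eps \<delta> y \<bullet> w) *\<^sub>R \<phi>' y v) = - (LINT y|lborel. fund_eps_deriv \<delta> v w y *\<^sub>R \<phi> y)"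
    using 1 2 by (simp add: add_eq_0_iff2)
qed

lemma inverse_Suc_sequence: "(\<lambda>n. inverse (real (Suc n))) \<longlonglongrightarrow> 0" "inverse (real (Suc n)) > 0"
  using LIMSEQ_inverse_real_of_nat by auto

text \<open>
  This says that \<open>fund\<close> is curl-free in the sense of distributions, also at its singularity.
\<close>

lemma fund_integral_symmetric:
  fixes \<phi> :: "'v::euclidean_space \<Rightarrow> 'b::euclidean_space"
  assumes "C1_on UNIV \<phi> \<phi>'" "compact S" "\<And>x. x \<notin> S \<Longrightarrow> \<phi> x = 0"
  shows "(LINT y|lborel. (fund y \<bullet> w) *\<^sub>R \<phi>' y v) = (LINT y|lborel. (fund y \<bullet> v) *\<^sub>R \<phi>' y w)"
proof -
  have \<phi>0: "\<phi>' x v = 0" if "x \<notin> S" for x v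
    by (rule C1_on_zero_off[OF assms(1) compact_imp_closed[OF assms(2)] _ that]) (rule assms(3))
  note lim = fund_integral(2)[OF C1_onD(2)[OF assms(1)] assms(2) \<phi>0 inverse_Suc_sequence]
  have "fund_eps_deriv \<delta> v w y = fund_eps_deriv \<delta> w v y" for \<delta> and y :: 'v
    unfolding fund_eps_deriv_def by (simp add: inner_commute mult_ac)
  moreover have "(LINT y|lborel. (fund_eps \<delta> y \<bullet> w) *\<^sub>R \<phi>' y v) = - (LINT y|lborel. fund_eps_deriv \<delta> v w y *\<^sub>R \<phi> y)"
    if "\<delta> > 0" for \<delta> v w by (rule fund_eps_by_parts(1)[OF assms(1,2) _ that]) (rule assms(3))
  ultimately have "(LINT y|lborel. (fund_eps (inverse (real (Suc n))) y \<bullet> w) *\<^sub>R \<phi>' y v)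
      = (LINT y|lborel. (fund_eps (inverse (real (Suc n))) y \<bullet> v) *\<^sub>R \<phi>' y w)" for n
    using inverse_Suc_sequence(2)[of n] by simp
  then show ?thesis using LIMSEQ_unique[OF lim[of w v]] lim[of v w] by simp
qed

text \<open>
  The divergence of \<open>fund_eps\<close>, multiplied by \<open>|y|\<close>, is dominated by \<open>fund\<close> and tends to \<open>0\<close> pointwise. As
  \<open>\<phi>\<close> vanishes at the origin, it is bounded by a multiple of \<open>|y|\<close>.
\<close>

lemma fund_integral_zero:
  fixes \<phi> :: "'v::euclidean_space \<Rightarrow> 'b::euclidean_space"
  assumes "C1_on UNIV \<phi> \<phi>'" "compact S" "\<And>x. x \<notin> S \<Longrightarrow> \<phi> x = 0" and "\<phi> 0 = 0"
  shows "(\<Sum>b\<in>Basis. LINT y|lborel. (fund y \<bullet> b) *\<^sub>R \<phi>' y b) = 0"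
proof -
  define s where "s n = inverse (real (Suc n))" for n
  have s: "s \<longlonglongrightarrow> 0" "s n > 0" for n unfolding s_def by (rule inverse_Suc_sequence)+
  have \<phi>0: "\<phi>' x v = 0" if "x \<notin> S" for x v
    by (rule C1_on_zero_off[OF assms(1) compact_imp_closed[OF assms(2)] _ that]) (rule assms(3))
  have lim: "(\<lambda>n. \<Sum>b\<in>Basis. LINT y|lborel. (fund_eps (s n) y \<bullet> b) *\<^sub>R \<phi>' y b)
      \<longlonglongrightarrow> (\<Sum>b\<in>Basis. LINT y|lborel. (fund y \<bullet> b) *\<^sub>R \<phi>' y b)"
    by (intro tendsto_sum fund_integral(2)[OF C1_onD(2)[OF assms(1)] assms(2) \<phi>0] s)
  define q where "q n y = real DIM('v) * ((s n)\<^sup>2 * ((s n)\<^sup>2 + y \<bullet> y) powr (- real DIM('v) / 2 - 1))" for n and y :: 'v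
  have eq: "(\<Sum>b\<in>Basis. LINT y|lborel. (fund_eps (s n) y \<bullet> b) *\<^sub>R \<phi>' y b) = - (LINT y|lborel. q n y *\<^sub>R \<phi> y)" for n
  proof -
    have "(\<Sum>b\<in>Basis. LINT y|lborel. (fund_eps (s n) y \<bullet> b) *\<^sub>R \<phi>' y b)
        = - (LINT y|lborel. (\<Sum>b\<in>Basis. fund_eps_deriv (s n) b b y *\<^sub>R \<phi> y))"
      using fund_eps_by_parts[OF assms(1-3) s(2)[of n]] by (simp add: sum_negf)
    then show ?thesis
      by (simp add: scaleR_sum_left[symmetric] fund_eps_divergence[OF s(2)] q_def mult.assoc)
  qed
  obtain M where M: "M > 0" "\<And>x y. norm (\<phi> y - \<phi> x) \<le> M * norm (y - x)"
    using C1_on_compact_bounded[OF assms(1-3)] by metis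
  obtain R where R: "R > 0" "\<And>x. x \<in> S \<Longrightarrow> norm x \<le> R" using compact_norm_bound[OF assms(2)] by blast
  define W where "W y = (real DIM('v) * M) * (indicator (cball 0 R) y *\<^sub>R norm (fund y))" for y :: 'v
  have Wi: "integrable lborel W" unfolding W_def by (intro integrable_mult_right integrable_fund_cball)
  have [measurable]: "\<phi> \<in> borel_measurable borel" using borel_measurable_continuous_onI[OF C1_onD(4)[OF assms(1)]] .
  have "(\<lambda>n. LINT y|lborel. q n y *\<^sub>R \<phi> y) \<longlonglongrightarrow> (LINT (y::'v)|lborel. (0::'b))"
  proof (rule integral_dominated_convergence[OF _ _ Wi])
    show "AE y in lborel. (\<lambda>n. q n y *\<^sub>R \<phi> y) \<longlonglongrightarrow> 0"
    proof (rule AE_I2)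
      fix y :: 'v
      show "(\<lambda>n. q n y *\<^sub>R \<phi> y) \<longlonglongrightarrow> 0"
      proof (cases "y = 0")
        case False
        have "(\<lambda>n. q n y *\<^sub>R \<phi> y) \<longlonglongrightarrow> (real DIM('v) * 0) *\<^sub>R \<phi> y"
          unfolding q_def by (intro tendsto_intros fund_eps_tendsto(2)[OF s(1) False])
        then show ?thesis by simp
      qed (simp add: assms(4))
    qed
    show "AE y in lborel. norm (q n y *\<^sub>R \<phi> y) \<le> W y" for n
    proof (rule AE_I2)
      fix y :: 'v
      show "norm (q n y *\<^sub>R \<phi> y) \<le> W y"
      proof (cases "y \<in> S")
        case True
        have q0: "q n y \<ge> 0" unfolding q_def by (intro mult_nonneg_nonneg) auto
        have "norm (\<phi> y) \<le> M * norm y" using M(2)[of y 0] assms(4) by simp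
        then have "q n y * norm (\<phi> y) \<le> q n y * (M * norm y)" using q0 by (rule mult_left_mono)
        also have "\<dots> = (real DIM('v) * M) * ((s n)\<^sup>2 * ((s n)\<^sup>2 + y \<bullet> y) powr (- real DIM('v) / 2 - 1) * norm y)"
          by (simp add: q_def)
        also have "\<dots> \<le> (real DIM('v) * M) * norm (fund y)"
          using M(1) by (intro mult_left_mono fund_eps_le(2) s(2)) auto
        finally show ?thesis using True R(2) q0 by (simp add: W_def)
      qed (use assms(3) M in \<open>simp add: W_def\<close>)
    qed
    show "(\<lambda>y. q n y *\<^sub>R \<phi> y) \<in> borel_measurable lborel" for n unfolding q_def by measurable
  qed measurable
  then have "(\<lambda>n. - (LINT y|lborel. q n y *\<^sub>R \<phi> y)) \<longlonglongrightarrow> - 0" by (intro tendsto_minus) simp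
  then show ?thesis using LIMSEQ_unique[OF lim] unfolding eq by simp
qed

text \<open>
  The value of the divergence on the test function \<open>bump 2\<close>, up to the sign. It normalises \<open>fund\<close>.
\<close>

definition fund_const :: "'v::euclidean_space itself \<Rightarrow> real" where
  "fund_const _ = (LINT y|lborel. 4 * (fund y \<bullet> y) * bump 1 (y::'v))"

lemma fund_inner_self: "fund (y::'v::euclidean_space) \<bullet> y = norm y ^ 2 / norm y ^ DIM('v)"
  by (simp add: fund_def power2_norm_eq_inner divide_inverse mult.commute)

lemma integrable_fund_inner_bump: "integrable lborel (\<lambda>y::'v::euclidean_space. 4 * (fund y \<bullet> y) * bump 1 y)"
proof -
  have b0: "bump 1 y = 0" if "y \<notin> cball 0 1" for y :: 'v using that by (intro bump_eq_0) auto
  have "integrable lborel (\<lambda>y::'v. \<Sum>b\<in>Basis. (fund y \<bullet> b) *\<^sub>R (4 * (y \<bullet> b) * bump 1 y))"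
    by (intro Bochner_Integration.integrable_sum fund_integral(1)[OF _ compact_cball[of 0 1]])
      (use b0 in \<open>auto intro!: continuous_intros continuous_on_bump\<close>)
  moreover have "(\<Sum>b\<in>Basis. (fund y \<bullet> b) *\<^sub>R (4 * (y \<bullet> b) * bump 1 y)) = 4 * (fund y \<bullet> y) * bump 1 y" for y :: 'v
    unfolding euclidean_inner[of "fund y" y] by (simp add: sum_distrib_left sum_distrib_right mult_ac)
  ultimately show ?thesis by simp
qed

lemma fund_const_pos: "fund_const TYPE('v::euclidean_space) > 0"
proof -
  obtain e :: 'v where e: "e \<in> Basis" using nonempty_Basis by blast
  let ?B = "cball ((1/2) *\<^sub>R e) (1/4)"
  have "0 < (1/16) * measure lborel ?B" using content_cball_pos[of "1/4" "(1/2) *\<^sub>R e"] by simp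
  also have "\<dots> = (LINT y|lborel. indicator ?B y * (1/16))" by simp
  also have "\<dots> \<le> (LINT y|lborel. 4 * (fund y \<bullet> y) * bump 1 (y::'v))"
  proof (rule integral_mono[OF _ integrable_fund_inner_bump])
    show "integrable lborel (\<lambda>y. indicator ?B y * (1/16) :: real)"
      by (intro integrable_mult_left integrable_indicator_cball)
    fix y :: 'v
    show "indicator ?B y * (1/16) \<le> 4 * (fund y \<bullet> y) * bump 1 y"
    proof (cases "y \<in> ?B")
      case True
      have "norm ((1/2) *\<^sub>R e) = 1/2" using e by simp
      then have y: "norm y \<ge> 1/4" "norm y \<le> 3/4"
        using True norm_triangle_ineq2[of "(1/2) *\<^sub>R e" y] norm_triangle_ineq2[of y "(1/2) *\<^sub>R e"]
        by (auto simp: dist_norm norm_minus_commute)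
      have "norm y ^ DIM('v) \<le> 1" using y by (intro power_le_one) auto
      moreover have "norm y ^ DIM('v) > 0" using y by (intro zero_less_power) auto
      ultimately have "norm y ^ 2 * 1 \<le> norm y ^ 2 * (1 / norm y ^ DIM('v))"
        by (intro mult_left_mono) (auto simp: le_divide_eq_1)
      then have 1: "fund y \<bullet> y \<ge> norm y ^ 2" unfolding fund_inner_self by simp
      have "norm y ^ 2 \<ge> (1/4) ^ 2" using y by (intro power_mono) auto
      with 1 have 2: "4 * (fund y \<bullet> y) \<ge> 1/4" by (simp add: power2_eq_square)
      have "norm y ^ 2 \<le> (3/4) ^ 2" using y by (intro power_mono) auto
      then have "y \<bullet> y \<le> 9/16" unfolding power2_norm_eq_inner by (simp add: power2_eq_square)
      then have 3: "bump 1 y \<ge> 1/4" by (simp add: bump_def)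
      have "(1/4) * (1/4) \<le> 4 * (fund y \<bullet> y) * bump 1 y" using 2 3 by (intro mult_mono) auto
      then show ?thesis using True by simp
    qed (simp add: fund_inner_self bump_nonneg)
  qed
  finally show ?thesis by (simp add: fund_const_def)
qed

text \<open>
  The distributional divergence of \<open>fund\<close> is a multiple of the Dirac measure: subtracting from \<open>\<phi>\<close> the
  multiple \<open>\<phi> 0\<close> of \<open>bump 2\<close> leaves a function that vanishes at the origin.
\<close>

lemma fund_integral_divergence:
  fixes \<phi> :: "'v::euclidean_space \<Rightarrow> 'b::euclidean_space"
  assumes "C1_on UNIV \<phi> \<phi>'" "compact S" "\<And>x. x \<notin> S \<Longrightarrow> \<phi> x = 0"
  shows "(\<Sum>b\<in>Basis. LINT y|lborel. (fund y \<bullet> b) *\<^sub>R \<phi>' y b) = - fund_const TYPE('v) *\<^sub>R \<phi> 0"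
proof -
  note B = C1_on_bump[of 2, where 'a = 'v]
  let ?B' = "\<lambda>(y::'v) v. - (2 * real 2) * (y \<bullet> v) * bump (2 - 1) y"
  have b0: "bump k y = 0" if "y \<notin> cball 0 1" "k > 0" for y :: 'v and k using that by (intro bump_eq_0) auto
  have \<phi>0: "\<phi>' x v = 0" if "x \<notin> S" for x v
    by (rule C1_on_zero_off[OF assms(1) compact_imp_closed[OF assms(2)] _ that]) (rule assms(3))
  have "C1_on UNIV (\<lambda>y. bump 2 y *\<^sub>R \<phi> 0) (\<lambda>y v. ?B' y v *\<^sub>R \<phi> 0)"
    using C1_on_linear_image[OF B, of "\<lambda>r. r *\<^sub>R \<phi> 0"] by (simp add: linearI scaleR_add_left)
  note C = C1_on_diff[OF assms(1) this]
  have "(\<Sum>b\<in>Basis. LINT y|lborel. (fund y \<bullet> b) *\<^sub>R (\<phi>' y b - ?B' y b *\<^sub>R \<phi> 0)) = 0"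
    by (rule fund_integral_zero[OF C, of "S \<union> cball 0 1"]) (use assms b0 in \<open>auto simp: bump_def\<close>)
  moreover have i1: "integrable lborel (\<lambda>y. (fund y \<bullet> b) *\<^sub>R \<phi>' y b)" for b
    by (rule fund_integral(1)[OF C1_onD(2)[OF assms(1)] assms(2) \<phi>0])
  moreover have i2: "integrable lborel (\<lambda>y. (fund y \<bullet> b) *\<^sub>R (?B' y b *\<^sub>R \<phi> 0))" for b
    by (rule fund_integral(1)[OF _ compact_cball[of 0 1]])
      (use b0 in \<open>auto intro!: continuous_intros continuous_on_bump\<close>)
  ultimately have "(\<Sum>b\<in>Basis. LINT y|lborel. (fund y \<bullet> b) *\<^sub>R \<phi>' y b)
      = (\<Sum>b\<in>Basis. LINT y|lborel. (fund y \<bullet> b) *\<^sub>R (?B' y b *\<^sub>R \<phi> 0))"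
    by (simp only: scaleR_diff_right Bochner_Integration.integral_diff sum_subtractf right_minus_eq)
  also have "\<dots> = (LINT y|lborel. (\<Sum>b\<in>Basis. (fund y \<bullet> b) *\<^sub>R (?B' y b *\<^sub>R \<phi> 0)))"
    by (rule Bochner_Integration.integral_sum[symmetric]) (rule i2)
  also have "(\<lambda>y. \<Sum>b\<in>Basis. (fund y \<bullet> b) *\<^sub>R (?B' y b *\<^sub>R \<phi> 0)) = (\<lambda>y. (- (4 * (fund y \<bullet> y) * bump 1 y)) *\<^sub>R \<phi> 0)"
  proof
    fix y :: 'v
    have "(\<Sum>b\<in>Basis. (fund y \<bullet> b) *\<^sub>R (?B' y b *\<^sub>R \<phi> 0)) = (\<Sum>b\<in>Basis. (fund y \<bullet> b) * ?B' y b) *\<^sub>R \<phi> 0"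
      by (simp add: scaleR_sum_left)
    also have "(\<Sum>b\<in>Basis. (fund y \<bullet> b) * ?B' y b) = - (4 * (fund y \<bullet> y) * bump 1 y)"
      unfolding euclidean_inner[of "fund y" y] by (simp add: sum_distrib_left sum_distrib_right sum_negf mult_ac)
    finally show "(\<Sum>b\<in>Basis. (fund y \<bullet> b) *\<^sub>R (?B' y b *\<^sub>R \<phi> 0)) = (- (4 * (fund y \<bullet> y) * bump 1 y)) *\<^sub>R \<phi> 0" .
  qed
  also have "(LINT y|lborel. (- (4 * (fund y \<bullet> y) * bump 1 (y::'v))) *\<^sub>R \<phi> 0) = - fund_const TYPE('v) *\<^sub>R \<phi> 0"
    using integral_scaleR_left[OF Bochner_Integration.integrable_minus[OF integrable_fund_inner_bump[where 'v = 'v]], of "\<phi> 0"]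
    by (simp add: fund_const_def)
  finally show ?thesis .
qed

section \<open>Thin layers at a smooth boundary\<close>

lemma strict_increase_on_segment:
  fixes \<rho> :: "'a::euclidean_space \<Rightarrow> real"
  assumes "C1_on B \<rho> \<rho>'" "convex B" "\<And>x. x \<in> B \<Longrightarrow> \<rho>' x v \<ge> c" "x \<in> B" "x + s *\<^sub>R v \<in> B" "s > 0"
  shows "\<rho> (x + s *\<^sub>R v) - \<rho> x \<ge> c * s"
proof -
  have seg: "x + t *\<^sub>R v \<in> B" if "0 \<le> t" "t \<le> s" for t
  proof -
    have "(1 - t / s) *\<^sub>R x + (t / s) *\<^sub>R (x + s *\<^sub>R v) \<in> B"
      using that assms(6) by (intro convexD_alt[OF assms(2,4,5)]) auto
    moreover have "(1 - t / s) *\<^sub>R x + (t / s) *\<^sub>R (x + s *\<^sub>R v) = x + t *\<^sub>R v"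
      using assms(6) by (simp add: algebra_simps)
    ultimately show ?thesis by simp
  qed
  have "\<exists>z>0. z < s \<and> \<rho> (x + s *\<^sub>R v) - \<rho> (x + 0 *\<^sub>R v) = (s - 0) * \<rho>' (x + z *\<^sub>R v) v"
  proof (rule MVT2[where f = "\<lambda>t. \<rho> (x + t *\<^sub>R v)" and f' = "\<lambda>t. \<rho>' (x + t *\<^sub>R v) v"])
    fix t :: real assume t: "0 \<le> t" "t \<le> s"
    have d: "(\<rho> has_derivative \<rho>' (x + t *\<^sub>R v)) (at (x + t *\<^sub>R v))" by (rule C1_onD(1)[OF assms(1) seg[OF t]])
    have "((\<lambda>t. \<rho> (x + t *\<^sub>R v)) has_derivative (\<lambda>h. \<rho>' (x + t *\<^sub>R v) (h *\<^sub>R v))) (at t)"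
      by (rule has_derivative_compose[where f = "\<lambda>t. x + t *\<^sub>R v" and g = \<rho>, OF _ d]) (auto intro!: derivative_eq_intros)
    moreover have "(\<lambda>h. \<rho>' (x + t *\<^sub>R v) (h *\<^sub>R v)) = (*) (\<rho>' (x + t *\<^sub>R v) v)"
      using linear_scale[OF has_derivative_linear[OF d]] by (auto simp: mult.commute)
    ultimately show "((\<lambda>t. \<rho> (x + t *\<^sub>R v)) has_real_derivative \<rho>' (x + t *\<^sub>R v) v) (at t)"
      by (simp add: has_field_derivative_def)
  qed fact
  then obtain z where "0 < z" "z < s" "\<rho> (x + s *\<^sub>R v) - \<rho> x = s * \<rho>' (x + z *\<^sub>R v) v" by auto
  then show ?thesis using assms(3)[OF seg[of z]] assms(6) by (simp add: mult.commute)
qed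

text \<open>
  Along \<open>v\<close> the function \<open>\<rho>\<close> grows at the rate \<open>c\<close>, so that translates of the layer
  \<open>\<bar>\<rho>\<bar> \<le> h\<close> by the multiples of \<open>3 h v / c\<close> are disjoint. About \<open>r c / (3 h)\<close> of them fit into a
  ball of twice the radius.
\<close>

lemma layer_measure:
  fixes \<rho> :: "'a::euclidean_space \<Rightarrow> real"
  assumes \<rho>: "C1_on (ball p r) \<rho> \<rho>'" "\<And>x. x \<in> ball p r \<Longrightarrow> \<rho>' x v \<ge> c" and v: "norm v = 1"
    and pos: "c > 0" "h > 0" "r > 0"
    and S: "S \<in> sets borel" "S \<subseteq> ball p r" "\<And>x. x \<in> S \<Longrightarrow> \<bar>\<rho> x\<bar> \<le> h"
  shows "measure lborel S \<le> 3 * measure lborel (ball p (2 * r)) / (r * c) * h"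
proof -
  define \<tau> where "\<tau> = 3 * h / c"
  have \<tau>: "\<tau> > 0" unfolding \<tau>_def using pos by simp
  define N where "N = nat \<lfloor>r / \<tau>\<rfloor> + 1"
  have N: "real N \<ge> r / \<tau>" unfolding N_def using pos \<tau> by linarith
  have Nk: "real k * \<tau> \<le> r" if "k < N" for k
  proof -
    have "k \<le> nat \<lfloor>r / \<tau>\<rfloor>" using that unfolding N_def by simp
    then have "real k \<le> r / \<tau>" using pos \<tau> by (simp add: le_nat_iff le_floor_iff)
    then show ?thesis using \<tau> by (simp add: le_divide_eq)
  qed
  have aux: False if "x - (real j * \<tau>) *\<^sub>R v \<in> S" "x - (real k * \<tau>) *\<^sub>R v \<in> S" "j < k" for x and j k :: nat
  proof -
    define y where "y = x - (real k * \<tau>) *\<^sub>R v"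
    define s where "s = real (k - j) * \<tau>"
    have s: "s \<ge> \<tau>" unfolding s_def using that(3) \<tau> by simp
    have y': "y + s *\<^sub>R v = x - (real j * \<tau>) *\<^sub>R v"
      unfolding y_def s_def using that(3) by (simp add: of_nat_diff algebra_simps)
    have "y \<in> ball p r" "y + s *\<^sub>R v \<in> ball p r" unfolding y' using S(2) that by (auto simp: y_def)
    moreover have "s > 0" using s \<tau> by linarith
    ultimately have "c * s \<le> \<rho> (y + s *\<^sub>R v) - \<rho> y"
      by (intro strict_increase_on_segment[OF \<rho>(1) convex_ball \<rho>(2)])
    moreover have "c * s \<ge> 3 * h" using s pos by (simp add: \<tau>_def field_simps)
    moreover have "\<bar>\<rho> (y + s *\<^sub>R v)\<bar> \<le> h" unfolding y' by (rule S(3)[OF that(1)])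
    moreover have "\<bar>\<rho> y\<bar> \<le> h" unfolding y_def by (rule S(3)[OF that(2)])
    ultimately show False using pos by linarith
  qed
  have le: "(\<Sum>k<N. indicator S (x + - (real k * \<tau>) *\<^sub>R v)) \<le> (indicator (ball p (2 * r)) x :: real)" for x
  proof (cases "\<exists>k<N. x + - (real k * \<tau>) *\<^sub>R v \<in> S")
    case True
    then obtain k where k: "k < N" "x - (real k * \<tau>) *\<^sub>R v \<in> S" by auto
    have "indicator S (x + - (real j * \<tau>) *\<^sub>R v) = (if j = k then 1 else (0::real))" for j
      using k(2) aux[of x j k] aux[of x k j] by (cases j k rule: linorder_cases) (auto simp: indicator_def)
    then have "(\<Sum>j<N. indicator S (x + - (real j * \<tau>) *\<^sub>R v)) = (1::real)" using k(1) by simp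
    moreover have "x \<in> ball p (2 * r)"
    proof -
      have "dist p x \<le> dist p (x - (real k * \<tau>) *\<^sub>R v) + dist (x - (real k * \<tau>) *\<^sub>R v) x" by (rule dist_triangle)
      also have "dist (x - (real k * \<tau>) *\<^sub>R v) x = real k * \<tau>" using \<tau> v by (simp add: dist_norm)
      also have "dist p (x - (real k * \<tau>) *\<^sub>R v) < r" using k(2) S(2) by auto
      finally show ?thesis using Nk[OF k(1)] by simp
    qed
    ultimately show ?thesis by simp
  next
    case False
    then have "(\<Sum>k<N. indicator S (x + - (real k * \<tau>) *\<^sub>R v)) = (0::real)" by (intro sum.neutral) (auto simp: indicator_def)
    then show ?thesis by simp
  qed
  have "emeasure lborel S \<le> emeasure lborel (ball p r)" by (rule emeasure_mono[OF S(2)]) simp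
  then have fin: "emeasure lborel S < \<infinity>" using emeasure_lborel_ball_finite by (rule order_le_less_trans)
  have Sm: "(indicator S :: 'a \<Rightarrow> real) \<in> borel_measurable borel" using S(1) by simp
  have Si: "integrable lborel (indicator S :: 'a \<Rightarrow> real)" using S(1) fin by (intro integrable_real_indicator) auto
  have Sti: "integrable lborel (\<lambda>x. indicator S (x + t) :: real)" for t
    using Si lborel_affine_integral(2)[OF Sm, of 1 t] by (simp add: add.commute)
  have "real N * measure lborel S = (\<Sum>k<N. (LINT x|lborel. indicator S (x + - (real k * \<tau>) *\<^sub>R v)))"
    unfolding lborel_translate[OF Sm] using S(1) by simp
  also have "\<dots> = (LINT x|lborel. (\<Sum>k<N. indicator S (x + - (real k * \<tau>) *\<^sub>R v)))"
    by (rule Bochner_Integration.integral_sum[symmetric]) (rule Sti)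
  also have "\<dots> \<le> (LINT x|lborel. indicator (ball p (2 * r)) x)"
  proof (rule integral_mono[OF _ _ le])
    show "integrable lborel (indicator (ball p (2 * r)) :: 'a \<Rightarrow> real)"
      using emeasure_lborel_ball_finite by (intro integrable_real_indicator) auto
  qed (intro Bochner_Integration.integrable_sum Sti)
  finally have "real N * measure lborel S \<le> measure lborel (ball p (2 * r))" by simp
  moreover have "(r / \<tau>) * measure lborel S \<le> real N * measure lborel S"
    by (intro mult_right_mono N) simp
  ultimately have "(r / \<tau>) * measure lborel S \<le> measure lborel (ball p (2 * r))" by linarith
  then show ?thesis using pos by (simp add: \<tau>_def field_simps)
qed

lemma Ck_on_1_iff_C1_on:
  fixes f :: "'a::euclidean_space \<Rightarrow> 'b::real_normed_vector"
  assumes "open U"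
  shows "Ck_on 1 U f \<longleftrightarrow> C1_on U f (\<lambda>x. frechet_derivative f (at x))"
proof
  assume *: "Ck_on 1 U f"
  show "C1_on U f (\<lambda>x. frechet_derivative f (at x))"
  proof (rule C1_onI)
    have d: "f differentiable (at x)" if "x \<in> U" for x
    proof -
      have "f differentiable_on U" using * by simp
      then show ?thesis using differentiable_on_eq_differentiable_at[OF assms] that by blast
    qed
    then show "(f has_derivative frechet_derivative f (at x)) (at x)" if "x \<in> U" for x
      using frechet_derivative_works that by blast
    fix v
    have "continuous_on U (\<lambda>x. \<Sum>b\<in>Basis. (v \<bullet> b) *\<^sub>R frechet_derivative f (at x) b)"
    proof (intro continuous_on_sum continuous_on_scaleR continuous_on_const)
      show "continuous_on U (\<lambda>x. frechet_derivative f (at x) b)" if "b \<in> Basis" for b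
        using * that by simp
    qed
    moreover have "frechet_derivative f (at x) v = (\<Sum>b\<in>Basis. (v \<bullet> b) *\<^sub>R frechet_derivative f (at x) b)" if "x \<in> U" for x
    proof -
      have l: "linear (frechet_derivative f (at x))" using d[OF that] by (rule linear_frechet_derivative)
      show ?thesis
        by (subst euclidean_representation[of v, symmetric]) (simp only: linear_sum[OF l] linear_scale[OF l])
    qed
    ultimately show "continuous_on U (\<lambda>x. frechet_derivative f (at x) v)"
      by (metis (no_types, lifting) continuous_on_cong)
  qed
next
  assume *: "C1_on U f (\<lambda>x. frechet_derivative f (at x))"
  then have "f differentiable_on U"
    unfolding differentiable_on_def differentiable_def using C1_onD(1) has_derivative_at_withinI by blast
  then show "Ck_on 1 U f" using C1_onD(2)[OF *] by simp
qed

lemma C1_on_imp_Ck_on_1: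
  fixes f :: "'a::euclidean_space \<Rightarrow> 'b::real_normed_vector"
  assumes "open U" "C1_on U f f'"
  shows "Ck_on 1 U f"
proof -
  have "C1_on U f (\<lambda>x. frechet_derivative f (at x))"
    by (rule C1_on_cong_open[OF assms(2,1) refl])
      (rule fun_cong[OF frechet_derivative_at[OF C1_onD(1)[OF assms(2)]]])
  then show ?thesis using Ck_on_1_iff_C1_on[OF assms(1)] by blast
qed

text \<open>
  Near \<open>p\<close> the defining function grows at a uniform rate in a fixed direction, in which its derivative at \<open>p\<close>
  is positive.
\<close>

lemma local_defining_function_direction:
  assumes "local_defining_function \<Omega> p V \<rho>"
  obtains r c M v where "r > 0" "c > 0" "M > 0" "norm v = 1" "ball p r \<subseteq> V"
    "C1_on V \<rho> (\<lambda>x. frechet_derivative \<rho> (at x))"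
    "\<And>x. x \<in> ball p r \<Longrightarrow> frechet_derivative \<rho> (at x) v \<ge> c"
    "\<And>x w. x \<in> ball p r \<Longrightarrow> \<bar>frechet_derivative \<rho> (at x) w\<bar> \<le> M * norm w"
proof -
  let ?D = "\<lambda>x. frechet_derivative \<rho> (at x)"
  have V: "open V" "p \<in> V" "smooth_on V \<rho>" "?D p \<noteq> (\<lambda>h. 0)"
    using assms by (auto simp: local_defining_function_def)
  have C1: "C1_on V \<rho> ?D" using V(1,3) Ck_on_1_iff_C1_on unfolding smooth_on_def by blast
  have lin: "linear (?D x)" if "x \<in> V" for x by (rule C1_onD(3)[OF C1 that])
  obtain w where w: "?D p w \<noteq> 0" using V(4) by auto
  define v where "v = (sgn (?D p w) / norm w) *\<^sub>R w"
  have w0: "w \<noteq> 0" using w linear_0[OF lin[OF V(2)]] by auto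
  have v1: "norm v = 1" unfolding v_def using w w0 by (simp add: abs_sgn_eq)
  have "?D p v = \<bar>?D p w\<bar> / norm w"
    unfolding v_def linear_scale[OF lin[OF V(2)]] by (simp add: abs_sgn mult.commute)
  then have vp: "?D p v > 0" using w w0 by simp
  define c where "c = ?D p v / 2"
  have c: "c > 0" unfolding c_def using vp by simp
  have "isCont (\<lambda>x. ?D x v) p" using C1_onD(2)[OF C1] continuous_on_eq_continuous_at[OF V(1)] V(2) by blast
  then obtain r1 where r1: "r1 > 0" "\<And>x. dist x p < r1 \<Longrightarrow> dist (?D x v) (?D p v) < c"
    unfolding continuous_at_eps_delta using c by metis
  obtain r2 where r2: "r2 > 0" "cball p r2 \<subseteq> V" using V(1,2) open_contains_cball by metis
  obtain M where M: "M > 0" "\<And>x v. x \<in> cball p r2 \<Longrightarrow> norm (?D x v) \<le> M * norm v"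
    using C1_on_bounded[OF C1 compact_cball r2(2)] by metis
  show ?thesis
  proof (rule that[OF _ c M(1) v1 _ C1])
    show "min r1 r2 > 0" using r1 r2 by simp
    show "ball p (min r1 r2) \<subseteq> V" using r2 by (auto simp: subset_iff)
    show "?D x v \<ge> c" if "x \<in> ball p (min r1 r2)" for x
    proof -
      have "dist (?D x v) (?D p v) < c" using r1(2)[of x] that by (simp add: dist_commute)
      then have "\<bar>?D x v - ?D p v\<bar> < c" by (simp add: dist_real_def)
      then show ?thesis unfolding c_def by linarith
    qed
    show "\<bar>?D x w\<bar> \<le> M * norm w" if "x \<in> ball p (min r1 r2)" for x w using M(2)[of x w] that by simp
  qed
qed

lemma inner_layer_measurable: "open \<Omega> \<Longrightarrow> {x \<in> \<Omega>. infdist x (- \<Omega>) \<le> \<epsilon>} \<in> sets borel"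
proof -
  assume "open \<Omega>"
  moreover have "closed {x. infdist x (- \<Omega>) \<le> \<epsilon>}" by (intro closed_Collect_le continuous_intros)
  moreover have "{x \<in> \<Omega>. infdist x (- \<Omega>) \<le> \<epsilon>} = \<Omega> \<inter> {x. infdist x (- \<Omega>) \<le> \<epsilon>}" by auto
  ultimately show ?thesis by (simp add: sets.Int)
qed

text \<open>
  A point of \<open>\<Omega>\<close> within distance \<open>\<epsilon>\<close> of a point outside of \<open>\<Omega>\<close> has \<open>|\<rho>| \<le> M \<epsilon>\<close>, because \<open>\<rho>\<close> changes sign between
  them.
\<close>

lemma local_inner_layer_measure:
  fixes \<Omega> :: "'a::euclidean_space set"
  assumes "open \<Omega>" "- \<Omega> \<noteq> {}" "local_defining_function \<Omega> p V \<rho>"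
  obtains r C where "r > 0" "C > 0"
    "\<And>\<epsilon>. 0 < \<epsilon> \<Longrightarrow> \<epsilon> < r \<Longrightarrow> measure lborel ({x \<in> \<Omega>. infdist x (- \<Omega>) \<le> \<epsilon>} \<inter> ball p r) \<le> C * \<epsilon>"
proof -
  obtain R c M v where R: "R > 0" "c > 0" "M > 0" "norm v = 1" "ball p R \<subseteq> V"
    "C1_on V \<rho> (\<lambda>x. frechet_derivative \<rho> (at x))"
    "\<And>x. x \<in> ball p R \<Longrightarrow> frechet_derivative \<rho> (at x) v \<ge> c"
    "\<And>x w. x \<in> ball p R \<Longrightarrow> \<bar>frechet_derivative \<rho> (at x) w\<bar> \<le> M * norm w"
    using local_defining_function_direction[OF assms(3)] by metis
  note C1 = C1_on_subset[OF R(6,5)]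
  have \<Omega>V: "x \<in> \<Omega> \<longleftrightarrow> \<rho> x < 0" if "x \<in> ball p R" for x
    using assms(3) that R(5) unfolding local_defining_function_def by blast
  define C where "C = 3 * measure lborel (ball p (2 * R)) / (R * c) * M"
  have "C > 0" unfolding C_def using R content_ball_pos[of "2 * R" p] by simp
  moreover have "measure lborel ({x \<in> \<Omega>. infdist x (- \<Omega>) \<le> \<epsilon>} \<inter> ball p (R / 2)) \<le> C * \<epsilon>"
    if \<epsilon>: "0 < \<epsilon>" "\<epsilon> < R / 2" for \<epsilon>
  proof -
    have "\<bar>\<rho> x\<bar> \<le> M * \<epsilon>" if "x \<in> \<Omega>" "infdist x (- \<Omega>) \<le> \<epsilon>" "x \<in> ball p (R / 2)" for x
    proof -
      obtain y where y: "y \<in> - \<Omega>" "infdist x (- \<Omega>) = dist x y"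
        using infdist_attains_inf[of "- \<Omega>" x] assms(1,2) by auto
      have "dist p y \<le> dist p x + dist x y" by (rule dist_triangle)
      then have yB: "y \<in> ball p R" using that y \<epsilon> by simp
      have xB: "x \<in> ball p R" using that R(1) by simp
      have "norm (\<rho> y - \<rho> x) \<le> M * norm (y - x)"
        by (rule C1_on_lipschitz[OF C1 convex_ball order_refl _ xB yB]) (use R(8) in simp)
      also have "\<dots> \<le> M * \<epsilon>" using that y R(3) by (intro mult_left_mono) (auto simp: dist_norm norm_minus_commute)
      finally show ?thesis using \<Omega>V[OF xB] \<Omega>V[OF yB] that y by auto
    qed
    then have "measure lborel ({x \<in> \<Omega>. infdist x (- \<Omega>) \<le> \<epsilon>} \<inter> ball p (R / 2))
        \<le> 3 * measure lborel (ball p (2 * R)) / (R * c) * (M * \<epsilon>)"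
      using inner_layer_measurable[OF assms(1), of \<epsilon>] R \<epsilon>
      by (intro layer_measure[OF C1 R(7,4,2) _ R(1)]) auto
    then show ?thesis by (simp add: C_def mult_ac)
  qed
  ultimately show ?thesis using that[of "R / 2" C] R(1) by simp
qed

text \<open>
  Finitely many of the balls of the previous lemma cover the boundary, and the part of \<open>\<Omega>\<close> outside of them
  has a positive distance from the complement.
\<close>

lemma inner_layer_measure:
  fixes \<Omega> :: "'a::euclidean_space set"
  assumes "open \<Omega>" "bounded \<Omega>" "smooth_boundary \<Omega>"
  obtains \<epsilon>0 C where "\<epsilon>0 > 0" "C > 0"
    "\<And>\<epsilon>. 0 < \<epsilon> \<Longrightarrow> \<epsilon> < \<epsilon>0 \<Longrightarrow> measure lborel {x \<in> \<Omega>. infdist x (- \<Omega>) \<le> \<epsilon>} \<le> C * \<epsilon>"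
proof -
  have ne: "- \<Omega> \<noteq> {}" using assms(2) not_bounded_UNIV by (metis Compl_empty_eq boolean_algebra_class.boolean_algebra.double_compl)
  have "\<forall>p\<in>frontier \<Omega>. \<exists>rC. fst rC > (0::real) \<and> snd rC > 0 \<and>
    (\<forall>\<epsilon>. 0 < \<epsilon> \<longrightarrow> \<epsilon> < fst rC \<longrightarrow> measure lborel ({x \<in> \<Omega>. infdist x (- \<Omega>) \<le> \<epsilon>} \<inter> ball p (fst rC)) \<le> snd rC * \<epsilon>)"
  proof
    fix p assume "p \<in> frontier \<Omega>"
    then obtain V \<rho> where "local_defining_function \<Omega> p V \<rho>" using assms(3) unfolding smooth_boundary_def by blast
    from local_inner_layer_measure[OF assms(1) ne this] obtain r C where "r > 0" "C > 0"
      "\<And>\<epsilon>. 0 < \<epsilon> \<Longrightarrow> \<epsilon> < r \<Longrightarrow> measure lborel ({x \<in> \<Omega>. infdist x (- \<Omega>) \<le> \<epsilon>} \<inter> ball p r) \<le> C * \<epsilon>" by blast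
    then show "\<exists>rC. fst rC > (0::real) \<and> snd rC > 0 \<and>
      (\<forall>\<epsilon>. 0 < \<epsilon> \<longrightarrow> \<epsilon> < fst rC \<longrightarrow> measure lborel ({x \<in> \<Omega>. infdist x (- \<Omega>) \<le> \<epsilon>} \<inter> ball p (fst rC)) \<le> snd rC * \<epsilon>)"
      by (intro exI[of _ "(r, C)"]) simp
  qed
  from bchoice[OF this] obtain q where q: "\<And>p. p \<in> frontier \<Omega> \<Longrightarrow> fst (q p) > (0::real)" "\<And>p. p \<in> frontier \<Omega> \<Longrightarrow> snd (q p) > 0"
    "\<And>p \<epsilon>. p \<in> frontier \<Omega> \<Longrightarrow> 0 < \<epsilon> \<Longrightarrow> \<epsilon> < fst (q p) \<Longrightarrow>
      measure lborel ({x \<in> \<Omega>. infdist x (- \<Omega>) \<le> \<epsilon>} \<inter> ball p (fst (q p))) \<le> snd (q p) * \<epsilon>"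
    by blast
  have "compact (frontier \<Omega>)" using assms(2) by (simp add: compact_frontier_bounded)
  then obtain F where F: "F \<subseteq> frontier \<Omega>" "finite F" "frontier \<Omega> \<subseteq> (\<Union>p\<in>F. ball p (fst (q p)))"
    by (rule compactE_image[of _ "frontier \<Omega>" "\<lambda>p. ball p (fst (q p))"]) (use q(1) in force)+
  define K where "K = closure \<Omega> - (\<Union>p\<in>F. ball p (fst (q p)))"
  have K: "compact K" unfolding K_def using assms(2) by (intro compact_diff compact_closure[THEN iffD2] open_UN) auto
  have K\<Omega>: "K \<subseteq> \<Omega>" unfolding K_def using F(3) assms(1) by (auto simp: frontier_def interior_open)
  obtain \<epsilon>1 where \<epsilon>1: "\<epsilon>1 > 0" "\<And>x. x \<in> K \<Longrightarrow> infdist x (- \<Omega>) > \<epsilon>1"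
  proof (cases "K = {}")
    case True
    then show ?thesis using that[of 1] by simp
  next
    case False
    have "continuous_on K (\<lambda>x. infdist x (- \<Omega>))" by (intro continuous_intros)
    from continuous_attains_inf[OF K False this] obtain x where x: "x \<in> K" "\<And>y. y \<in> K \<Longrightarrow> infdist x (- \<Omega>) \<le> infdist y (- \<Omega>)" by blast
    have "infdist x (- \<Omega>) \<noteq> 0" using x(1) K\<Omega> in_closed_iff_infdist_zero[of "- \<Omega>" x] assms(1) ne by auto
    then have p: "infdist x (- \<Omega>) > 0" using infdist_nonneg[of x "- \<Omega>"] by linarith
    then have "infdist y (- \<Omega>) > infdist x (- \<Omega>) / 2" if "y \<in> K" for y using x(2)[OF that] by linarith
    then show ?thesis using that[of "infdist x (- \<Omega>) / 2"] p by simp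
  qed
  define \<epsilon>0 where "\<epsilon>0 = Min (insert \<epsilon>1 ((\<lambda>p. fst (q p)) ` F))"
  have \<epsilon>0: "\<epsilon>0 > 0" "\<epsilon>0 \<le> \<epsilon>1" "\<And>p. p \<in> F \<Longrightarrow> \<epsilon>0 \<le> fst (q p)"
    unfolding \<epsilon>0_def using F q(1) \<epsilon>1 by (auto simp: subset_iff)
  define C where "C = 1 + (\<Sum>p\<in>F. snd (q p))"
  have C: "C > 0" unfolding C_def using F(1) q(2) by (intro add_pos_nonneg sum_nonneg) (auto simp: subset_iff less_imp_le)
  have "measure lborel {x \<in> \<Omega>. infdist x (- \<Omega>) \<le> \<epsilon>} \<le> C * \<epsilon>" if \<epsilon>: "0 < \<epsilon>" "\<epsilon> < \<epsilon>0" for \<epsilon>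
  proof -
    let ?L = "{x \<in> \<Omega>. infdist x (- \<Omega>) \<le> \<epsilon>}"
    have "?L \<subseteq> (\<Union>p\<in>F. ball p (fst (q p)))"
    proof
      fix x assume x: "x \<in> ?L"
      then have "x \<notin> K" using \<epsilon>1(2)[of x] \<epsilon>0(2) \<epsilon> by auto
      then show "x \<in> (\<Union>p\<in>F. ball p (fst (q p)))" using x closure_subset[of \<Omega>] unfolding K_def by auto
    qed
    then have eq: "?L = (\<Union>p\<in>F. ?L \<inter> ball p (fst (q p)))" by auto
    have "measure lborel ?L = measure lborel (\<Union>p\<in>F. ?L \<inter> ball p (fst (q p)))" using eq by simp
    also have "\<dots> \<le> (\<Sum>p\<in>F. measure lborel (?L \<inter> ball p (fst (q p))))"
    proof (rule measure_UNION_le[OF F(2)])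
      show "?L \<inter> ball p (fst (q p)) \<in> sets lborel" for p using inner_layer_measurable[OF assms(1), of \<epsilon>] by simp
    qed
    also have "\<dots> \<le> (\<Sum>p\<in>F. snd (q p) * \<epsilon>)"
      using F(1) q(3) \<epsilon> \<epsilon>0(3) by (intro sum_mono) force
    also have "\<dots> \<le> C * \<epsilon>" unfolding C_def using \<epsilon> by (simp add: sum_distrib_right distrib_right)
    finally show ?thesis .
  qed
  then show ?thesis using that \<epsilon>0(1) C by blast
qed

text \<open>
  Cutting off near the boundary costs a factor of order \<open>1 / \<epsilon>\<close> in the gradient, which the volume of
  the layer makes up for, so that a continuous function which vanishes at the boundary does not
  notice the cutoff in the limit.
\<close>

lemma boundary_cutoffs:
  fixes \<Omega> :: "'a::euclidean_space set"
  assumes "open \<Omega>" "bounded \<Omega>" "smooth_boundary \<Omega>"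
  obtains \<theta> :: "nat \<Rightarrow> 'a \<Rightarrow> real" and \<theta>' T where "\<And>m. C1_on UNIV (\<theta> m) (\<theta>' m)" "\<And>m. compact (T m)" "\<And>m. T m \<subseteq> \<Omega>"
    "\<And>m x. x \<notin> T m \<Longrightarrow> \<theta> m x = 0"
    "\<And>(A :: 'a \<Rightarrow> 'b::euclidean_space) \<Phi> \<Phi>' v. continuous_on UNIV A \<Longrightarrow> (\<And>x. x \<notin> \<Omega> \<Longrightarrow> A x = 0) \<Longrightarrow> C1_on UNIV \<Phi> \<Phi>' \<Longrightarrow>
      (\<lambda>m. LINT x|lborel. (\<theta> m x * \<Phi>' x v + \<theta>' m x v * \<Phi> x) *\<^sub>R A x) \<longlonglongrightarrow> (LINT x|lborel. \<Phi>' x v *\<^sub>R A x)"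
proof -
  let ?i = "\<lambda>x. infdist x (- \<Omega>)"
  have ne: "- \<Omega> \<noteq> {}" using assms(2) not_bounded_UNIV by (metis Compl_empty_eq boolean_algebra_class.boolean_algebra.double_compl)
  obtain \<epsilon>0 C where \<epsilon>0: "\<epsilon>0 > 0" "C > 0"
    "\<And>\<epsilon>. 0 < \<epsilon> \<Longrightarrow> \<epsilon> < \<epsilon>0 \<Longrightarrow> measure lborel {x \<in> \<Omega>. ?i x \<le> \<epsilon>} \<le> C * \<epsilon>"
    using inner_layer_measure[OF assms] by blast
  define e where "e m = inverse (real (Suc m))" for m
  have e: "e \<longlonglongrightarrow> 0" "e m > 0" for m unfolding e_def by (rule inverse_Suc_sequence)+
  define G where "G = gradient_const TYPE('a)"
  have i0: "?i x = 0" if "x \<notin> \<Omega>" for x using that by simp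
  have ci: "continuous_on UNIV ?i" by (intro continuous_intros)
  have lip: "?i x \<le> ?i y + dist x y" for x y by (rule infdist_triangle)
  have "\<forall>m. \<exists>\<eta> \<eta>'. C1_on UNIV \<eta> \<eta>' \<and> (\<forall>x. 0 \<le> \<eta> x \<and> \<eta> x \<le> (1::real)) \<and> (\<forall>x v. \<bar>\<eta>' x v\<bar> \<le> G / e m * norm v)
    \<and> (\<forall>x. ?i x > 3 * e m \<longrightarrow> \<eta> x = 1) \<and> (\<forall>x. ?i x < e m \<longrightarrow> \<eta> x = 0)"
  proof
    fix m
    let ?P = "{x. ?i x > 2 * e m}"
    have "open ?P" by (intro open_Collect_less continuous_intros)
    moreover have "?P \<subseteq> \<Omega>"
    proof
      fix x assume "x \<in> ?P"
      then show "x \<in> \<Omega>" using i0[of x] e(2)[of m] by (cases "x \<in> \<Omega>") auto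
    qed
    then have "bounded ?P" using assms(2) bounded_subset by blast
    ultimately obtain \<eta> \<eta>' where \<eta>: "C1_on UNIV \<eta> \<eta>'" "\<And>x. 0 \<le> \<eta> x" "\<And>x. \<eta> x \<le> (1::real)"
      "\<And>x v. \<bar>\<eta>' x v\<bar> \<le> gradient_const TYPE('a) / e m * norm v"
      "\<And>x. cball x (e m) \<subseteq> ?P \<Longrightarrow> \<eta> x = 1" "\<And>x. cball x (e m) \<inter> ?P = {} \<Longrightarrow> \<eta> x = 0"
      using mollified_indicator[of ?P "e m"] e(2)[of m] borel_open by blast
    moreover have "\<eta> x = 1" if "?i x > 3 * e m" for x
    proof (rule \<eta>(5), rule subsetI)
      fix y assume "y \<in> cball x (e m)"
      then show "y \<in> ?P" using lip[of x y] that by simp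
    qed
    moreover have "\<eta> x = 0" if "?i x < e m" for x
    proof (rule \<eta>(6), rule ccontr)
      assume "cball x (e m) \<inter> ?P \<noteq> {}"
      then obtain y where "dist x y \<le> e m" "?i y > 2 * e m" by auto
      then show False using lip[of y x] that by (simp add: dist_commute)
    qed
    ultimately show "\<exists>\<eta> \<eta>'. C1_on UNIV \<eta> \<eta>' \<and> (\<forall>x. 0 \<le> \<eta> x \<and> \<eta> x \<le> (1::real)) \<and> (\<forall>x v. \<bar>\<eta>' x v\<bar> \<le> G / e m * norm v)
      \<and> (\<forall>x. ?i x > 3 * e m \<longrightarrow> \<eta> x = 1) \<and> (\<forall>x. ?i x < e m \<longrightarrow> \<eta> x = 0)"
      unfolding G_def by blast
  qed
  from choice[OF this] obtain \<theta> where "\<forall>m. \<exists>\<eta>'. C1_on UNIV (\<theta> m) \<eta>' \<and> (\<forall>x. 0 \<le> \<theta> m x \<and> \<theta> m x \<le> (1::real)) \<and> (\<forall>x v. \<bar>\<eta>' x v\<bar> \<le> G / e m * norm v)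
    \<and> (\<forall>x. ?i x > 3 * e m \<longrightarrow> \<theta> m x = 1) \<and> (\<forall>x. ?i x < e m \<longrightarrow> \<theta> m x = 0)" by blast
  from choice[OF this] obtain \<theta>' where \<theta>: "\<And>m. C1_on UNIV (\<theta> m) (\<theta>' m)" "\<And>m x. 0 \<le> \<theta> m x" "\<And>m x. \<theta> m x \<le> 1"
    "\<And>m x v. \<bar>\<theta>' m x v\<bar> \<le> G / e m * norm v" "\<And>m x. ?i x > 3 * e m \<Longrightarrow> \<theta> m x = 1" "\<And>m x. ?i x < e m \<Longrightarrow> \<theta> m x = 0" by blast
  have \<theta>'0: "\<theta>' m x v = 0" if x: "?i x > 3 * e m" for m x v
  proof -
    have o: "open {x. ?i x > 3 * e m}" by (intro open_Collect_less continuous_intros)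
    have "(\<theta> m has_derivative (\<lambda>v. 0)) (at x)"
    proof (rule has_derivative_transform_within_open[OF has_derivative_const o])
      show "x \<in> {x. ?i x > 3 * e m}" using x by simp
      show "1 = \<theta> m z" if "z \<in> {x. ?i x > 3 * e m}" for z using \<theta>(5)[of m z] that by simp
    qed
    then have "\<theta>' m x = (\<lambda>v. 0)" by (rule has_derivative_unique[OF C1_onD(1)[OF \<theta>(1) UNIV_I]])
    then show ?thesis by simp
  qed
  define T where "T m = {x. ?i x \<ge> e m}" for m
  have T\<Omega>: "T m \<subseteq> \<Omega>" for m
  proof
    fix x assume "x \<in> T m"
    then show "x \<in> \<Omega>" using i0[of x] e(2)[of m] by (cases "x \<in> \<Omega>") (auto simp: T_def)
  qed
  show ?thesis
  proof (rule that[of \<theta> \<theta>' T])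
    show "C1_on UNIV (\<theta> m) (\<theta>' m)" "T m \<subseteq> \<Omega>" for m by (rule \<theta>(1) T\<Omega>)+
    have "closed (T m)" for m unfolding T_def by (intro closed_Collect_le continuous_intros)
    moreover have "bounded (T m)" for m by (rule bounded_subset[OF assms(2) T\<Omega>])
    ultimately show "compact (T m)" for m by (simp add: compact_eq_bounded_closed)
    show "\<theta> m x = 0" if "x \<notin> T m" for m x using \<theta>(6) that by (simp add: T_def)
    fix A :: "'a \<Rightarrow> 'b::euclidean_space" and \<Phi> :: "'a \<Rightarrow> real" and \<Phi>' v
    assume A: "continuous_on UNIV A" "\<And>x. x \<notin> \<Omega> \<Longrightarrow> A x = 0" and \<Phi>: "C1_on UNIV \<Phi> \<Phi>'"
    have K: "compact (closure \<Omega>)" using assms(2) by simp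
    have A0: "A x = 0" if "x \<notin> closure \<Omega>" for x using A(2)[of x] that subsetD[OF closure_subset[of \<Omega>], of x] by blast
    have "compact (\<Phi> ` closure \<Omega>)"
      by (intro compact_continuous_image K continuous_on_subset[OF C1_onD(4)[OF \<Phi>]] subset_UNIV)
    then obtain M1 where "M1 > 0" "\<And>y. y \<in> \<Phi> ` closure \<Omega> \<Longrightarrow> norm y \<le> M1" using compact_norm_bound by blast
    then have M1: "M1 > 0" "\<And>x. x \<in> closure \<Omega> \<Longrightarrow> norm (\<Phi> x) \<le> M1" by auto
    obtain M2 where M2: "M2 > 0" "\<And>x w. x \<in> closure \<Omega> \<Longrightarrow> norm (\<Phi>' x w) \<le> M2 * norm w"
      using C1_on_bounded[OF \<Phi> K subset_UNIV] by metis
    have int: "integrable lborel (\<lambda>x. q x *\<^sub>R A x)" if q: "continuous_on UNIV q" for q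
      by (rule integrable_compact_support[OF _ K]) (use A A0 q in \<open>auto intro!: continuous_intros\<close>)
    have c1: "continuous_on UNIV (\<lambda>x. \<theta> m x * \<Phi>' x v + \<theta>' m x v * \<Phi> x)" for m
      by (intro continuous_intros C1_onD(2,4)[OF \<Phi>] C1_onD(2,4)[OF \<theta>(1)])
    show "(\<lambda>m. LINT x|lborel. (\<theta> m x * \<Phi>' x v + \<theta>' m x v * \<Phi> x) *\<^sub>R A x) \<longlonglongrightarrow> (LINT x|lborel. \<Phi>' x v *\<^sub>R A x)"
    proof (rule LIMSEQ_I)
      fix r :: real assume r: "r > 0"
      define H where "H = (M2 + G * M1) * norm v * (3 * C)"
      have G: "G \<ge> 1" unfolding G_def by (rule gradient_const_ge_1)
      have H: "H \<ge> 0" unfolding H_def using M1 M2 G \<epsilon>0 by (intro mult_nonneg_nonneg add_nonneg_nonneg) auto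
      define \<omega> where "\<omega> = r / (H + 1)"
      have \<omega>: "\<omega> > 0" unfolding \<omega>_def using r H by simp
      have "uniformly_continuous_on UNIV A" by (rule uniformly_continuous_compact_support[OF A(1) K A0])
      from uniformly_continuous_onE[OF this \<omega>] obtain \<delta> where \<delta>: "\<delta> > 0" "\<And>x y. dist y x < \<delta> \<Longrightarrow> dist (A y) (A x) < \<omega>" by auto
      have "\<forall>\<^sub>F m in sequentially. dist (e m) 0 < min (min (\<epsilon>0 / 3) (\<delta> / 3)) 1"
        by (rule tendstoD[OF e(1)]) (use \<epsilon>0 \<delta> in auto)
      then obtain N where N: "\<And>m. m \<ge> N \<Longrightarrow> e m < \<epsilon>0 / 3 \<and> e m < \<delta> / 3 \<and> e m < 1"
        unfolding eventually_sequentially by (auto simp: dist_real_def abs_of_pos[OF e(2)])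
      show "\<exists>no. \<forall>m\<ge>no. norm ((LINT x|lborel. (\<theta> m x * \<Phi>' x v + \<theta>' m x v * \<Phi> x) *\<^sub>R A x) - (LINT x|lborel. \<Phi>' x v *\<^sub>R A x)) < r"
      proof (intro exI[of _ N] allI impI)
        fix m assume "N \<le> m"
        note Nm = N[OF this]
        let ?L = "{x \<in> \<Omega>. ?i x \<le> 3 * e m}"
        have Lm: "?L \<in> sets lborel" using inner_layer_measurable[OF assms(1)] by simp
        have "emeasure lborel ?L \<le> emeasure lborel (closure \<Omega>)" using closure_subset by (intro emeasure_mono) auto
        then have Lf: "emeasure lborel ?L < \<infinity>" using emeasure_compact_finite[OF K] by (rule order_le_less_trans)
        have "(LINT x|lborel. (\<theta> m x * \<Phi>' x v + \<theta>' m x v * \<Phi> x) *\<^sub>R A x) - (LINT x|lborel. \<Phi>' x v *\<^sub>R A x)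
          = (LINT x|lborel. (\<theta> m x * \<Phi>' x v + \<theta>' m x v * \<Phi> x) *\<^sub>R A x - \<Phi>' x v *\<^sub>R A x)"
          by (rule Bochner_Integration.integral_diff[symmetric]) (intro int c1 C1_onD(2)[OF \<Phi>])+
        also have "norm \<dots> \<le> (LINT x|lborel. indicator ?L x * ((M2 + G * M1) / e m * norm v * \<omega>))"
        proof (rule Bochner_Integration.integral_norm_bound_integral)
          show "integrable lborel (\<lambda>x. (\<theta> m x * \<Phi>' x v + \<theta>' m x v * \<Phi> x) *\<^sub>R A x - \<Phi>' x v *\<^sub>R A x)"
            by (intro Bochner_Integration.integrable_diff int c1 C1_onD(2)[OF \<Phi>])
          show "integrable lborel (\<lambda>x. indicator ?L x * ((M2 + G * M1) / e m * norm v * \<omega>))"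
            using Lm Lf by (intro integrable_mult_left integrable_real_indicator)
          fix x :: 'a
          show "norm ((\<theta> m x * \<Phi>' x v + \<theta>' m x v * \<Phi> x) *\<^sub>R A x - \<Phi>' x v *\<^sub>R A x)
            \<le> indicator ?L x * ((M2 + G * M1) / e m * norm v * \<omega>)"
          proof (cases "x \<in> ?L")
            case True
            then have x: "x \<in> closure \<Omega>" using closure_subset by blast
            obtain y where y: "y \<in> - \<Omega>" "?i x = dist x y" using infdist_attains_inf[of "- \<Omega>" x] assms(1) ne by auto
            then have "dist (A x) (A y) < \<omega>" using True Nm by (intro \<delta>(2)) auto
            then have Ax: "norm (A x) \<le> \<omega>" using A(2)[of y] y(1) by (simp add: dist_norm)
            have "\<bar>(\<theta> m x - 1) * \<Phi>' x v + \<theta>' m x v * \<Phi> x\<bar> \<le> \<bar>\<theta> m x - 1\<bar> * \<bar>\<Phi>' x v\<bar> + \<bar>\<theta>' m x v\<bar> * \<bar>\<Phi> x\<bar>"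
              by (metis abs_mult abs_triangle_ineq)
            also have "\<dots> \<le> 1 * (M2 * norm v) + (G / e m * norm v) * M1"
              using \<theta>(2,3)[of m x] \<theta>(4)[of m x v] M1(2)[OF x] M2(2)[OF x, of v] G e(2)[of m]
              by (intro add_mono mult_mono) (auto simp: abs_le_iff)
            also have "\<dots> \<le> (M2 + G * M1) / e m * norm v"
            proof -
              have "1 \<le> 1 / e m" using Nm e(2)[of m] by simp
              then have "M2 * norm v * 1 \<le> M2 * norm v * (1 / e m)" using M2(1) by (intro mult_left_mono) auto
              then show ?thesis by (simp add: add_divide_distrib distrib_left distrib_right mult_ac)
            qed
            finally have "\<bar>(\<theta> m x - 1) * \<Phi>' x v + \<theta>' m x v * \<Phi> x\<bar> * norm (A x) \<le> ((M2 + G * M1) / e m * norm v) * \<omega>"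
              using Ax by (intro mult_mono) (auto intro: order_trans[OF abs_ge_zero])
            moreover have "(\<theta> m x * \<Phi>' x v + \<theta>' m x v * \<Phi> x) *\<^sub>R A x - \<Phi>' x v *\<^sub>R A x = ((\<theta> m x - 1) * \<Phi>' x v + \<theta>' m x v * \<Phi> x) *\<^sub>R A x"
              by (simp add: algebra_simps)
            ultimately show ?thesis using True by simp
          next
            case False
            then consider "x \<notin> \<Omega>" | "?i x > 3 * e m" by fastforce
            then have "(\<theta> m x * \<Phi>' x v + \<theta>' m x v * \<Phi> x) *\<^sub>R A x = \<Phi>' x v *\<^sub>R A x"
              by cases (use A(2) \<theta>(5) \<theta>'0 in simp_all)
            then show ?thesis using False by simp
          qed
        qed
        also have "\<dots> = measure lborel ?L * ((M2 + G * M1) / e m * norm v * \<omega>)" using Lm by simp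
        also have "\<dots> \<le> (C * (3 * e m)) * ((M2 + G * M1) / e m * norm v * \<omega>)"
          using \<epsilon>0(3)[of "3 * e m"] Nm e(2)[of m] M1 M2 G \<omega> by (intro mult_right_mono) auto
        also have "\<dots> = H * \<omega>" unfolding H_def using e(2)[of m] by (simp add: mult_ac)
        also have "\<dots> < r" unfolding \<omega>_def using H r by (simp add: field_simps)
        finally show "norm ((LINT x|lborel. (\<theta> m x * \<Phi>' x v + \<theta>' m x v * \<Phi> x) *\<^sub>R A x) - (LINT x|lborel. \<Phi>' x v *\<^sub>R A x)) < r" .
      qed
    qed
  qed
qed

section \<open>The Dirac operators of two vector variables\<close>

text \<open>
  The relations are only required on the basis; for linear dependence on the vector they amount to
  \<open>g v (g v s) = - |v|\<^sup>2 s\<close>.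
\<close>

definition clifford_map :: "('v::euclidean_space \<Rightarrow> 'b::euclidean_space \<Rightarrow> 'b) \<Rightarrow> bool" where
  "clifford_map g \<longleftrightarrow> (\<forall>b. linear (g b)) \<and>
     (\<forall>b\<in>Basis. \<forall>c\<in>Basis. \<forall>s. g b (g c s) + g c (g b s) = (if b = c then - (2 *\<^sub>R s) else 0))"

lemma clifford_map_linear: "clifford_map g \<Longrightarrow> linear (g b)"
  by (simp add: clifford_map_def)

text \<open>
  The algebraic reason for \<open>\<nabla> \<nabla> = - \<Delta>\<close>: in a symmetric array, such as one of second derivatives, the
  off-diagonal terms cancel by anticommutation.
\<close>

lemma clifford_symmetric_sum:
  assumes "clifford_map g" "\<And>b c. b \<in> Basis \<Longrightarrow> c \<in> Basis \<Longrightarrow> S b c = S c b"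
  shows "(\<Sum>b\<in>Basis. \<Sum>c\<in>Basis. g b (g c (S b c))) = - (\<Sum>b\<in>(Basis :: 'v::euclidean_space set). S b b)"
proof -
  let ?X = "\<Sum>b\<in>Basis. \<Sum>c\<in>Basis. g b (g c (S b c))"
  have "?X = (\<Sum>b\<in>Basis. \<Sum>c\<in>Basis. g c (g b (S b c)))"
    by (subst sum.swap) (auto intro!: sum.cong simp: assms(2))
  then have "2 *\<^sub>R ?X = (\<Sum>b\<in>Basis. \<Sum>c\<in>Basis. g b (g c (S b c)) + g c (g b (S b c)))"
    by (simp add: sum.distrib scaleR_2)
  also have "\<dots> = (\<Sum>b\<in>Basis. \<Sum>c\<in>Basis. if b = c then - (2 *\<^sub>R S b c) else 0)"
    using assms(1) unfolding clifford_map_def by (intro sum.cong refl) blast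
  also have "\<dots> = (\<Sum>b\<in>Basis. - (2 *\<^sub>R S b b))" by simp
  also have "\<dots> = 2 *\<^sub>R - (\<Sum>b\<in>Basis. S b b)" by (simp add: sum_negf scaleR_sum_right)
  finally show ?thesis by (simp only: scaleR_cancel_left) simp
qed

lemma integral_linear_image:
  fixes f :: "'z \<Rightarrow> 'b::euclidean_space" and T :: "'b \<Rightarrow> 'c::euclidean_space"
  assumes "linear T" "integrable M f"
  shows "integrable M (\<lambda>x. T (f x))" "(LINT x|M. T (f x)) = T (LINT x|M. f x)"
proof -
  have "bounded_linear T" using assms(1) by (simp add: linear_conv_bounded_linear)
  then show "integrable M (\<lambda>x. T (f x))" "(LINT x|M. T (f x)) = T (LINT x|M. f x)"
    using assms(2) by (auto intro: integrable_bounded_linear integral_bounded_linear)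
qed

lemma linear_sum_scaleR_integral:
  fixes f :: "'i \<Rightarrow> 'z \<Rightarrow> 'b::euclidean_space" and T :: "'i \<Rightarrow> 'b \<Rightarrow> 'c::euclidean_space"
  assumes "\<And>i. i \<in> I \<Longrightarrow> linear (T i)" "\<And>i. i \<in> I \<Longrightarrow> integrable M (\<lambda>x. p x *\<^sub>R f i x)"
  shows "(\<Sum>i\<in>I. T i (LINT x|M. p x *\<^sub>R f i x)) = (LINT x|M. p x *\<^sub>R (\<Sum>i\<in>I. T i (f i x)))"
proof -
  have "p x *\<^sub>R (\<Sum>i\<in>I. T i (f i x)) = (\<Sum>i\<in>I. T i (p x *\<^sub>R f i x))" for x
    unfolding scaleR_sum_right by (rule sum.cong[OF refl]) (simp add: linear_scale[OF assms(1)])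
  then have "(LINT x|M. p x *\<^sub>R (\<Sum>i\<in>I. T i (f i x))) = (LINT x|M. (\<Sum>i\<in>I. T i (p x *\<^sub>R f i x)))"
    by (simp only:)
  also have "\<dots> = (\<Sum>i\<in>I. (LINT x|M. T i (p x *\<^sub>R f i x)))"
    by (rule Bochner_Integration.integral_sum) (rule integral_linear_image(1)[OF assms])
  also have "\<dots> = (\<Sum>i\<in>I. T i (LINT x|M. p x *\<^sub>R f i x))"
    by (rule sum.cong[OF refl]) (rule integral_linear_image(2)[OF assms])
  finally show ?thesis by (rule sym)
qed

subsection \<open>Solutions of the Dirac equation are harmonic\<close>

lemma integrable_extend_zero:
  fixes q :: "'a::euclidean_space \<Rightarrow> real" and u :: "'a \<Rightarrow> 'b::euclidean_space"
  assumes "continuous_on UNIV q" "compact S" "S \<subseteq> W" "open W" "\<And>x. x \<notin> S \<Longrightarrow> q x = 0" "continuous_on W u"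
  shows "integrable lborel (\<lambda>x. q x *\<^sub>R u x)"
  by (rule integrable_compact_support[OF continuous_on_extend_zero[OF assms(1) compact_imp_closed[OF assms(2)] assms(3,4) _ assms(6)] assms(2)])
    (simp_all add: assms(5))

text \<open>
  The weak form of \<open>\<nabla> \<nabla> u = - \<Delta> u\<close> for a function with only one derivative. One derivative of the Laplacian is
  moved from the test function \<open>p\<close> to \<open>u\<close>; the symmetry in the two remaining derivatives, one on each
  factor, is \<open>integral_swap_derivatives\<close>. The map \<open>j\<close> embeds one of the two vector variables.
\<close>

lemma dirac_weakly_harmonic:
  fixes u :: "'a::euclidean_space \<Rightarrow> 'b::euclidean_space" and j :: "'v::euclidean_space \<Rightarrow> 'a"
  assumes g: "clifford_map g"
    and u: "C1_on W u u'" "open W" "\<And>x. x \<in> W \<Longrightarrow> (\<Sum>c\<in>Basis. g c (u' x (j c))) = 0"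
    and p: "C1_on UNIV p p'" "compact S" "S \<subseteq> W" "\<And>x. x \<notin> S \<Longrightarrow> p x = 0"
    and q: "\<And>b. b \<in> Basis \<Longrightarrow> C1_on UNIV (\<lambda>x. p' x (j b)) (q' b)"
  shows "(LINT z|lborel. (\<Sum>b\<in>Basis. q' b z (j b)) *\<^sub>R u z) = 0"
proof -
  have p0: "p' x v = 0" if "x \<notin> S" for x v
    by (rule C1_on_zero_off[OF p(1) compact_imp_closed[OF p(2)] _ that]) (rule p(4))
  have q0: "q' b x v = 0" if "x \<notin> S" "b \<in> Basis" for b x v
    by (rule C1_on_zero_off[OF q[OF that(2)] compact_imp_closed[OF p(2)] _ that(1)]) (rule p0)
  have iq: "integrable lborel (\<lambda>z. q' b z (j b) *\<^sub>R u z)" if "b \<in> Basis" for b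
    by (rule integrable_extend_zero[OF C1_onD(2)[OF q[OF that]] p(2,3) u(2) q0[OF _ that] C1_onD(4)[OF u(1)]])
  have ip: "integrable lborel (\<lambda>z. p' z v *\<^sub>R u' z w)" for v w
    by (rule integrable_extend_zero[OF C1_onD(2)[OF p(1)] p(2,3) u(2) p0 C1_onD(2)[OF u(1)]])
  define S2 where "S2 b c = (LINT z|lborel. p' z (j b) *\<^sub>R u' z (j c))" for b c
  have sym: "S2 b c = S2 c b" for b c
    unfolding S2_def by (rule integral_swap_derivatives_local[OF p(1,2,4) u(1,2) p(3)])
  have "(LINT z|lborel. (\<Sum>b\<in>Basis. q' b z (j b)) *\<^sub>R u z) = (\<Sum>b\<in>Basis. LINT z|lborel. q' b z (j b) *\<^sub>R u z)"
    unfolding scaleR_sum_left by (rule Bochner_Integration.integral_sum) (rule iq)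
  also have "\<dots> = (\<Sum>b\<in>Basis. - S2 b b)"
    unfolding S2_def by (intro sum.cong refl integral_by_parts[OF q p(2,3) u(2) p0 u(1)])
  also have "\<dots> = (\<Sum>b\<in>Basis. \<Sum>c\<in>Basis. g b (g c (S2 b c)))"
    unfolding clifford_symmetric_sum[OF g sym] by (simp add: sum_negf)
  also have "\<dots> = (\<Sum>b\<in>Basis. g b 0)"
  proof (rule sum.cong[OF refl])
    fix b :: 'v assume "b \<in> Basis"
    have "(\<Sum>c\<in>Basis. g b (g c (S2 b c))) = g b (\<Sum>c\<in>Basis. g c (S2 b c))"
      by (rule linear_sum[OF clifford_map_linear[OF g], symmetric])
    also have "(\<Sum>c\<in>Basis. g c (S2 b c)) = (LINT z|lborel. p' z (j b) *\<^sub>R (\<Sum>c\<in>Basis. g c (u' z (j c))))"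
      unfolding S2_def by (rule linear_sum_scaleR_integral[OF clifford_map_linear[OF g] ip])
    also have "(\<lambda>z. p' z (j b) *\<^sub>R (\<Sum>c\<in>Basis. g c (u' z (j c)))) = (\<lambda>z. 0)"
    proof
      fix z show "p' z (j b) *\<^sub>R (\<Sum>c\<in>Basis. g c (u' z (j c))) = 0"
        using u(3)[of z] p0[of z "j b"] p(3) by (cases "z \<in> S") auto
    qed
    finally show "(\<Sum>c\<in>Basis. g b (g c (S2 b c))) = g b 0" by simp
  qed
  also have "\<dots> = 0" using linear_0[OF clifford_map_linear[OF g]] by simp
  finally show ?thesis .
qed

text \<open>
  The second derivative of \<open>bump 3\<close> at radius \<open>t\<close>, in the directions \<open>b\<close> and \<open>w\<close>.
\<close>

definition bump_hessian :: "real \<Rightarrow> 'a::euclidean_space \<Rightarrow> 'a \<Rightarrow> 'a \<Rightarrow> 'a \<Rightarrow> real" where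
  "bump_hessian t x b z w = - (6 / t\<^sup>2) * ((w \<bullet> b) * bump 2 ((z - x) /\<^sub>R t)
      - (4 / t\<^sup>2) * ((z - x) \<bullet> b) * ((z - x) \<bullet> w) * bump 1 ((z - x) /\<^sub>R t))"

lemma C1_on_bump3:
  "C1_on UNIV (\<lambda>z::'a::euclidean_space. bump 3 ((z - x) /\<^sub>R t)) (\<lambda>z v. - (6 / t\<^sup>2) * ((z - x) \<bullet> v) * bump 2 ((z - x) /\<^sub>R t))"
  "C1_on UNIV (\<lambda>z::'a::euclidean_space. - (6 / t\<^sup>2) * ((z - x) \<bullet> b) * bump 2 ((z - x) /\<^sub>R t)) (bump_hessian t x b)"
  using C1_on_bump_at[of 3, where x = x and t = t] C1_on_bump_at_derivative[of 3, where x = x and t = t and v = b]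
  by (simp_all add: bump_hessian_def[abs_def])

lemma bump_hessian_trace:
  fixes x z :: "'a::euclidean_space"
  shows "(\<Sum>b\<in>Basis. bump_hessian t x b z b) = (6 / t\<^sup>2) * lap_bump ((z - x) /\<^sub>R t)"
proof -
  define y where "y = z - x"
  have 1: "(\<Sum>b\<in>Basis. (y \<bullet> b) * (y \<bullet> b)) = y \<bullet> y" using euclidean_inner[of y y] by simp
  have 2: "(y /\<^sub>R t) \<bullet> (y /\<^sub>R t) = y \<bullet> y / t\<^sup>2" by (simp add: power2_eq_square divide_inverse mult_ac)
  have "(\<Sum>b\<in>Basis. bump_hessian t x b z b)
      = (\<Sum>b\<in>(Basis :: 'a set). - (6 / t\<^sup>2) * bump 2 (y /\<^sub>R t) + (6 / t\<^sup>2 * (4 / t\<^sup>2) * bump 1 (y /\<^sub>R t)) * ((y \<bullet> b) * (y \<bullet> b)))"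
    unfolding bump_hessian_def y_def[symmetric] by (intro sum.cong refl) (simp add: algebra_simps)
  also have "\<dots> = - (6 / t\<^sup>2) * bump 2 (y /\<^sub>R t) * real DIM('a) + (6 / t\<^sup>2 * (4 / t\<^sup>2) * bump 1 (y /\<^sub>R t)) * (y \<bullet> y)"
    unfolding sum.distrib sum_distrib_left[symmetric] 1 by simp
  also have "\<dots> = (6 / t\<^sup>2) * lap_bump (y /\<^sub>R t)"
    unfolding lap_bump_def 2 by (simp add: algebra_simps)
  finally show ?thesis unfolding y_def .
qed

lemma lap_bump_eq_0: "t > 0 \<Longrightarrow> z \<notin> cball x t \<Longrightarrow> lap_bump ((z - x) /\<^sub>R t) = 0"
  using bump_at_eq_0[of 1 t z x] bump_at_eq_0[of 2 t z x] by (simp add: lap_bump_def)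

lemma continuous_on_lap_bump: "continuous_on UNIV (\<lambda>z. lap_bump ((z - x) /\<^sub>R t))"
  unfolding lap_bump_def by (intro continuous_intros continuous_on_bump_at)

lemma sum_Basis_pairs:
  fixes f :: "'a::euclidean_space \<times> 'b::euclidean_space \<Rightarrow> 'c::comm_monoid_add"
  shows "(\<Sum>b\<in>Basis. f b) = (\<Sum>b\<in>Basis. f (b, 0)) + (\<Sum>b\<in>Basis. f (0, b))"
  unfolding Basis_prod_def by (subst sum.union_disjoint) (auto simp: sum.reindex inj_on_def o_def)

lemma monogenic_mean_value:
  fixes u :: "'v::euclidean_space \<times> 'v \<Rightarrow> 'b::euclidean_space"
  assumes g: "clifford_map g" and u: "C1_on W u u'" "open W"
    and d0: "\<And>x. x \<in> W \<Longrightarrow> (\<Sum>c\<in>Basis. g c (u' x (c, 0))) = 0"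
    and d1: "\<And>x. x \<in> W \<Longrightarrow> (\<Sum>c\<in>Basis. g c (u' x (0, c))) = 0"
  shows "mean_value_on W (\<lambda>x. u x \<bullet> s)"
proof (rule mean_value_onI[OF u(2)])
  show "continuous_on W (\<lambda>x. u x \<bullet> s)" using C1_onD(4)[OF u(1)] by (intro continuous_intros)
  fix x :: "'v \<times> 'v" and t :: real assume t: "t > 0" "cball x t \<subseteq> W"
  have z: "bump 3 ((z - x) /\<^sub>R t) = 0" if "z \<notin> cball x t" for z by (rule bump_at_eq_0) (use t that in auto)
  note H = dirac_weakly_harmonic[OF g u _ C1_on_bump3(1) compact_cball t(2) z C1_on_bump3(2)]
  have i: "integrable lborel (\<lambda>z. bump_hessian t x b z w *\<^sub>R u z)" for b w
  proof (rule integrable_extend_zero[OF C1_onD(2)[OF C1_on_bump3(2)] compact_cball[of x t] t(2) u(2) _ C1_onD(4)[OF u(1)]])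
    show "bump_hessian t x b z w = 0" if "z \<notin> cball x t" for z
      unfolding bump_hessian_def using bump_at_eq_0[of _ t z x] t that by simp
  qed
  have i': "integrable lborel (\<lambda>z. (\<Sum>b\<in>(Basis::'v set). bump_hessian t x (j b) z (j b)) *\<^sub>R u z)" for j
    unfolding scaleR_sum_left by (intro Bochner_Integration.integrable_sum i)
  have trace: "(LINT z|lborel. (\<Sum>b\<in>Basis. bump_hessian t x b z b) *\<^sub>R u z) = 0"
  proof -
    have "(\<Sum>b\<in>Basis. bump_hessian t x b z b) = (\<Sum>b\<in>Basis. bump_hessian t x (b, 0) z (b, 0)) + (\<Sum>b\<in>Basis. bump_hessian t x (0, b) z (0, b))" for z
      by (rule sum_Basis_pairs)
    then show ?thesis
    using H[of "\<lambda>c. (c, 0)"] H[of "\<lambda>c. (0, c)"] d0 d1 i'[of "\<lambda>c. (c, 0)"] i'[of "\<lambda>c. (0, c)"]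
    by (simp add: scaleR_add_left)
  qed
  have 0: "(LINT z|lborel. lap_bump ((z - x) /\<^sub>R t) *\<^sub>R u z) = 0"
  proof -
    have "(LINT z|lborel. (6 / t\<^sup>2) *\<^sub>R lap_bump ((z - x) /\<^sub>R t) *\<^sub>R u z) = 0"
      using trace by (simp only: bump_hessian_trace scaleR_scaleR)
    then have "(6 / t\<^sup>2) *\<^sub>R (LINT z|lborel. lap_bump ((z - x) /\<^sub>R t) *\<^sub>R u z) = 0"
      by (simp only: integral_scaleR_right)
    then show ?thesis using t by simp
  qed
  have "integrable lborel (\<lambda>z. lap_bump ((z - x) /\<^sub>R t) *\<^sub>R u z)"
    by (rule integrable_extend_zero[OF continuous_on_lap_bump compact_cball t(2) u(2) lap_bump_eq_0[OF t(1)] C1_onD(4)[OF u(1)]])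
  from integral_inner_left[OF this, of s] show "(LINT z|lborel. lap_bump ((z - x) /\<^sub>R t) * (u z \<bullet> s)) = 0"
    by (simp add: 0)
qed

subsection \<open>Extension by zero across the boundary\<close>

lemma continuous_on_zero_extension:
  fixes G :: "'a::euclidean_space \<Rightarrow> 'b::real_normed_vector"
  assumes "open \<Omega>" "continuous_on \<Omega> G" "\<And>p. p \<in> frontier \<Omega> \<Longrightarrow> (G \<longlongrightarrow> 0) (at p within \<Omega>)"
  shows "continuous_on UNIV (\<lambda>x. if x \<in> \<Omega> then G x else 0)"
proof (rule continuous_at_imp_continuous_on, rule ballI)
  fix p :: 'a
  let ?G = "\<lambda>x. if x \<in> \<Omega> then G x else 0"
  consider "p \<in> \<Omega>" | "p \<in> frontier \<Omega>" | "p \<in> - closure \<Omega>"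
    using assms(1) by (auto simp: frontier_def interior_open)
  then show "isCont ?G p"
  proof cases
    case 1
    have "continuous_on \<Omega> ?G" using assms(2) by (rule continuous_on_eq) simp
    then show ?thesis using continuous_on_eq_continuous_at[OF assms(1)] 1 by blast
  next
    case 2
    then have p: "p \<notin> \<Omega>" using assms(1) by (auto simp: frontier_def interior_open)
    show ?thesis unfolding continuous_at_eps_delta
    proof (intro allI impI)
      fix e :: real assume "e > 0"
      with tendstoD[OF assms(3)[OF 2]] have "\<forall>\<^sub>F x in at p within \<Omega>. dist (G x) 0 < e" by blast
      then obtain d where d: "d > 0" "\<And>x. x \<in> \<Omega> \<Longrightarrow> x \<noteq> p \<Longrightarrow> dist x p < d \<Longrightarrow> dist (G x) 0 < e"
        unfolding eventually_at by blast
      then show "\<exists>d>0. \<forall>x'. dist x' p < d \<longrightarrow> dist (?G x') (?G p) < e"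
        using p \<open>e > 0\<close> by (intro exI[of _ d]) auto
    qed
  next
    case 3
    have "continuous_on (- closure \<Omega>) ?G"
      by (rule continuous_on_eq[where f = "\<lambda>x. 0"]) (use closure_subset in auto)
    then show ?thesis using continuous_on_eq_continuous_at[of "- closure \<Omega>"] 3 by blast
  qed
qed

text \<open>
  At a boundary point \<open>p\<close> the derivative is \<open>0\<close>: on the way from \<open>p\<close> to a point \<open>y\<close> of \<open>\<Omega>\<close> there is a
  last point outside of \<open>\<Omega>\<close>, from which on the mean value inequality applies.
\<close>

lemma C1_on_zero_extension:
  fixes F :: "'a::euclidean_space \<Rightarrow> 'b::euclidean_space"
  assumes "open \<Omega>" and F: "C1_on \<Omega> F F'" "\<And>p. p \<in> frontier \<Omega> \<Longrightarrow> (F \<longlongrightarrow> 0) (at p within \<Omega>)"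
    "\<And>p b. p \<in> frontier \<Omega> \<Longrightarrow> b \<in> Basis \<Longrightarrow> ((\<lambda>x. F' x b) \<longlongrightarrow> 0) (at p within \<Omega>)"
  shows "C1_on UNIV (\<lambda>x. if x \<in> \<Omega> then F x else 0) (\<lambda>x v. if x \<in> \<Omega> then F' x v else 0)"
proof (rule C1_onI)
  let ?F = "\<lambda>x. if x \<in> \<Omega> then F x else 0"
  have lin: "linear (F' x)" if "x \<in> \<Omega>" for x by (rule C1_onD(3)[OF F(1) that])
  have cF: "continuous_on UNIV ?F" by (rule continuous_on_zero_extension[OF assms(1) C1_onD(4)[OF F(1)] F(2)])
  have near: "\<exists>d>0. \<forall>x\<in>\<Omega>. dist x p < d \<longrightarrow> (\<forall>v. norm (F' x v) \<le> e * norm v)" if p: "p \<in> frontier \<Omega>" and e: "e > 0" for p e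
  proof -
    have "\<forall>\<^sub>F x in at p within \<Omega>. \<forall>b\<in>Basis. dist (F' x b) 0 < e / (real DIM('a) + 1)"
      using e by (intro eventually_ball_finite ballI tendstoD[OF F(3)[OF p]] finite_Basis divide_pos_pos) auto
    then obtain d where d: "d > 0" "\<And>x b. x \<in> \<Omega> \<Longrightarrow> x \<noteq> p \<Longrightarrow> dist x p < d \<Longrightarrow> b \<in> Basis \<Longrightarrow> norm (F' x b) < e / (real DIM('a) + 1)"
      unfolding eventually_at by auto
    have "norm (F' x v) \<le> e * norm v" if x: "x \<in> \<Omega>" "dist x p < d" for x v
    proof -
      have "x \<noteq> p" using x(1) p assms(1) by (auto simp: frontier_def interior_open)
      then have "norm (F' x v) \<le> (real DIM('a) * (e / (real DIM('a) + 1))) * norm v"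
        using d(2)[OF x(1) _ x(2)] by (intro linear_norm_le_sum_Basis[OF lin[OF x(1)]]) (auto intro: less_imp_le)
      also have "\<dots> \<le> e * norm v" using e by (intro mult_right_mono) (auto simp: field_simps)
      finally show ?thesis .
    qed
    then show ?thesis using d(1) by blast
  qed
  show "continuous_on UNIV (\<lambda>x. if x \<in> \<Omega> then F' x v else 0)" for v
  proof (rule continuous_on_zero_extension[OF assms(1) C1_onD(2)[OF F(1)]])
    fix p assume p: "p \<in> frontier \<Omega>"
    show "((\<lambda>x. F' x v) \<longlongrightarrow> 0) (at p within \<Omega>)"
    proof (rule tendstoI)
      fix e :: real assume "e > 0"
      then have "e / (norm v + 1) > 0" by (intro divide_pos_pos add_nonneg_pos) auto
      from near[OF p this] obtain d where d: "d > 0" "\<And>x. x \<in> \<Omega> \<Longrightarrow> dist x p < d \<Longrightarrow> norm (F' x v) \<le> e / (norm v + 1) * norm v" by blast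
      have "e / (norm v + 1) * norm v < e"
      proof -
        have "norm v + 1 > 0" by (intro add_nonneg_pos) auto
        then show ?thesis using \<open>e > 0\<close> by (simp add: divide_less_eq algebra_simps)
      qed
      then show "\<forall>\<^sub>F x in at p within \<Omega>. dist (F' x v) 0 < e"
        unfolding eventually_at using d by (intro exI[of _ d]) force
    qed
  qed
  fix p :: 'a
  consider "p \<in> \<Omega>" | "p \<in> frontier \<Omega>" | "p \<in> - closure \<Omega>"
    using assms(1) by (auto simp: frontier_def interior_open)
  then show "(?F has_derivative (\<lambda>v. if p \<in> \<Omega> then F' p v else 0)) (at p)"
  proof cases
    case 1
    have "(?F has_derivative F' p) (at p)"
      by (rule has_derivative_transform_within_open[OF C1_onD(1)[OF F(1) 1] assms(1) 1]) simp
    then show ?thesis using 1 by simp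
  next
    case 2
    then have p: "p \<notin> \<Omega>" using assms(1) by (auto simp: frontier_def interior_open)
    have "\<exists>d>0. \<forall>y. norm (y - p) < d \<longrightarrow> norm (?F y - ?F p - 0) \<le> e * norm (y - p)" if e: "e > 0" for e
    proof -
      obtain d where d: "d > 0" "\<And>x v. x \<in> \<Omega> \<Longrightarrow> dist x p < d \<Longrightarrow> norm (F' x v) \<le> e * norm v"
        using near[OF 2 e] by blast
      have "norm (?F y) \<le> e * norm (y - p)" if y: "norm (y - p) < d" "y \<in> \<Omega>" for y
      proof -
        let ?l = "\<lambda>s. p + s *\<^sub>R (y - p)"
        let ?S = "{0..1} \<inter> ?l -` (- \<Omega>)"
        have "closed (?l -` (- \<Omega>))" using assms(1) by (intro closed_vimage continuous_intros) auto
        then have "compact ?S" by (intro compact_Int_closed) auto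
        moreover have "0 \<in> ?S" using p by simp
        ultimately obtain s0 where s0: "s0 \<in> ?S" "\<And>s. s \<in> ?S \<Longrightarrow> s \<le> s0"
          using compact_attains_sup[of ?S] by blast
        have s01: "s0 < 1" using s0(1) y(2) by (cases "s0 = 1") auto
        have "\<exists>s\<in>{s0<..<1}. norm (?F (?l 1) - ?F (?l s0)) \<le> norm ((1 - s0) *\<^sub>R F' (?l s) (y - p))"
        proof (rule mvt_general[OF s01])
          show "continuous_on {s0..1} (\<lambda>s. ?F (?l s))"
            by (rule continuous_on_compose2[OF cF]) (auto intro!: continuous_intros)
          fix s assume s: "s0 < s" "s < 1"
          then have ls: "?l s \<in> \<Omega>" using s0(2)[of s] s0(1) by (cases "?l s \<in> \<Omega>") auto
          have "(?F has_derivative F' (?l s)) (at (?l s))"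
            by (rule has_derivative_transform_within_open[OF C1_onD(1)[OF F(1) ls] assms(1) ls]) simp
          then have "((\<lambda>s. ?F (?l s)) has_derivative (\<lambda>h. F' (?l s) (h *\<^sub>R (y - p)))) (at s)"
            by (intro has_derivative_compose[where g = ?F and f = ?l]) (auto intro!: derivative_eq_intros)
          then show "((\<lambda>s. ?F (?l s)) has_derivative (\<lambda>h. h *\<^sub>R F' (?l s) (y - p))) (at s)"
            using linear_scale[OF lin[OF ls]] by simp
        qed
        then obtain s where s: "s0 < s" "s < 1" "norm (?F (?l 1) - ?F (?l s0)) \<le> norm ((1 - s0) *\<^sub>R F' (?l s) (y - p))" by auto
        have ls: "?l s \<in> \<Omega>" using s0(2)[of s] s0(1) s by (cases "?l s \<in> \<Omega>") auto
        have "dist (?l s) p = \<bar>s\<bar> * norm (y - p)" by (simp add: dist_norm)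
        also have "\<dots> \<le> norm (y - p)" using s s0(1) by (simp add: mult_left_le_one_le)
        finally have n: "norm (F' (?l s) (y - p)) \<le> e * norm (y - p)" using y(1) by (intro d(2)[OF ls]) simp
        have l1: "?l 1 = y" by simp
        have "norm (?F y) \<le> norm ((1 - s0) *\<^sub>R F' (?l s) (y - p))" using s(3)[unfolded l1] s0(1) by simp
        also have "\<dots> \<le> norm (F' (?l s) (y - p))" using s0(1) s01 by (simp add: mult_left_le_one_le)
        finally show ?thesis using n by linarith
      qed
      then have "norm (?F y - ?F p - 0) \<le> e * norm (y - p)" if "norm (y - p) < d" for y
        using that p e by (cases "y \<in> \<Omega>") auto
      then show ?thesis using d(1) by blast
    qed
    then have "(?F has_derivative (\<lambda>v. 0)) (at p)"
      unfolding has_derivative_at_alt by simp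
    then show ?thesis using p by simp
  next
    case 3
    then have p: "p \<notin> \<Omega>" using closure_subset by blast
    have "(?F has_derivative (\<lambda>v. 0)) (at p)"
      by (rule has_derivative_transform_within_open[OF has_derivative_const _ 3]) (use closure_subset in auto)
    then show ?thesis using p by simp
  qed
qed

section \<open>Solution of the inhomogeneous equations\<close>

text \<open>
  In the sense of distributions \<open>\<nabla>\<^sub>0 \<nabla>\<^sub>0 F\<^sub>1 = \<nabla>\<^sub>1 \<nabla>\<^sub>0 F\<^sub>0\<close>, which is necessary for \<open>(F\<^sub>0, F\<^sub>1) = (\<nabla>\<^sub>0 u, \<nabla>\<^sub>1 u)\<close>
  because \<open>\<nabla>\<^sub>0 \<nabla>\<^sub>0\<close> is scalar and commutes with \<open>\<nabla>\<^sub>1\<close>.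
\<close>

definition compatible ::
    "('v::euclidean_space \<Rightarrow> 'b::euclidean_space \<Rightarrow> 'b) \<Rightarrow> ('v \<times> 'v \<Rightarrow> 'v \<times> 'v \<Rightarrow> 'b) \<Rightarrow> ('v \<times> 'v \<Rightarrow> 'v \<times> 'v \<Rightarrow> 'b) \<Rightarrow> bool" where
  "compatible g F0' F1' \<longleftrightarrow> (\<forall>\<Phi> \<Phi>' S. C1_on UNIV \<Phi> \<Phi>' \<longrightarrow> compact S \<longrightarrow> (\<forall>x. x \<notin> S \<longrightarrow> \<Phi> x = (0::real)) \<longrightarrow>
     (\<Sum>b\<in>Basis. \<Sum>c\<in>Basis. g b (g c (LINT x|lborel. \<Phi>' x (b, 0) *\<^sub>R F1' x (c, 0))))
     = (\<Sum>b\<in>Basis. \<Sum>c\<in>Basis. g b (g c (LINT x|lborel. \<Phi>' x (0, b) *\<^sub>R F0' x (c, 0)))))"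

text \<open>
  The formal computation is \<open>\<Delta>\<^sub>0 \<nabla>\<^sub>1 u = \<nabla>\<^sub>1 \<Delta>\<^sub>0 u = - \<nabla>\<^sub>1 \<nabla>\<^sub>0 F\<^sub>0 = - \<nabla>\<^sub>0 \<nabla>\<^sub>0 F\<^sub>1 = \<Delta>\<^sub>0 F\<^sub>1\<close>. In the weak form all but
  one derivative stay on the test function \<open>p\<close>, whose second derivatives are \<open>q'\<close>.
\<close>

lemma slice_weakly_harmonic:
  fixes u :: "'v::euclidean_space \<times> 'v \<Rightarrow> 'b::euclidean_space"
  assumes g: "clifford_map g"
    and F0: "C1_on UNIV F0 F0'" and F1: "C1_on UNIV F1 F1'" and u: "C1_on UNIV u u'"
    and Du: "\<And>x. (\<Sum>c\<in>Basis. g c (u' x (c, 0))) = F0 x"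
    and comp: "compatible g F0' F1'"
    and p: "C1_on UNIV p p'" "compact S" "\<And>x. x \<notin> S \<Longrightarrow> p x = 0"
    and q: "\<And>c. c \<in> Basis \<Longrightarrow> C1_on UNIV (\<lambda>x. p' x (c, 0)) (q' c)"
    and q_sym: "\<And>c e z. q' c z (e, 0) = q' e z (c, 0)"
  shows "(LINT z|lborel. (\<Sum>c\<in>Basis. q' c z (c, 0)) *\<^sub>R ((\<Sum>b\<in>Basis. g b (u' z (0, b))) - F1 z)) = 0"
proof -
  have p0: "p' x v = 0" if "x \<notin> S" for x v
    by (rule C1_on_zero_off[OF p(1) compact_imp_closed[OF p(2)] _ that]) (rule p(3))
  have q0: "q' b x v = 0" if "x \<notin> S" "b \<in> Basis" for b x v
    by (rule C1_on_zero_off[OF q[OF that(2)] compact_imp_closed[OF p(2)] _ that(1)]) (rule p0)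
  have iq: "integrable lborel (\<lambda>z. q' c z w *\<^sub>R f z)" if "c \<in> Basis" "continuous_on UNIV f" for c w and f :: "'v \<times> 'v \<Rightarrow> 'b"
    by (rule integrable_extend_zero[OF C1_onD(2)[OF q[OF that(1)]] p(2) subset_UNIV open_UNIV q0[OF _ that(1)] that(2)])
  have lin: "linear (g b)" for b by (rule clifford_map_linear[OF g])
  define L where "L z = (\<Sum>c\<in>Basis. q' c z (c, 0))" for z
  have iL: "integrable lborel (\<lambda>z. L z *\<^sub>R f z)" if "continuous_on UNIV f" for f :: "'v \<times> 'v \<Rightarrow> 'b"
    unfolding L_def scaleR_sum_left by (intro Bochner_Integration.integrable_sum iq that)
  have intL: "(LINT z|lborel. L z *\<^sub>R f z) = (\<Sum>c\<in>Basis. (LINT z|lborel. q' c z (c, 0) *\<^sub>R f z))"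
    if "continuous_on UNIV f" for f :: "'v \<times> 'v \<Rightarrow> 'b"
    unfolding L_def scaleR_sum_left by (rule Bochner_Integration.integral_sum) (rule iq[OF _ that])
  have parts: "(LINT x|lborel. q' c x v *\<^sub>R f x) = - (LINT x|lborel. p' x (c, 0) *\<^sub>R f' x v)"
    if "c \<in> Basis" "C1_on UNIV f f'" for c v and f :: "'v \<times> 'v \<Rightarrow> 'b" and f'
    by (rule integral_by_parts[OF q[OF that(1)] p(2) subset_UNIV open_UNIV _ that(2)]) (rule p0)
  define S1 where "S1 b c = (LINT z|lborel. p' z (b, 0) *\<^sub>R F1' z (c, 0))" for b c
  have S1: "S1 b c = S1 c b" for b c
    unfolding S1_def by (rule integral_swap_derivatives[OF p F1])
  have "(LINT z|lborel. L z *\<^sub>R F1 z) = - (\<Sum>c\<in>Basis. S1 c c)"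
    unfolding intL[OF C1_onD(4)[OF F1]] S1_def sum_negf[symmetric] by (intro sum.cong refl parts[OF _ F1])
  also have "\<dots> = (\<Sum>b\<in>Basis. \<Sum>c\<in>Basis. g b (g c (S1 b c)))"
    by (rule clifford_symmetric_sum[OF g S1, symmetric])
  also have "\<dots> = (\<Sum>b\<in>Basis. \<Sum>c\<in>Basis. g b (g c (LINT z|lborel. p' z (0, b) *\<^sub>R F0' z (c, 0))))"
    using comp p unfolding compatible_def S1_def by blast
  also have "\<dots> = (\<Sum>b\<in>Basis. g b (LINT z|lborel. L z *\<^sub>R u' z (0, b)))"
  proof (rule sum.cong[OF refl])
    fix b :: 'v assume b: "b \<in> Basis"
    define S2 where "S2 c e = (LINT z|lborel. q' c z (e, 0) *\<^sub>R u' z (0, b))" for c e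
    have S2: "S2 c e = S2 e c" for c e unfolding S2_def by (simp only: q_sym[of c _ e])
    have "(LINT z|lborel. p' z (0, b) *\<^sub>R F0' z (c, 0)) = - (\<Sum>e\<in>Basis. g e (S2 c e))" if c: "c \<in> Basis" for c
    proof -
      have "(LINT z|lborel. p' z (0, b) *\<^sub>R F0' z (c, 0)) = (LINT z|lborel. p' z (c, 0) *\<^sub>R F0' z (0, b))"
        by (rule integral_swap_derivatives[OF p F0])
      also have "\<dots> = - (LINT z|lborel. q' c z (0, b) *\<^sub>R F0 z)"
        using parts[OF c F0, of "(0, b)"] by simp
      also have "(LINT z|lborel. q' c z (0, b) *\<^sub>R F0 z) = (LINT z|lborel. q' c z (0, b) *\<^sub>R (\<Sum>e\<in>Basis. g e (u' z (e, 0))))"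
        by (simp only: Du)
      also have "\<dots> = (\<Sum>e\<in>Basis. g e (LINT z|lborel. q' c z (0, b) *\<^sub>R u' z (e, 0)))"
        by (rule linear_sum_scaleR_integral[OF lin iq[OF c C1_onD(2)[OF u]], symmetric])
      also have "\<dots> = (\<Sum>e\<in>Basis. g e (S2 c e))"
      proof -
        have "(LINT z|lborel. q' c z (0, b) *\<^sub>R u' z (e, 0)) = S2 c e" for e
          unfolding S2_def by (rule integral_swap_derivatives[OF q[OF c] p(2) p0 u])
        then show ?thesis by (simp only:)
      qed
      finally show ?thesis .
    qed
    then have "(\<Sum>c\<in>Basis. g b (g c (LINT z|lborel. p' z (0, b) *\<^sub>R F0' z (c, 0))))
        = (\<Sum>c\<in>Basis. g b (g c (- (\<Sum>e\<in>Basis. g e (S2 c e)))))" by (intro sum.cong refl) simp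
    also have "\<dots> = g b (- (\<Sum>c\<in>Basis. \<Sum>e\<in>Basis. g c (g e (S2 c e))))"
      by (simp add: linear_sum[OF lin] linear_neg[OF lin] sum_negf)
    also have "(\<Sum>c\<in>Basis. \<Sum>e\<in>Basis. g c (g e (S2 c e))) = - (\<Sum>c\<in>Basis. S2 c c)"
      by (rule clifford_symmetric_sum[OF g S2])
    also have "- (- (\<Sum>c\<in>Basis. S2 c c)) = (LINT z|lborel. L z *\<^sub>R u' z (0, b))"
      unfolding intL[OF C1_onD(2)[OF u]] S2_def by simp
    finally show "(\<Sum>c\<in>Basis. g b (g c (LINT z|lborel. p' z (0, b) *\<^sub>R F0' z (c, 0)))) = g b (LINT z|lborel. L z *\<^sub>R u' z (0, b))" .
  qed
  also have "\<dots> = (LINT z|lborel. L z *\<^sub>R (\<Sum>b\<in>Basis. g b (u' z (0, b))))"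
    by (rule linear_sum_scaleR_integral[OF lin iL[OF C1_onD(2)[OF u]]])
  finally have e: "(LINT z|lborel. L z *\<^sub>R F1 z) = (LINT z|lborel. L z *\<^sub>R (\<Sum>b\<in>Basis. g b (u' z (0, b))))" .
  have "continuous_on UNIV (\<lambda>z. \<Sum>b\<in>Basis. g b (u' z (0, b)))"
    by (intro continuous_on_sum linear_continuous_on_compose[OF C1_onD(2)[OF u] lin])
  note i = iL[OF this]
  have "(LINT z|lborel. L z *\<^sub>R ((\<Sum>b\<in>Basis. g b (u' z (0, b))) - F1 z))
    = (LINT z|lborel. L z *\<^sub>R (\<Sum>b\<in>Basis. g b (u' z (0, b)))) - (LINT z|lborel. L z *\<^sub>R F1 z)"
    unfolding scaleR_diff_right by (rule Bochner_Integration.integral_diff[OF i iL[OF C1_onD(4)[OF F1]]])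
  then show ?thesis using e unfolding L_def by simp
qed

lemma continuous_on_slice_integral:
  fixes w :: "'v::euclidean_space \<Rightarrow> real" and H :: "'v \<times> 'y::euclidean_space \<Rightarrow> real"
  assumes "continuous_on UNIV w" "compact S" "\<And>y. y \<notin> S \<Longrightarrow> w y = 0" "continuous_on UNIV H"
  shows "continuous_on UNIV (\<lambda>y1. LINT y0|lborel. w y0 * H (y0, y1))"
  unfolding continuous_on_sequentially
proof (intro allI ballI impI, unfold o_def)
  fix X :: "nat \<Rightarrow> 'y" and y assume X: "(\<forall>n. X n \<in> UNIV) \<and> X \<longlonglongrightarrow> y"
  define K where "K = insert y (range X)"
  have "compact (S \<times> K)" unfolding K_def using X assms(2) by (intro compact_Times compact_sequence_with_limit) auto
  then have "compact (H ` (S \<times> K))" by (intro compact_continuous_image continuous_on_subset[OF assms(4)] subset_UNIV)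
  then obtain M where M: "M > 0" "\<And>h. h \<in> H ` (S \<times> K) \<Longrightarrow> norm h \<le> M" using compact_norm_bound by blast
  have wi: "integrable lborel w" by (rule integrable_compact_support[OF assms(1-3)])
  have c: "continuous_on UNIV (\<lambda>y0. w y0 * H (y0, y1))" for y1
    by (rule continuous_on_mult[OF assms(1)], rule continuous_on_compose2[OF assms(4)]) (auto intro!: continuous_intros)
  show "(\<lambda>n. LINT y0|lborel. w y0 * H (y0, X n)) \<longlonglongrightarrow> (LINT y0|lborel. w y0 * H (y0, y))"
  proof (rule integral_dominated_convergence[where w = "\<lambda>y0. norm (w y0) * M"])
    show "AE y0 in lborel. (\<lambda>n. w y0 * H (y0, X n)) \<longlonglongrightarrow> w y0 * H (y0, y)"
      using X by (intro AE_I2 tendsto_intros continuous_on_tendsto_compose[OF assms(4)]) auto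
    show "AE y0 in lborel. norm (w y0 * H (y0, X n)) \<le> norm (w y0) * M" for n
    proof (rule AE_I2)
      fix y0 show "norm (w y0 * H (y0, X n)) \<le> norm (w y0) * M"
      proof (cases "y0 \<in> S")
        case True
        then have "norm (H (y0, X n)) \<le> M" unfolding K_def by (intro M(2)) (auto simp: K_def)
        then show ?thesis by (simp add: abs_mult mult_left_mono)
      qed (simp add: assms(3))
    qed
  qed (use wi borel_measurable_continuous_onI[OF c] in auto)
qed

text \<open>
  The weak equation is tested with products of a bump in each variable. Letting the second bump shrink to a
  point gives the weak Laplace equation on each slice.
\<close>

lemma slice_mean_value:
  fixes u :: "'v::euclidean_space \<times> 'v \<Rightarrow> 'b::euclidean_space"
  assumes g: "clifford_map g"
    and F0: "C1_on UNIV F0 F0'" and F1: "C1_on UNIV F1 F1'" and u: "C1_on UNIV u u'"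
    and Du: "\<And>x. (\<Sum>c\<in>Basis. g c (u' x (c, 0))) = F0 x"
    and comp: "compatible g F0' F1'"
  shows "mean_value_on UNIV (\<lambda>y. ((\<Sum>b\<in>Basis. g b (u' (y, y1) (0, b))) - F1 (y, y1)) \<bullet> \<sigma>)"
proof -
  define h where "h z = (\<Sum>b\<in>Basis. g b (u' z (0, b))) - F1 z" for z
  define H where "H z = h z \<bullet> \<sigma>" for z
  have "continuous_on UNIV h"
    unfolding h_def[abs_def] by (intro continuous_on_diff continuous_on_sum C1_onD(4)[OF F1]
        linear_continuous_on_compose[OF C1_onD(2)[OF u] clifford_map_linear[OF g]])
  then have ch: "continuous_on UNIV h" and cH: "continuous_on UNIV H"
    unfolding H_def by (auto intro!: continuous_intros)
  have cH': "continuous_on UNIV (\<lambda>y. H (y, y1))" for y1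
    by (rule continuous_on_compose2[OF cH]) (auto intro!: continuous_intros)
  have "mean_value_on UNIV (\<lambda>y. H (y, y1))"
  proof (rule mean_value_onI[OF open_UNIV cH'])
    fix a :: 'v and t :: real assume t: "t > 0"
    define Q where "Q y1 = (LINT y|lborel. lap_bump ((y - a) /\<^sub>R t) * H (y, y1))" for y1
    have cQ: "continuous_on UNIV Q"
      unfolding Q_def[abs_def]
      by (rule continuous_on_slice_integral[OF continuous_on_lap_bump compact_cball lap_bump_eq_0[OF t] cH])
    have 0: "(LINT y1|lborel. bump 2 ((y1 - b) /\<^sub>R s) * Q y1) = 0" if s: "s > 0" for b s
    proof -
      let ?A = "\<lambda>z::'v \<times> 'v. bump 3 ((fst z - a) /\<^sub>R t)" and ?B = "\<lambda>z::'v \<times> 'v. bump 2 ((snd z - b) /\<^sub>R s)"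
      let ?A' = "\<lambda>(z::'v \<times> 'v) v. - (6 / t\<^sup>2) * ((fst z - a) \<bullet> fst v) * bump 2 ((fst z - a) /\<^sub>R t)"
      let ?B' = "\<lambda>(z::'v \<times> 'v) v. - (2 * real 2 / s\<^sup>2) * ((snd z - b) \<bullet> snd v) * bump (2 - 1) ((snd z - b) /\<^sub>R s)"
      have lf: "linear (fst :: 'v \<times> 'v \<Rightarrow> 'v)" "linear (snd :: 'v \<times> 'v \<Rightarrow> 'v)" by (simp_all add: linear_fst linear_snd)
      have CA: "C1_on UNIV ?A ?A'"
        using C1_on_affine[OF C1_on_bump3(1)[where x = a and t = t] lf(1), of 0] by simp
      have CB: "C1_on UNIV ?B ?B'"
        using C1_on_affine[OF C1_on_bump_at[of 2, where x = b and t = s] lf(2), of 0] by simp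
      have CA2: "C1_on UNIV (\<lambda>z::'v \<times> 'v. - (6 / t\<^sup>2) * ((fst z - a) \<bullet> c) * bump 2 ((fst z - a) /\<^sub>R t)) (\<lambda>z w. bump_hessian t a c (fst z) (fst w))" for c
        using C1_on_affine[OF C1_on_bump3(2)[where x = a and t = t and b = c] lf(1), of 0] by simp
      define p where "p z = ?A z * ?B z" for z
      define p' where "p' z v = ?A z * ?B' z v + ?A' z v * ?B z" for z v
      define q' where "q' c z w = (- (6 / t\<^sup>2) * ((fst z - a) \<bullet> c) * bump 2 ((fst z - a) /\<^sub>R t)) * ?B' z w
        + bump_hessian t a c (fst z) (fst w) * ?B z" for c and z w :: "'v \<times> 'v"
      have Cp: "C1_on UNIV p p'" using C1_on_scaleR[OF CA CB] unfolding p_def[abs_def] p'_def[abs_def] by simp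
      have "p' z (c, 0) = (- (6 / t\<^sup>2) * ((fst z - a) \<bullet> c) * bump 2 ((fst z - a) /\<^sub>R t)) * ?B z" for c z
        unfolding p'_def by simp
      then have Cq: "C1_on UNIV (\<lambda>z. p' z (c, 0)) (q' c)" for c
        using C1_on_scaleR[OF CA2[of c] CB] unfolding q'_def[abs_def] by simp
      have supp: "p z = 0" if "z \<notin> cball a t \<times> cball b s" for z
        using that bump_at_eq_0[of 3 t "fst z" a] bump_at_eq_0[of 2 s "snd z" b] s t
        unfolding p_def by (cases z) auto
      have sym: "q' c z (e, 0) = q' e z (c, 0)" for c e z
        unfolding q'_def bump_hessian_def by (simp add: inner_commute mult_ac)
      have tr: "(\<Sum>c\<in>Basis. q' c z (c, 0)) = (6 / t\<^sup>2) * lap_bump ((fst z - a) /\<^sub>R t) * ?B z" for z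
        using bump_hessian_trace[where t = t and x = a and z = "fst z"] unfolding q'_def by (simp add: sum_distrib_right[symmetric])
      have "(LINT z|lborel. ((6 / t\<^sup>2) * lap_bump ((fst z - a) /\<^sub>R t) * ?B z) *\<^sub>R h z) = 0"
        using slice_weakly_harmonic[OF g F0 F1 u Du comp Cp compact_Times[OF compact_cball compact_cball] supp Cq sym]
        unfolding tr h_def .
      then have "(LINT z|lborel. (6 / t\<^sup>2) *\<^sub>R ((lap_bump ((fst z - a) /\<^sub>R t) * ?B z) *\<^sub>R h z)) = 0"
        by (simp only: scaleR_scaleR mult.assoc)
      then have h0: "(LINT z|lborel. (lap_bump ((fst z - a) /\<^sub>R t) * ?B z) *\<^sub>R h z) = 0"
        unfolding integral_scaleR_right using t by simp
      have cc: "continuous_on UNIV (\<lambda>z. lap_bump ((fst z - a) /\<^sub>R t) * ?B z)"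
        by (rule continuous_on_mult[OF continuous_on_compose2[OF continuous_on_lap_bump, of UNIV fst]
            continuous_on_compose2[OF continuous_on_bump_at, of UNIV snd]]) (auto intro!: continuous_intros)
      have z0: "lap_bump ((fst z - a) /\<^sub>R t) * ?B z = 0" if "z \<notin> cball a t \<times> cball b s" for z
        using that lap_bump_eq_0[of t "fst z" a] bump_at_eq_0[of 2 s "snd z" b] s t by (cases z) auto
      have ih: "integrable lborel (\<lambda>z. (lap_bump ((fst z - a) /\<^sub>R t) * ?B z) *\<^sub>R h z)"
        by (rule integrable_extend_zero[OF cc compact_Times[OF compact_cball compact_cball] subset_UNIV open_UNIV z0 ch])
      have iH: "integrable lborel (\<lambda>z. (lap_bump ((fst z - a) /\<^sub>R t) * ?B z) * H z)"
        using integrable_inner_left[OF ih, of \<sigma>] by (simp add: H_def)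
      have "(LINT z|lborel. (lap_bump ((fst z - a) /\<^sub>R t) * ?B z) * H z) = 0"
        using integral_inner_left[OF ih, of \<sigma>] h0 by (simp add: H_def)
      moreover have "(LINT z|lborel. (lap_bump ((fst z - a) /\<^sub>R t) * ?B z) * H z)
        = (LINT y1|lborel. (LINT y|lborel. (lap_bump ((y - a) /\<^sub>R t) * bump 2 ((y1 - b) /\<^sub>R s)) * H (y, y1)))"
        using lborel_pair.integral_snd[of "\<lambda>y y1. (lap_bump ((y - a) /\<^sub>R t) * bump 2 ((y1 - b) /\<^sub>R s)) * H (y, y1)"] iH
        by (simp add: lborel_prod case_prod_beta')
      moreover have "(LINT y|lborel. (lap_bump ((y - a) /\<^sub>R t) * bump 2 ((y1 - b) /\<^sub>R s)) * H (y, y1))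
        = bump 2 ((y1 - b) /\<^sub>R s) * Q y1" for y1
        unfolding Q_def integral_mult_right_zero[symmetric] by (simp add: mult_ac)
      ultimately show ?thesis by simp
    qed
    have "Q y1 = 0" by (rule zero_if_bump_averages_zero[OF open_UNIV UNIV_I cQ zero_less_one 0])
    then show "(LINT z|lborel. lap_bump ((z - a) /\<^sub>R t) * H (z, y1)) = 0" by (simp add: Q_def)
  qed
  then show ?thesis by (simp add: H_def h_def)
qed

lemma shifted_compact_support:
  fixes G :: "'v::euclidean_space \<times> 'v \<Rightarrow> 'b::euclidean_space"
  assumes "continuous_on UNIV G" "compact S" "\<And>z. z \<notin> S \<Longrightarrow> G z = 0"
  obtains R where "R > 0" "\<And>x y. G (x + (- y, 0)) \<noteq> 0 \<Longrightarrow> y \<in> cball (fst x) R"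
    "\<And>x. continuous_on UNIV (\<lambda>y. G (x + (- y, 0)))"
proof -
  obtain R where R: "R > 0" "\<And>z. z \<in> S \<Longrightarrow> norm z \<le> R" using compact_norm_bound[OF assms(2)] by blast
  show ?thesis
  proof (rule that[OF R(1)])
    fix x :: "'v \<times> 'v" and y :: 'v assume "G (x + (- y, 0)) \<noteq> 0"
    then have "x + (- y, 0) \<in> S" using assms(3) by blast
    then have "norm (x + (- y, 0)) \<le> R" by (rule R(2))
    moreover have "x + (- y, 0) = (fst x - y, snd x)" by (simp add: prod_eq_iff)
    ultimately have "norm (fst x - y) \<le> R" using norm_fst_le[of "fst x - y" "snd x"] by simp
    then show "y \<in> cball (fst x) R" by (simp add: dist_norm)
  next
    fix x show "continuous_on UNIV (\<lambda>y. G (x + (- y, 0)))"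
      by (rule continuous_on_compose2[OF assms(1)]) (auto intro!: continuous_intros)
  qed
qed

lemma integrable_fund_shift:
  fixes G :: "'v::euclidean_space \<times> 'v \<Rightarrow> 'b::euclidean_space"
  assumes "continuous_on UNIV G" "compact S" "\<And>z. z \<notin> S \<Longrightarrow> G z = 0"
  shows "integrable lborel (\<lambda>y. (fund y \<bullet> w) *\<^sub>R G (x + (- y, 0)))"
proof -
  obtain R where R: "R > 0" "\<And>x y. G (x + (- y, 0)) \<noteq> 0 \<Longrightarrow> y \<in> cball (fst x) R"
    "\<And>x. continuous_on UNIV (\<lambda>y. G (x + (- y, 0)))" using shifted_compact_support[OF assms] by metis
  show ?thesis by (rule fund_integral(1)[OF R(3) compact_cball[of "fst x" R]]) (use R(2) in blast)
qed

text \<open>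
  Near its singularity \<open>fund\<close> is integrable, and elsewhere it is at most \<open>1\<close>.
\<close>

lemma fund_convolution_bounded:
  fixes G :: "'v::euclidean_space \<times> 'v \<Rightarrow> 'b::euclidean_space"
  assumes "continuous_on UNIV G" "compact S" "\<And>z. z \<notin> S \<Longrightarrow> G z = 0"
  obtains B where "\<And>x. norm (LINT y|lborel. (fund y \<bullet> w) *\<^sub>R G (x + (- y, 0))) \<le> B"
proof -
  obtain R where R: "R > 0" "\<And>x y. G (x + (- y, 0)) \<noteq> 0 \<Longrightarrow> y \<in> cball (fst x) R"
    "\<And>x. continuous_on UNIV (\<lambda>y. G (x + (- y, 0)))" using shifted_compact_support[OF assms] by metis
  obtain M where M: "M > 0" "\<And>x. norm (G x) \<le> M" using bounded_compact_support[OF assms] by blast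
  define I where "I = (LINT y|lborel. indicator (cball 0 1) y *\<^sub>R norm (fund (y::'v)))"
  define V where "V = measure lborel (cball (0::'v) 1)"
  have "norm (LINT y|lborel. (fund y \<bullet> w) *\<^sub>R G (x + (- y, 0))) \<le> (norm w * M) * (I + R ^ DIM('v) * V)" for x
  proof -
    have i: "integrable lborel (\<lambda>y. indicator (cball 0 1) y *\<^sub>R norm (fund (y::'v)) + indicator (cball (fst x) R) y)"
      by (intro Bochner_Integration.integrable_add integrable_fund_unit_ball integrable_indicator_cball)
    have "norm (LINT y|lborel. (fund y \<bullet> w) *\<^sub>R G (x + (- y, 0)))
      \<le> (LINT y|lborel. (norm w * M) * (indicator (cball 0 1) y *\<^sub>R norm (fund y) + indicator (cball (fst x) R) y))"
    proof (rule Bochner_Integration.integral_norm_bound_integral[OF integrable_fund_shift[OF assms(1,2)] integrable_mult_right[OF i]])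
      show "G z = 0" if "z \<notin> S" for z using assms(3)[OF that] .
      fix y :: 'v
      show "norm ((fund y \<bullet> w) *\<^sub>R G (x + (- y, 0)))
        \<le> (norm w * M) * (indicator (cball 0 1) y *\<^sub>R norm (fund y) + indicator (cball (fst x) R) y)"
      proof (cases "G (x + (- y, 0)) = 0")
        case True
        then show ?thesis using M(1) by (simp add: indicator_def)
      next
        case False
        have "norm (fund y) \<le> indicator (cball 0 1) y *\<^sub>R norm (fund y) + indicator (cball (fst x) R) y"
          using R(2)[OF False] norm_fund_le_1[of y] by (cases "norm y \<le> 1") (auto simp: indicator_def)
        then have "(norm w * M) * norm (fund y) \<le> (norm w * M) * (indicator (cball 0 1) y *\<^sub>R norm (fund y) + indicator (cball (fst x) R) y)"
          using M(1) by (intro mult_left_mono) auto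
        moreover have "norm ((fund y \<bullet> w) *\<^sub>R G (x + (- y, 0))) \<le> (norm (fund y) * norm w) * M"
          unfolding norm_scaleR using Cauchy_Schwarz_ineq2[of "fund y" w] M by (intro mult_mono) auto
        ultimately show ?thesis by (simp add: mult_ac)
      qed
    qed
    also have "\<dots> = (norm w * M) * (I + measure lborel (cball (fst x) R))"
      unfolding integral_mult_right_zero
      by (subst Bochner_Integration.integral_add[OF integrable_fund_unit_ball integrable_indicator_cball]) (simp add: I_def)
    also have "measure lborel (cball (fst x) R) = R ^ DIM('v) * V" using R(1) by (simp add: content_cball V_def)
    finally show ?thesis .
  qed
  then show ?thesis using that by blast
qed

text \<open>
  In dimension \<open>1\<close> neither of the two terms tends to \<open>0\<close>, only the difference does. In every dimension
  \<open>fund (n e + z)\<close> is \<open>n / n\<^sup>d \<le> 1\<close> times a vector that converges to \<open>e\<close>.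
\<close>

lemma fund_far_difference:
  fixes e y :: "'v::euclidean_space"
  assumes e: "norm e = 1"
  shows "(\<lambda>n. fund (real n *\<^sub>R e - y) - fund (real n *\<^sub>R e + y)) \<longlonglongrightarrow> 0"
proof -
  define A where "A n z = (e + inverse (real n) *\<^sub>R z) /\<^sub>R norm (e + inverse (real n) *\<^sub>R z) ^ DIM('v)" for n and z :: 'v
  have inv: "(\<lambda>n. inverse (real n)) \<longlonglongrightarrow> 0" by (rule LIMSEQ_inverse_real_of_nat[THEN LIMSEQ_imp_Suc])
  have A: "(\<lambda>n. A n z) \<longlonglongrightarrow> e" for z
  proof -
    have "(\<lambda>n. e + inverse (real n) *\<^sub>R z) \<longlonglongrightarrow> e + 0 *\<^sub>R z" by (intro tendsto_intros inv)
    then have "(\<lambda>n. e + inverse (real n) *\<^sub>R z) \<longlonglongrightarrow> e" by simp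
    then have "(\<lambda>n. A n z) \<longlonglongrightarrow> e /\<^sub>R norm e ^ DIM('v)"
      unfolding A_def by (intro tendsto_intros) (use e in auto)
    then show ?thesis using e by simp
  qed
  have eq: "fund (real n *\<^sub>R e + z) = (real n / real n ^ DIM('v)) *\<^sub>R A n z" if "n > 0" for n z
  proof -
    have "real n *\<^sub>R e + z = real n *\<^sub>R (e + inverse (real n) *\<^sub>R z)" using that by (simp add: scaleR_add_right)
    then show ?thesis unfolding A_def fund_def by (simp add: power_mult_distrib divide_inverse mult_ac)
  qed
  have "(\<lambda>n. A n (- y) - A n y) \<longlonglongrightarrow> e - e" by (intro tendsto_diff A)
  then have "(\<lambda>n. norm (A n (- y) - A n y)) \<longlonglongrightarrow> 0" using tendsto_norm_zero by simp
  then show ?thesis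
  proof (rule Lim_null_comparison[rotated])
    show "\<forall>\<^sub>F n in sequentially. norm (fund (real n *\<^sub>R e - y) - fund (real n *\<^sub>R e + y)) \<le> norm (A n (- y) - A n y)"
      using eventually_gt_at_top[of 0]
    proof eventually_elim
      case (elim n)
      have "real n ^ 1 \<le> real n ^ DIM('v)" using elim by (intro power_increasing) (auto simp: Suc_le_eq)
      then have "real n / real n ^ DIM('v) \<le> 1" using elim by (simp add: divide_le_eq_1)
      moreover have "fund (real n *\<^sub>R e - y) - fund (real n *\<^sub>R e + y) = (real n / real n ^ DIM('v)) *\<^sub>R (A n (- y) - A n y)"
        using eq[OF elim, of "- y"] eq[OF elim, of y] by (simp add: scaleR_diff_right)
      ultimately show ?case by (simp only: norm_scaleR) (intro mult_left_le_one_le; simp)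
    qed
  qed
qed

text \<open>Since \<open>fund\<close> is odd, the convolutions at opposite points far away cancel in the limit.\<close>

lemma fund_convolution_antipodal:
  fixes G :: "'v::euclidean_space \<times> 'v \<Rightarrow> 'b::euclidean_space"
  assumes G: "continuous_on UNIV G" "compact S" "\<And>z. z \<notin> S \<Longrightarrow> G z = 0" and e: "norm e = 1"
  shows "(\<lambda>n. (LINT y|lborel. (fund y \<bullet> w) *\<^sub>R G ((real n *\<^sub>R e, y1) + (- y, 0)))
     + (LINT y|lborel. (fund y \<bullet> w) *\<^sub>R G ((- (real n *\<^sub>R e), y1) + (- y, 0)))) \<longlonglongrightarrow> 0"
proof -
  obtain R where R: "R > 0" "\<And>z. z \<in> S \<Longrightarrow> norm z \<le> R" using compact_norm_bound[OF G(2)] by blast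
  define \<psi> where "\<psi> y = G (y, y1)" for y
  have c\<psi>: "continuous_on UNIV \<psi>"
    unfolding \<psi>_def[abs_def] by (rule continuous_on_compose2[OF G(1)]) (auto intro!: continuous_intros)
  have \<psi>0: "\<psi> y = 0" if "y \<notin> cball 0 R" for y
    using R(2)[of "(y, y1)"] norm_fst_le[of y y1] G(3)[of "(y, y1)"] that by (force simp: \<psi>_def)
  have \<psi>i: "integrable lborel \<psi>" by (rule integrable_compact_support[OF c\<psi> compact_cball \<psi>0])
  have [measurable]: "\<psi> \<in> borel_measurable borel" using borel_measurable_continuous_onI[OF c\<psi>] .
  have move: "(LINT y|lborel. (fund y \<bullet> w) *\<^sub>R G ((a, y1) + (- y, 0))) = (LINT y|lborel. (fund (a - y) \<bullet> w) *\<^sub>R \<psi> y)"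
    "integrable lborel (\<lambda>y. (fund (a - y) \<bullet> w) *\<^sub>R \<psi> y)" for a
  proof -
    have m: "(\<lambda>y. (fund y \<bullet> w) *\<^sub>R \<psi> (a - y)) \<in> borel_measurable borel" by measurable
    have eq: "(\<lambda>y. (fund y \<bullet> w) *\<^sub>R G ((a, y1) + (- y, 0))) = (\<lambda>y. (fund y \<bullet> w) *\<^sub>R \<psi> (a - y))"
      by (simp add: \<psi>_def)
    show "(LINT y|lborel. (fund y \<bullet> w) *\<^sub>R G ((a, y1) + (- y, 0))) = (LINT y|lborel. (fund (a - y) \<bullet> w) *\<^sub>R \<psi> y)"
      unfolding eq using lborel_affine_integral(1)[OF m, of "-1" a] by simp
    show "integrable lborel (\<lambda>y. (fund (a - y) \<bullet> w) *\<^sub>R \<psi> y)"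
      using lborel_affine_integral(2)[OF m, of "-1" a] integrable_fund_shift[OF G, of w "(a, y1)"] eq by simp
  qed
  have "(LINT y|lborel. (fund y \<bullet> w) *\<^sub>R G ((real n *\<^sub>R e, y1) + (- y, 0)))
     + (LINT y|lborel. (fund y \<bullet> w) *\<^sub>R G ((- (real n *\<^sub>R e), y1) + (- y, 0)))
     = (LINT y|lborel. ((fund (real n *\<^sub>R e - y) - fund (real n *\<^sub>R e + y)) \<bullet> w) *\<^sub>R \<psi> y)" for n
  proof -
    have "fund (- (real n *\<^sub>R e) - y) = - fund (real n *\<^sub>R e + y)" for y
      using fund_minus[of "real n *\<^sub>R e + y"] by simp
    then show ?thesis
      unfolding move(1) Bochner_Integration.integral_add[OF move(2) move(2), symmetric]
      by (simp add: inner_diff_left scaleR_diff_left)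
  qed
  moreover have "(\<lambda>n. LINT y|lborel. ((fund (real n *\<^sub>R e - y) - fund (real n *\<^sub>R e + y)) \<bullet> w) *\<^sub>R \<psi> y) \<longlonglongrightarrow> 0"
  proof -
    obtain N :: nat where N: "real N \<ge> R + 1" using real_arch_simple by blast
    have "(\<lambda>n. LINT y|lborel. ((fund (real (n + N) *\<^sub>R e - y) - fund (real (n + N) *\<^sub>R e + y)) \<bullet> w) *\<^sub>R \<psi> y) \<longlonglongrightarrow> (LINT (y::'v)|lborel. (0::'b))"
    proof (rule integral_dominated_convergence[where w = "\<lambda>y. 2 * norm w * norm (\<psi> y)"])
      show "AE y in lborel. (\<lambda>n. ((fund (real (n + N) *\<^sub>R e - y) - fund (real (n + N) *\<^sub>R e + y)) \<bullet> w) *\<^sub>R \<psi> y) \<longlonglongrightarrow> 0"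
      proof (rule AE_I2)
        fix y :: 'v
        have "(\<lambda>n. ((fund (real n *\<^sub>R e - y) - fund (real n *\<^sub>R e + y)) \<bullet> w) *\<^sub>R \<psi> y) \<longlonglongrightarrow> (0 \<bullet> w) *\<^sub>R \<psi> y"
          by (intro tendsto_intros fund_far_difference e)
        from LIMSEQ_ignore_initial_segment[OF this, of N]
        show "(\<lambda>n. ((fund (real (n + N) *\<^sub>R e - y) - fund (real (n + N) *\<^sub>R e + y)) \<bullet> w) *\<^sub>R \<psi> y) \<longlonglongrightarrow> 0" by simp
      qed
      show "AE y in lborel. norm (((fund (real (n + N) *\<^sub>R e - y) - fund (real (n + N) *\<^sub>R e + y)) \<bullet> w) *\<^sub>R \<psi> y) \<le> 2 * norm w * norm (\<psi> y)" for n
      proof (rule AE_I2)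
        fix y :: 'v
        show "norm (((fund (real (n + N) *\<^sub>R e - y) - fund (real (n + N) *\<^sub>R e + y)) \<bullet> w) *\<^sub>R \<psi> y) \<le> 2 * norm w * norm (\<psi> y)"
        proof (cases "norm y \<le> R")
          case True
          have far: "norm (fund (real (n + N) *\<^sub>R e + z)) \<le> 1" if "norm z \<le> R" for z
          proof (rule norm_fund_le_1)
            have "real (n + N) - norm z \<le> norm (real (n + N) *\<^sub>R e + z)"
              using norm_triangle_ineq2[of "real (n + N) *\<^sub>R e" "- z"] e by simp
            then show "1 \<le> norm (real (n + N) *\<^sub>R e + z)" using that N by simp
          qed
          have "norm (fund (real (n + N) *\<^sub>R e - y) - fund (real (n + N) *\<^sub>R e + y)) \<le> 1 + 1"
            using far[of "- y"] far[of y] True by (intro order_trans[OF norm_triangle_ineq4] add_mono) auto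
          then have "norm (fund (real (n + N) *\<^sub>R e - y) - fund (real (n + N) *\<^sub>R e + y)) * norm w \<le> 2 * norm w"
            by (intro mult_right_mono) auto
          then have "\<bar>(fund (real (n + N) *\<^sub>R e - y) - fund (real (n + N) *\<^sub>R e + y)) \<bullet> w\<bar> \<le> 2 * norm w"
            using Cauchy_Schwarz_ineq2 order_trans by blast
          then show ?thesis unfolding norm_scaleR by (rule mult_right_mono) simp
        qed (use \<psi>0 in simp)
      qed
      show "(\<lambda>y. ((fund (real (n + N) *\<^sub>R e - y) - fund (real (n + N) *\<^sub>R e + y)) \<bullet> w) *\<^sub>R \<psi> y) \<in> borel_measurable lborel" for n by measurable
    qed (use \<psi>i in auto)
    then have "(\<lambda>n. LINT y|lborel. ((fund (real (n + N) *\<^sub>R e - y) - fund (real (n + N) *\<^sub>R e + y)) \<bullet> w) *\<^sub>R \<psi> y) \<longlonglongrightarrow> 0" by simp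
    then show ?thesis by (rule LIMSEQ_offset)
  qed
  ultimately show ?thesis by (simp only:)
qed

text \<open>
  The solution is the convolution of \<open>F0\<close> with the Cauchy kernel in the first variable. That it solves the
  second equation is a consequence of the compatibility, of Liouville's theorem on the slices and of the
  behaviour at infinity. The linear maps \<open>T1\<close> and \<open>T2\<close> carry along a linear side condition: if the values of
  \<open>F0\<close> lie in the kernel of \<open>T1\<close>, and Clifford multiplication maps it to the kernel of \<open>T2\<close>, then the
  values of \<open>u\<close> lie in the latter.
\<close>

lemma dirac_solution:
  fixes F0 F1 :: "'v::euclidean_space \<times> 'v \<Rightarrow> 'b::euclidean_space"
    and T1 :: "'b \<Rightarrow> 'c::euclidean_space" and T2 :: "'b \<Rightarrow> 'd::euclidean_space"
  assumes g: "clifford_map g"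
    and F0: "C1_on UNIV F0 F0'" and F1: "C1_on UNIV F1 F1'"
    and S: "compact S" "\<And>x. x \<notin> S \<Longrightarrow> F0 x = 0" "\<And>x. x \<notin> S \<Longrightarrow> F1 x = 0"
    and comp: "compatible g F0' F1'"
    and T: "linear T1" "linear T2" "\<And>x. T1 (F0 x) = 0" "\<And>b s. b \<in> Basis \<Longrightarrow> T1 s = 0 \<Longrightarrow> T2 (g b s) = 0"
  obtains u u' R where "C1_on UNIV u u'" "\<And>x. (\<Sum>c\<in>Basis. g c (u' x (c, 0))) = F0 x"
    "\<And>x. (\<Sum>c\<in>Basis. g c (u' x (0, c))) = F1 x" "\<And>x. norm (snd x) > R \<Longrightarrow> u x = 0" "\<And>x. T2 (u x) = 0"
proof -
  define \<kappa> where "\<kappa> = fund_const TYPE('v)"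
  have \<kappa>: "\<kappa> > 0" unfolding \<kappa>_def by (rule fund_const_pos)
  have lin: "linear (g b)" for b by (rule clifford_map_linear[OF g])
  have F0'0: "F0' x v = 0" if "x \<notin> S" for x v
    by (rule C1_on_zero_off[OF F0 compact_imp_closed[OF S(1)] _ that]) (rule S(2))
  obtain R where R: "R > 0" "\<And>z. z \<in> S \<Longrightarrow> norm z \<le> R" using compact_norm_bound[OF S(1)] by blast
  define J where "J i x = (LINT y|lborel. (fund y \<bullet> i) *\<^sub>R F0 (x + (- y, 0)))" for i x
  define J' where "J' i x v = (LINT y|lborel. (fund y \<bullet> i) *\<^sub>R F0' (x + (- y, 0)) v)" for i x v
  define u where "u x = (- 1 / \<kappa>) *\<^sub>R (\<Sum>i\<in>Basis. g i (J i x))" for x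
  define u' where "u' x v = (- 1 / \<kappa>) *\<^sub>R (\<Sum>i\<in>Basis. g i (J' i x v))" for x v
  have CJ: "C1_on UNIV (J i) (J' i)" for i
    unfolding J_def[abs_def] J'_def[abs_def]
  proof (rule C1_on_convolution_local[OF integrable_fund_component F0 S(1,2)])
    show "(\<lambda>y. (- y, 0)) \<in> borel_measurable (borel :: 'v measure)"
      by (intro borel_measurable_continuous_onI continuous_intros)
  qed (auto simp: norm_prod_def)
  have Cu: "C1_on UNIV u u'"
    unfolding u_def[abs_def] u'_def[abs_def]
    by (rule C1_on_linear_image[where T = "\<lambda>s. (- 1 / \<kappa>) *\<^sub>R s", OF C1_on_sum[OF C1_on_linear_image[OF CJ lin]]])
      (auto intro!: linearI simp: scaleR_add_right)
  have D0: "(\<Sum>c\<in>Basis. g c (u' x (c, 0))) = F0 x" for x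
  proof -
    define \<phi> where "\<phi> y = F0 ((- y, 0) + x)" for y
    define \<phi>' where "\<phi>' y v = F0' ((- y, 0) + x) (- v, 0)" for y v
    have C\<phi>: "C1_on UNIV \<phi> \<phi>'"
      unfolding \<phi>_def[abs_def] \<phi>'_def[abs_def] by (rule C1_on_affine[OF F0]) (auto intro!: linearI)
    obtain r where r: "r > 0" "\<And>x y. F0 (x + (- y, 0)) \<noteq> 0 \<Longrightarrow> y \<in> cball (fst x) r"
      using shifted_compact_support[OF C1_onD(4)[OF F0] S(1,2)] by metis
    have \<phi>0: "\<phi> y = 0" if "y \<notin> cball (fst x) r" for y
      using r(2)[where x = x and y = y] that unfolding \<phi>_def by (auto simp: add.commute)
    have J'\<phi>: "J' i x (k, 0) = - (LINT y|lborel. (fund y \<bullet> i) *\<^sub>R \<phi>' y k)" for i k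
    proof -
      have "\<phi>' y k = - F0' (x + (- y, 0)) (k, 0)" for y
        using linear_neg[OF C1_onD(3)[OF F0], of "x + (- y, 0)" "(k, 0)"] by (simp add: \<phi>'_def add.commute)
      then show ?thesis unfolding J'_def by simp
    qed
    have sym: "J' i x (k, 0) = J' k x (i, 0)" for i k
      unfolding J'\<phi> by (rule arg_cong[OF fund_integral_symmetric[OF C\<phi> compact_cball \<phi>0]])
    have "(\<Sum>c\<in>Basis. g c (u' x (c, 0))) = (- 1 / \<kappa>) *\<^sub>R (\<Sum>c\<in>Basis. \<Sum>i\<in>Basis. g c (g i (J' i x (c, 0))))"
      unfolding u'_def by (simp only: linear_scale[OF lin] linear_sum[OF lin] scaleR_sum_right)
    also have "(\<Sum>c\<in>Basis. \<Sum>i\<in>Basis. g c (g i (J' i x (c, 0)))) = - (\<Sum>c\<in>Basis. J' c x (c, 0))"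
      by (rule clifford_symmetric_sum[OF g sym])
    also have "\<dots> = (\<Sum>c\<in>Basis. LINT y|lborel. (fund y \<bullet> c) *\<^sub>R \<phi>' y c)"
      unfolding J'\<phi> by (simp add: sum_negf)
    also have "\<dots> = - \<kappa> *\<^sub>R \<phi> 0"
      unfolding \<kappa>_def by (rule fund_integral_divergence[OF C\<phi> compact_cball \<phi>0])
    finally show ?thesis using \<kappa> by (simp add: \<phi>_def zero_prod_def[symmetric])
  qed
  \<comment> \<open>On each slice \<open>h\<close> is harmonic and bounded, hence constant.\<close>
  define h where "h x = (\<Sum>b\<in>Basis. g b (u' x (0, b))) - F1 x" for x
  have mv: "mean_value_on UNIV (\<lambda>y. h (y, y1) \<bullet> \<sigma>)" for y1 \<sigma>
    unfolding h_def by (rule slice_mean_value[OF g F0 F1 Cu D0 comp])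
  obtain BF where BF: "\<And>x. norm (F1 x) \<le> BF" using bounded_compact_support[OF C1_onD(4)[OF F1] S(1,3)] by metis
  have "\<exists>B. \<forall>x. norm (J' i x v) \<le> B" for i v
    unfolding J'_def using fund_convolution_bounded[OF C1_onD(2)[OF F0] S(1) F0'0, of i v] by metis
  then obtain B where B: "\<And>i v x. norm (J' i x v) \<le> B i v" by metis
  have gb: "\<exists>K. \<forall>s. norm (g b s) \<le> K * norm s" for b
    using linear_bounded[OF lin[of b]] by blast
  then obtain K where K: "\<And>b s. norm (g b s) \<le> K b * norm s" by metis
  have hb: "\<exists>M. \<forall>x. norm (h x) \<le> M"
  proof -
    have u'b: "norm (u' x v) \<le> \<bar>1 / \<kappa>\<bar> * (\<Sum>i\<in>Basis. \<bar>K i\<bar> * B i v)" for x v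
    proof -
      have "norm (\<Sum>i\<in>Basis. g i (J' i x v)) \<le> (\<Sum>i\<in>Basis. \<bar>K i\<bar> * B i v)"
      proof (intro order_trans[OF norm_sum] sum_mono)
        fix i :: 'v
        have "norm (g i (J' i x v)) \<le> K i * norm (J' i x v)" by (rule K)
        also have "\<dots> \<le> \<bar>K i\<bar> * B i v" by (intro mult_mono B) auto
        finally show "norm (g i (J' i x v)) \<le> \<bar>K i\<bar> * B i v" .
      qed
      then show ?thesis unfolding u'_def by (simp add: mult_left_mono divide_right_mono)
    qed
    have "norm (h x) \<le> (\<Sum>b\<in>Basis. \<bar>K b\<bar> * (\<bar>1 / \<kappa>\<bar> * (\<Sum>i\<in>Basis. \<bar>K i\<bar> * B i (0, b)))) + BF" for x
      unfolding h_def
    proof (intro order_trans[OF norm_triangle_ineq4] add_mono BF order_trans[OF norm_sum] sum_mono)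
      fix b :: 'v
      have "norm (g b (u' x (0, b))) \<le> K b * norm (u' x (0, b))" by (rule K)
      also have "\<dots> \<le> \<bar>K b\<bar> * (\<bar>1 / \<kappa>\<bar> * (\<Sum>i\<in>Basis. \<bar>K i\<bar> * B i (0, b)))" by (intro mult_mono u'b) auto
      finally show "norm (g b (u' x (0, b))) \<le> \<bar>K b\<bar> * (\<bar>1 / \<kappa>\<bar> * (\<Sum>i\<in>Basis. \<bar>K i\<bar> * B i (0, b)))" .
    qed
    then show ?thesis by blast
  qed
  then obtain M where M: "\<And>x. norm (h x) \<le> M" by blast
  have const: "h (y, y1) = h (0, y1)" for y y1
  proof (rule euclidean_eqI)
    fix \<sigma> :: 'b assume \<sigma>: "\<sigma> \<in> Basis"
    show "h (y, y1) \<bullet> \<sigma> = h (0, y1) \<bullet> \<sigma>"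
    proof (rule mean_value_on_Liouville[OF mv])
      show "\<bar>h (y, y1) \<bullet> \<sigma>\<bar> \<le> M" for y using Basis_le_norm[OF \<sigma>, of "h (y, y1)"] M[of "(y, y1)"] by linarith
    qed
  qed
  have h0: "h (0, y1) = 0" for y1
  proof -
    obtain e :: 'v where e: "e \<in> Basis" using nonempty_Basis by blast
    then have e1: "norm e = 1" by simp
    \<comment> \<open>At the far points \<open>P n\<close> and \<open>Q n\<close> on opposite sides \<open>F1\<close> vanishes and the kernel has opposite signs.\<close>
    define P where "P n = (real n *\<^sub>R e, y1)" for n
    define Q where "Q n = (- (real n *\<^sub>R e), y1)" for n
    have J0: "(\<lambda>n. J' i (P n) v + J' i (Q n) v) \<longlonglongrightarrow> 0" for i v
      unfolding J'_def P_def Q_def by (rule fund_convolution_antipodal[OF C1_onD(2)[OF F0] S(1) F0'0 e1])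
    have glim: "(\<lambda>n. g b (X n)) \<longlonglongrightarrow> 0" if X: "X \<longlonglongrightarrow> 0" for b and X :: "nat \<Rightarrow> 'b"
    proof -
      have "bounded_linear (g b)" using lin by (simp add: linear_conv_bounded_linear)
      from bounded_linear.tendsto[OF this X] show ?thesis using linear_0[OF lin] by simp
    qed
    have uu: "u' (P n) v + u' (Q n) v = (- 1 / \<kappa>) *\<^sub>R (\<Sum>i\<in>Basis. g i (J' i (P n) v + J' i (Q n) v))" for n v
      unfolding u'_def by (simp add: linear_add[OF lin] sum.distrib scaleR_add_right)
    have "(\<lambda>n. u' (P n) v + u' (Q n) v) \<longlonglongrightarrow> (- 1 / \<kappa>) *\<^sub>R (\<Sum>i\<in>(Basis::'v set). 0)" for v
      unfolding uu by (intro tendsto_scaleR tendsto_const tendsto_sum glim J0)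
    then have u0: "(\<lambda>n. u' (P n) v + u' (Q n) v) \<longlonglongrightarrow> 0" for v by simp
    have "(\<lambda>n. \<Sum>b\<in>Basis. g b (u' (P n) (0, b) + u' (Q n) (0, b))) \<longlonglongrightarrow> (\<Sum>b\<in>(Basis::'v set). 0)"
      by (intro tendsto_sum glim u0)
    moreover have "\<forall>\<^sub>F n in sequentially. (\<Sum>b\<in>Basis. g b (u' (P n) (0, b) + u' (Q n) (0, b))) = 2 *\<^sub>R h (0, y1)"
    proof -
      obtain N :: nat where N: "real N > R" using reals_Archimedean2 by blast
      show ?thesis using eventually_ge_at_top[of N]
      proof eventually_elim
        case (elim n)
        have "norm (real n *\<^sub>R e) > R" using elim N e1 by simp
        then have "norm (P n) > R" "norm (Q n) > R"
          unfolding P_def Q_def using norm_fst_le[of "real n *\<^sub>R e" y1] norm_fst_le[of "- (real n *\<^sub>R e)" y1] by auto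
        then have "P n \<notin> S" "Q n \<notin> S" using R(2)[of "P n"] R(2)[of "Q n"] by auto
        then have "F1 (P n) = 0" "F1 (Q n) = 0" by (auto intro: S(3))
        then have "h (P n) + h (Q n) = (\<Sum>b\<in>Basis. g b (u' (P n) (0, b) + u' (Q n) (0, b)))"
          unfolding h_def by (simp add: linear_add[OF lin] sum.distrib)
        moreover have "h (P n) + h (Q n) = 2 *\<^sub>R h (0, y1)"
          unfolding P_def Q_def const[of "real n *\<^sub>R e"] const[of "- (real n *\<^sub>R e)"] by (simp add: scaleR_2)
        ultimately show ?case by simp
      qed
    qed
    ultimately have "(\<lambda>n::nat. 2 *\<^sub>R h (0, y1)) \<longlonglongrightarrow> (\<Sum>b\<in>(Basis::'v set). 0)"
      by (rule Lim_transform_eventually)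
    then have "2 *\<^sub>R h (0, y1) = 0" using LIMSEQ_unique[OF tendsto_const] by fastforce
    then show ?thesis by simp
  qed
  show ?thesis
  proof (rule that[OF Cu D0])
    show "(\<Sum>c\<in>Basis. g c (u' x (0, c))) = F1 x" for x
      using const[of "fst x" "snd x"] h0[of "snd x"] unfolding h_def by simp
    show "u x = 0" if x: "norm (snd x) > R" for x
    proof -
      have "F0 (x + (- y, 0)) = 0" for y
      proof (rule S(2))
        have "x + (- y, 0) = (fst x - y, snd x)" by (simp add: prod_eq_iff)
        then have "norm (x + (- y, 0)) > R" using x norm_snd_le[of "snd x" "fst x - y"] by simp
        then show "x + (- y, 0) \<notin> S" using R(2)[of "x + (- y, 0)"] by auto
      qed
      then show ?thesis unfolding u_def J_def by (simp add: linear_0[OF lin])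
    qed
    show "T2 (u x) = 0" for x
    proof -
      have "T1 (J i x) = 0" for i
      proof -
        have "T1 (J i x) = (LINT y|lborel. T1 ((fund y \<bullet> i) *\<^sub>R F0 (x + (- y, 0))))"
          unfolding J_def by (rule integral_linear_image(2)[OF T(1) integrable_fund_shift[OF C1_onD(4)[OF F0] S(1,2)], symmetric])
        then show ?thesis by (simp add: linear_scale[OF T(1)] T(3))
      qed
      then show ?thesis unfolding u_def by (simp add: linear_neg[OF T(2)] linear_scale[OF T(2)] linear_sum[OF T(2)] T(4))
    qed
  qed
qed

section \<open>The data of the extension problem are compatible\<close>

text \<open>The symmetry of second derivatives follows from exchanging derivatives under the integral.\<close>

lemma second_derivatives_commute:
  fixes f :: "'a::euclidean_space \<Rightarrow> 'b::euclidean_space"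
  assumes "open U" and f: "C1_on U f f1" and fa: "C1_on U (\<lambda>x. f1 x a) fa" and fb: "C1_on U (\<lambda>x. f1 x b) fb" and x: "x \<in> U"
  shows "fa x b = fb x a"
proof (rule euclidean_eqI)
  fix \<sigma> :: 'b
  define K where "K z = (fa z b - fb z a) \<bullet> \<sigma>" for z
  have cK: "continuous_on U K" unfolding K_def[abs_def] by (intro continuous_intros C1_onD(2)[OF fa] C1_onD(2)[OF fb])
  obtain r where r: "r > 0" "cball x r \<subseteq> U" using open_contains_cball[THEN iffD1, OF assms(1)] x by blast
  have 0: "(LINT z|lborel. bump 2 ((z - x) /\<^sub>R s) * K z) = 0" if s: "s > 0" "s \<le> r" for s
  proof -
    have sU: "cball x s \<subseteq> U" using r s by (auto simp: subset_iff)
    have z: "bump 2 ((z - x) /\<^sub>R s) = 0" if "z \<notin> cball x s" for z by (rule bump_at_eq_0) (use s that in auto)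
    let ?p' = "\<lambda>z v. - (2 * real 2 / s\<^sup>2) * ((z - x) \<bullet> v) * bump (2 - 1) ((z - x) /\<^sub>R s)"
    have C: "C1_on UNIV (\<lambda>z. bump 2 ((z - x) /\<^sub>R s)) ?p'" by (rule C1_on_bump_at) simp
    have "(LINT z|lborel. bump 2 ((z - x) /\<^sub>R s) *\<^sub>R fa z b) = - (LINT z|lborel. ?p' z b *\<^sub>R f1 z a)"
      using integral_by_parts[OF C compact_cball sU assms(1) z fa, of b] by simp
    also have "(LINT z|lborel. ?p' z b *\<^sub>R f1 z a) = (LINT z|lborel. ?p' z a *\<^sub>R f1 z b)"
      by (rule integral_swap_derivatives_local[OF C compact_cball z f assms(1) sU])
    also have "- \<dots> = (LINT z|lborel. bump 2 ((z - x) /\<^sub>R s) *\<^sub>R fb z a)"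
      using integral_by_parts[OF C compact_cball sU assms(1) z fb, of a] by simp
    finally have e: "(LINT z|lborel. bump 2 ((z - x) /\<^sub>R s) *\<^sub>R fa z b) = (LINT z|lborel. bump 2 ((z - x) /\<^sub>R s) *\<^sub>R fb z a)" .
    have ia: "integrable lborel (\<lambda>z. bump 2 ((z - x) /\<^sub>R s) *\<^sub>R fa z b)"
      by (rule integrable_extend_zero[OF continuous_on_bump_at compact_cball sU assms(1) z C1_onD(2)[OF fa]])
    have ib: "integrable lborel (\<lambda>z. bump 2 ((z - x) /\<^sub>R s) *\<^sub>R fb z a)"
      by (rule integrable_extend_zero[OF continuous_on_bump_at compact_cball sU assms(1) z C1_onD(2)[OF fb]])
    have "(LINT z|lborel. bump 2 ((z - x) /\<^sub>R s) * K z)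
      = (LINT z|lborel. (bump 2 ((z - x) /\<^sub>R s) *\<^sub>R fa z b - bump 2 ((z - x) /\<^sub>R s) *\<^sub>R fb z a) \<bullet> \<sigma>)"
      unfolding K_def by (simp add: inner_diff_left right_diff_distrib)
    also have "\<dots> = 0"
      using integral_inner_left[OF Bochner_Integration.integrable_diff[OF ia ib], of \<sigma>]
        Bochner_Integration.integral_diff[OF ia ib] e by simp
    finally show ?thesis .
  qed
  have "K x = 0" by (rule zero_if_bump_averages_zero[OF assms(1) x cK r(1) 0])
  then show "fa x b \<bullet> \<sigma> = fb x a \<bullet> \<sigma>"
    by (simp add: K_def inner_diff_left)
qed

text \<open>
  For test functions with support in \<open>\<Omega>\<close> both sides equal \<open>\<nabla>\<^sub>1\<close> applied to \<open>- \<Delta>\<^sub>0 f\<close>; since \<open>f\<close> has only two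
  derivatives, one is left on the test function, where \<open>integral_swap_derivatives\<close> can exchange it. General
  test functions are cut off near the boundary.
\<close>

lemma compatible_zero_extension:
  fixes f :: "'v::euclidean_space \<times> 'v \<Rightarrow> 'b::euclidean_space"
  assumes g: "clifford_map g" and \<Omega>: "open \<Omega>" "bounded \<Omega>" "smooth_boundary \<Omega>"
    and f: "C1_on \<Omega> f f1" and f2: "\<And>a. a \<in> Basis \<Longrightarrow> C1_on \<Omega> (\<lambda>x. f1 x a) (f2 a)"
    and F0: "\<And>x v. x \<in> \<Omega> \<Longrightarrow> F0' x v = (\<Sum>b\<in>Basis. g b (f2 (b, 0) x v))" "\<And>x v. x \<notin> \<Omega> \<Longrightarrow> F0' x v = 0"
      "\<And>v. continuous_on UNIV (\<lambda>x. F0' x v)"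
    and F1: "\<And>x v. x \<in> \<Omega> \<Longrightarrow> F1' x v = (\<Sum>b\<in>Basis. g b (f2 (0, b) x v))" "\<And>x v. x \<notin> \<Omega> \<Longrightarrow> F1' x v = 0"
      "\<And>v. continuous_on UNIV (\<lambda>x. F1' x v)"
  shows "compatible g F0' F1'"
proof -
  have lin: "linear (g b)" for b by (rule clifford_map_linear[OF g])
  have B: "(b, 0) \<in> Basis" "(0, b) \<in> Basis" if "b \<in> Basis" for b :: 'v using that by (auto simp: Basis_prod_def)
  have interior: "(\<Sum>b\<in>Basis. \<Sum>c\<in>Basis. g b (g c (LINT x|lborel. \<Psi>' x (b, 0) *\<^sub>R F1' x (c, 0))))
     = (\<Sum>b\<in>Basis. \<Sum>c\<in>Basis. g b (g c (LINT x|lborel. \<Psi>' x (0, b) *\<^sub>R F0' x (c, 0))))"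
    if \<Psi>: "C1_on UNIV \<Psi> \<Psi>'" "compact T" "T \<subseteq> \<Omega>" "\<And>x. x \<notin> T \<Longrightarrow> \<Psi> x = (0::real)" for \<Psi> \<Psi>' T
  proof -
    have \<Psi>0: "\<Psi>' x v = 0" if "x \<notin> T" for x v
      by (rule C1_on_zero_off[OF \<Psi>(1) compact_imp_closed[OF \<Psi>(2)] _ that]) (rule \<Psi>(4))
    define J where "J a d k = (LINT x|lborel. \<Psi>' x a *\<^sub>R f2 d x k)" for a d k
    have iJ: "integrable lborel (\<lambda>x. \<Psi>' x a *\<^sub>R f2 d x k)" if "d \<in> Basis" for a d k
      by (rule integrable_extend_zero[OF C1_onD(2)[OF \<Psi>(1)] \<Psi>(2,3) \<Omega>(1) \<Psi>0 C1_onD(2)[OF f2[OF that]]])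
    have swap: "J a d k = J k d a" if "d \<in> Basis" for a d k
      unfolding J_def by (rule integral_swap_derivatives_local[OF \<Psi>(1,2,4) f2[OF that] \<Omega>(1) \<Psi>(3)])
    have comm: "J a d k = J a k d" if "d \<in> Basis" "k \<in> Basis" for a d k
    proof -
      have "\<Psi>' x a *\<^sub>R f2 d x k = \<Psi>' x a *\<^sub>R f2 k x d" for x
      proof (cases "x \<in> T")
        case True
        then have "x \<in> \<Omega>" using \<Psi>(3) by blast
        then show ?thesis using second_derivatives_commute[OF \<Omega>(1) f f2[OF that(1)] f2[OF that(2)]] by simp
      qed (simp add: \<Psi>0)
      then show ?thesis unfolding J_def by (simp only:)
    qed
    have F1J: "(LINT x|lborel. \<Psi>' x a *\<^sub>R F1' x k) = (\<Sum>e\<in>Basis. g e (J a (0, e) k))" for a k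
    proof -
      have "\<Psi>' x a *\<^sub>R F1' x k = \<Psi>' x a *\<^sub>R (\<Sum>e\<in>Basis. g e (f2 (0, e) x k))" for x
        using \<Psi>0[of x a] F1(1)[of x k] \<Psi>(3) by (cases "x \<in> T") auto
      then have e: "(LINT x|lborel. \<Psi>' x a *\<^sub>R F1' x k) = (LINT x|lborel. \<Psi>' x a *\<^sub>R (\<Sum>e\<in>Basis. g e (f2 (0, e) x k)))"
        by (simp only:)
      show ?thesis unfolding J_def e by (rule linear_sum_scaleR_integral[OF lin iJ[OF B(2)], symmetric])
    qed
    have F0J: "(LINT x|lborel. \<Psi>' x a *\<^sub>R F0' x k) = (\<Sum>e\<in>Basis. g e (J a (e, 0) k))" for a k
    proof -
      have "\<Psi>' x a *\<^sub>R F0' x k = \<Psi>' x a *\<^sub>R (\<Sum>e\<in>Basis. g e (f2 (e, 0) x k))" for x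
        using \<Psi>0[of x a] F0(1)[of x k] \<Psi>(3) by (cases "x \<in> T") auto
      then have e: "(LINT x|lborel. \<Psi>' x a *\<^sub>R F0' x k) = (LINT x|lborel. \<Psi>' x a *\<^sub>R (\<Sum>e\<in>Basis. g e (f2 (e, 0) x k)))"
        by (simp only:)
      show ?thesis unfolding J_def e by (rule linear_sum_scaleR_integral[OF lin iJ[OF B(1)], symmetric])
    qed
    define S where "S b c = (\<Sum>e\<in>Basis. g e (J (b, 0) (0, e) (c, 0)))" for b c
    have "(\<Sum>b\<in>Basis. \<Sum>c\<in>Basis. g b (g c (LINT x|lborel. \<Psi>' x (b, 0) *\<^sub>R F1' x (c, 0))))
        = (\<Sum>b\<in>Basis. \<Sum>c\<in>Basis. g b (g c (S b c)))"
      unfolding F1J S_def ..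
    also have "\<dots> = - (\<Sum>b\<in>Basis. S b b)"
    proof (rule clifford_symmetric_sum[OF g])
      fix b c :: 'v
      show "S b c = S c b" unfolding S_def
        by (intro sum.cong refl arg_cong[where f = "g _"] swap B(2))
    qed
    also have "(\<Sum>b\<in>Basis. S b b) = (\<Sum>b\<in>Basis. \<Sum>e\<in>Basis. g e (J (0, e) (b, 0) (b, 0)))"
    proof -
      have "J (b, 0) (0, e) (b, 0) = J (0, e) (b, 0) (b, 0)" if be: "b \<in> Basis" "e \<in> Basis" for b e
        using comm[OF B(2)[OF be(2)] B(1)[OF be(1)], of "(b, 0)"] swap[OF B(1)[OF be(1)], of "(b, 0)" "(0, e)"] by simp
      then show ?thesis unfolding S_def by simp
    qed
    also have "\<dots> = (\<Sum>e\<in>Basis. \<Sum>b\<in>Basis. g e (J (0, e) (b, 0) (b, 0)))" by (rule sum.swap)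
    also have "- \<dots> = (\<Sum>e\<in>Basis. g e (- (\<Sum>b\<in>Basis. J (0, e) (b, 0) (b, 0))))"
      by (simp add: sum_negf linear_neg[OF lin] linear_sum[OF lin])
    also have "\<dots> = (\<Sum>e\<in>Basis. g e (\<Sum>c\<in>Basis. \<Sum>b\<in>Basis. g c (g b (J (0, e) (b, 0) (c, 0)))))"
    proof -
      have "(\<Sum>c\<in>Basis. \<Sum>b\<in>Basis. g c (g b (J a (b, 0) (c, 0)))) = - (\<Sum>b\<in>Basis. J a (b, 0) (b, 0))" for a
        by (rule clifford_symmetric_sum[OF g]) (intro comm B)
      then show ?thesis by (simp only:)
    qed
    also have "\<dots> = (\<Sum>e\<in>Basis. \<Sum>c\<in>Basis. g e (g c (LINT x|lborel. \<Psi>' x (0, e) *\<^sub>R F0' x (c, 0))))"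
      unfolding F0J by (simp only: linear_sum[OF lin])
    finally show ?thesis .
  qed
  obtain \<theta> :: "nat \<Rightarrow> 'v \<times> 'v \<Rightarrow> real" and \<theta>' T where \<theta>: "\<And>m. C1_on UNIV (\<theta> m) (\<theta>' m)" "\<And>m. compact (T m)" "\<And>m. T m \<subseteq> \<Omega>"
    "\<And>m x. x \<notin> T m \<Longrightarrow> \<theta> m x = 0"
    "\<And>(A :: 'v \<times> 'v \<Rightarrow> 'b) \<Phi> \<Phi>' v. continuous_on UNIV A \<Longrightarrow> (\<And>x. x \<notin> \<Omega> \<Longrightarrow> A x = 0) \<Longrightarrow> C1_on UNIV \<Phi> \<Phi>' \<Longrightarrow>
      (\<lambda>m. LINT x|lborel. (\<theta> m x * \<Phi>' x v + \<theta>' m x v * \<Phi> x) *\<^sub>R A x) \<longlonglongrightarrow> (LINT x|lborel. \<Phi>' x v *\<^sub>R A x)"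
    using boundary_cutoffs[OF \<Omega>, where 'b = 'b] by blast
  have glim: "(\<lambda>n. g b (X n)) \<longlonglongrightarrow> g b L" if X: "X \<longlonglongrightarrow> L" for b L and X :: "nat \<Rightarrow> 'b"
  proof -
    have "bounded_linear (g b)" using lin by (simp add: linear_conv_bounded_linear)
    from bounded_linear.tendsto[OF this X] show ?thesis .
  qed
  show ?thesis unfolding compatible_def
  proof (intro allI impI)
    fix \<Phi> :: "'v \<times> 'v \<Rightarrow> real" and \<Phi>' S assume \<Phi>: "C1_on UNIV \<Phi> \<Phi>'"
    define \<Psi>' where "\<Psi>' m x v = \<theta> m x * \<Phi>' x v + \<theta>' m x v * \<Phi> x" for m x v
    have "C1_on UNIV (\<lambda>x. \<theta> m x * \<Phi> x) (\<Psi>' m)" for m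
      using C1_on_scaleR[OF \<theta>(1) \<Phi>, of m] unfolding \<Psi>'_def by simp
    note C\<Psi> = this
    have eq: "(\<Sum>b\<in>Basis. \<Sum>c\<in>Basis. g b (g c (LINT x|lborel. \<Psi>' m x (b, 0) *\<^sub>R F1' x (c, 0))))
       = (\<Sum>b\<in>Basis. \<Sum>c\<in>Basis. g b (g c (LINT x|lborel. \<Psi>' m x (0, b) *\<^sub>R F0' x (c, 0))))" for m
      by (rule interior[OF C\<Psi> \<theta>(2)[of m] \<theta>(3)]) (simp add: \<theta>(4))
    have "(\<lambda>m. \<Sum>b\<in>Basis. \<Sum>c\<in>Basis. g b (g c (LINT x|lborel. \<Psi>' m x (b, 0) *\<^sub>R F1' x (c, 0))))
      \<longlonglongrightarrow> (\<Sum>b\<in>Basis. \<Sum>c\<in>Basis. g b (g c (LINT x|lborel. \<Phi>' x (b, 0) *\<^sub>R F1' x (c, 0))))"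
      unfolding \<Psi>'_def by (intro tendsto_sum glim \<theta>(5) F1(2,3) \<Phi>)
    moreover have "(\<lambda>m. \<Sum>b\<in>Basis. \<Sum>c\<in>Basis. g b (g c (LINT x|lborel. \<Psi>' m x (0, b) *\<^sub>R F0' x (c, 0))))
      \<longlonglongrightarrow> (\<Sum>b\<in>Basis. \<Sum>c\<in>Basis. g b (g c (LINT x|lborel. \<Phi>' x (0, b) *\<^sub>R F0' x (c, 0))))"
      unfolding \<Psi>'_def by (intro tendsto_sum glim \<theta>(5) F0(2,3) \<Phi>)
    ultimately show "(\<Sum>b\<in>Basis. \<Sum>c\<in>Basis. g b (g c (LINT x|lborel. \<Phi>' x (b, 0) *\<^sub>R F1' x (c, 0))))
     = (\<Sum>b\<in>Basis. \<Sum>c\<in>Basis. g b (g c (LINT x|lborel. \<Phi>' x (0, b) *\<^sub>R F0' x (c, 0))))"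
      unfolding eq by (rule LIMSEQ_unique)
  qed
qed

section \<open>The Hartogs phenomenon\<close>

lemma smooth_frontier_subset_exterior:
  fixes \<Omega> :: "'a::euclidean_space set"
  assumes "open \<Omega>" "smooth_boundary \<Omega>" "p \<in> frontier \<Omega>"
  shows "p \<in> closure (- closure \<Omega>)"
proof -
  obtain V \<rho> where V: "local_defining_function \<Omega> p V \<rho>" using assms(2,3) unfolding smooth_boundary_def by blast
  obtain r c M v where R: "r > 0" "c > 0" "M > 0" "norm v = 1" "ball p r \<subseteq> V"
    "C1_on V \<rho> (\<lambda>x. frechet_derivative \<rho> (at x))"
    "\<And>x. x \<in> ball p r \<Longrightarrow> frechet_derivative \<rho> (at x) v \<ge> c"
    "\<And>x w. x \<in> ball p r \<Longrightarrow> \<bar>frechet_derivative \<rho> (at x) w\<bar> \<le> M * norm w"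
    using local_defining_function_direction[OF V] by metis
  have \<Omega>V: "x \<in> \<Omega> \<longleftrightarrow> \<rho> x < 0" if "x \<in> V" for x using V that unfolding local_defining_function_def by blast
  have pV: "p \<in> V" "open V" using V unfolding local_defining_function_def by auto
  have "p \<notin> \<Omega>" using assms(1,3) by (auto simp: frontier_def interior_open)
  then have \<rho>p: "\<rho> p \<ge> 0" using \<Omega>V[OF pV(1)] by simp
  show ?thesis unfolding closure_approachable
  proof (intro allI impI)
    fix e :: real assume e: "e > 0"
    define s where "s = min e r / 2"
    have s: "s > 0" "s < e" "s < r" unfolding s_def using e R(1) by auto
    define y where "y = p + s *\<^sub>R v"
    have d: "dist y p = s" unfolding y_def using R(4) s by (simp add: dist_norm)
    then have yB: "y \<in> ball p r" using s by (simp add: dist_commute)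
    have "\<rho> (p + s *\<^sub>R v) - \<rho> p \<ge> c * s"
      by (rule strict_increase_on_segment[OF C1_on_subset[OF R(6,5)] convex_ball R(7)])
        (use yB R(1) s in \<open>auto simp: y_def\<close>)
    moreover have "c * s > 0" using R(2) s by simp
    ultimately have "\<rho> y > 0" unfolding y_def using \<rho>p by linarith
    have o: "open (V \<inter> \<rho> -` {0<..})"
      by (rule continuous_open_preimage[OF C1_onD(4)[OF R(6)] pV(2)]) simp
    have "(V \<inter> \<rho> -` {0<..}) \<inter> \<Omega> = {}" using \<Omega>V by auto
    then have "(V \<inter> \<rho> -` {0<..}) \<inter> closure \<Omega> = {}" using open_Int_closure_eq_empty[OF o] by blast
    moreover have "y \<in> V \<inter> \<rho> -` {0<..}" using \<open>\<rho> y > 0\<close> yB R(5) by auto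
    ultimately have "y \<notin> closure \<Omega>" by blast
    then show "\<exists>y\<in>- closure \<Omega>. dist y p < e" using d s by (intro bexI[of _ y]) auto
  qed
qed

lemma dirac_unique_continuation:
  fixes u :: "'v::euclidean_space \<times> 'v \<Rightarrow> 'b::euclidean_space"
  assumes "clifford_map g" "C1_on W u u'" "open W" "connected W"
    "\<And>x. x \<in> W \<Longrightarrow> (\<Sum>c\<in>Basis. g c (u' x (c, 0))) = 0" "\<And>x. x \<in> W \<Longrightarrow> (\<Sum>c\<in>Basis. g c (u' x (0, c))) = 0"
    "open V" "V \<noteq> {}" "V \<subseteq> W" "\<And>x. x \<in> V \<Longrightarrow> u x = 0" "x \<in> W"
  shows "u x = 0"
proof (rule euclidean_eqI)
  fix s :: 'b
  show "u x \<bullet> s = 0 \<bullet> s"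
    using mean_value_on_unique_continuation[OF assms(3,4) monogenic_mean_value[OF assms(1,2,3,5,6)] assms(7,8,9) _ assms(11), of s] assms(10)
    by simp
qed

text \<open>
  The solution \<open>u\<close> of the equation with the right-hand side extended by zero vanishes far out in the
  direction of the second variable, which is part of the connected exterior of \<open>\<Omega>\<close>.
\<close>

lemma hartogs_correction:
  fixes f :: "'v::euclidean_space \<times> 'v \<Rightarrow> 'b::euclidean_space"
    and T1 :: "'b \<Rightarrow> 'c::euclidean_space" and T2 :: "'b \<Rightarrow> 'd::euclidean_space"
  assumes g: "clifford_map g" and \<Omega>: "open \<Omega>" "bounded \<Omega>" "smooth_boundary \<Omega>" "connected (- closure \<Omega>)"
    and f: "C1_on \<Omega> f f1" and f2: "\<And>a. a \<in> Basis \<Longrightarrow> C1_on \<Omega> (\<lambda>x. f1 x a) (f2 a)"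
    and bd0: "\<And>p. p \<in> frontier \<Omega> \<Longrightarrow> ((\<lambda>x. \<Sum>b\<in>Basis. g b (f1 x (b, 0))) \<longlongrightarrow> 0) (at p within \<Omega>)"
      "\<And>p a. p \<in> frontier \<Omega> \<Longrightarrow> a \<in> Basis \<Longrightarrow> ((\<lambda>x. \<Sum>b\<in>Basis. g b (f2 (b, 0) x a)) \<longlongrightarrow> 0) (at p within \<Omega>)"
    and bd1: "\<And>p. p \<in> frontier \<Omega> \<Longrightarrow> ((\<lambda>x. \<Sum>b\<in>Basis. g b (f1 x (0, b))) \<longlongrightarrow> 0) (at p within \<Omega>)"
      "\<And>p a. p \<in> frontier \<Omega> \<Longrightarrow> a \<in> Basis \<Longrightarrow> ((\<lambda>x. \<Sum>b\<in>Basis. g b (f2 (0, b) x a)) \<longlongrightarrow> 0) (at p within \<Omega>)"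
    and T: "linear T1" "linear T2" "\<And>x. x \<in> \<Omega> \<Longrightarrow> T1 (\<Sum>b\<in>Basis. g b (f1 x (b, 0))) = 0"
      "\<And>b s. b \<in> Basis \<Longrightarrow> T1 s = 0 \<Longrightarrow> T2 (g b s) = 0"
  obtains u u' where "C1_on UNIV u u'" "\<And>x. T2 (u x) = 0" "\<And>x. x \<in> frontier \<Omega> \<Longrightarrow> u x = 0"
    "\<And>x. x \<in> \<Omega> \<Longrightarrow> (\<Sum>b\<in>Basis. g b (u' x (b, 0))) = (\<Sum>b\<in>Basis. g b (f1 x (b, 0)))"
    "\<And>x. x \<in> \<Omega> \<Longrightarrow> (\<Sum>b\<in>Basis. g b (u' x (0, b))) = (\<Sum>b\<in>Basis. g b (f1 x (0, b)))"
proof -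
  have lin: "linear (g b)" for b by (rule clifford_map_linear[OF g])
  have B: "(b, 0) \<in> Basis" "(0, b) \<in> Basis" if "b \<in> Basis" for b :: 'v using that by (auto simp: Basis_prod_def)
  define F0 where "F0 x = (if x \<in> \<Omega> then \<Sum>b\<in>Basis. g b (f1 x (b, 0)) else 0)" for x
  define F0' where "F0' x v = (if x \<in> \<Omega> then \<Sum>b\<in>Basis. g b (f2 (b, 0) x v) else 0)" for x v
  define F1 where "F1 x = (if x \<in> \<Omega> then \<Sum>b\<in>Basis. g b (f1 x (0, b)) else 0)" for x
  define F1' where "F1' x v = (if x \<in> \<Omega> then \<Sum>b\<in>Basis. g b (f2 (0, b) x v) else 0)" for x v
  have C0: "C1_on UNIV F0 F0'"
    unfolding F0_def[abs_def] F0'_def[abs_def]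
    by (rule C1_on_zero_extension[OF \<Omega>(1) C1_on_sum[OF C1_on_linear_image[OF f2[OF B(1)] lin]] bd0])
  have C1: "C1_on UNIV F1 F1'"
    unfolding F1_def[abs_def] F1'_def[abs_def]
    by (rule C1_on_zero_extension[OF \<Omega>(1) C1_on_sum[OF C1_on_linear_image[OF f2[OF B(2)] lin]] bd1])
  have K: "compact (closure \<Omega>)" using \<Omega>(2) by simp
  have z: "F0 x = 0" "F1 x = 0" if "x \<notin> closure \<Omega>" for x
    using that subsetD[OF closure_subset[of \<Omega>], of x] by (auto simp: F0_def F1_def)
  have comp: "compatible g F0' F1'"
    by (rule compatible_zero_extension[OF g \<Omega>(1-3) f f2 _ _ C1_onD(2)[OF C0] _ _ C1_onD(2)[OF C1]])
      (simp_all add: F0'_def F1'_def)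
  have T0: "T1 (F0 x) = 0" for x using T(3)[of x] linear_0[OF T(1)] by (simp add: F0_def)
  obtain u u' R where u: "C1_on UNIV u u'" "\<And>x. (\<Sum>c\<in>Basis. g c (u' x (c, 0))) = F0 x"
    "\<And>x. (\<Sum>c\<in>Basis. g c (u' x (0, c))) = F1 x" "\<And>x. norm (snd x) > R \<Longrightarrow> u x = 0" "\<And>x. T2 (u x) = 0"
    using dirac_solution[OF g C0 C1 K z comp T(1,2) T0 T(4)] by blast
  have ext: "u x = 0" if x: "x \<in> - closure \<Omega>" for x
  proof -
    obtain r where r: "r > 0" "\<And>x. x \<in> closure \<Omega> \<Longrightarrow> norm x \<le> r" using compact_norm_bound[OF K] by blast
    let ?V = "{x :: 'v \<times> 'v. norm (snd x) > max R r}"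
    have Vo: "open ?V" by (intro open_Collect_less continuous_intros)
    obtain e :: 'v where e: "e \<in> Basis" using nonempty_Basis by blast
    have "(0, (\<bar>R\<bar> + r + 1) *\<^sub>R e) \<in> ?V" using e r(1) by auto
    then have Vn: "?V \<noteq> {}" by blast
    have Vs: "?V \<subseteq> - closure \<Omega>"
    proof
      fix y :: "'v \<times> 'v" assume "y \<in> ?V"
      then have "norm y > r" using norm_snd_le[of "snd y" "fst y"] by simp
      then show "y \<in> - closure \<Omega>" using r(2)[of y] by auto
    qed
    have W: "open (- closure \<Omega>)" by (simp add: open_Compl)
    show ?thesis
      by (rule dirac_unique_continuation[OF g C1_on_subset[OF u(1) subset_UNIV] W \<Omega>(4) _ _ Vo Vn Vs _ x])
        (use u z in auto)
  qed
  show ?thesis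
  proof (rule that[OF u(1) u(5)])
    show "u p = 0" if "p \<in> frontier \<Omega>" for p
    proof (rule continuous_constant_on_closure[of "- closure \<Omega>" u 0 p])
      show "continuous_on (closure (- closure \<Omega>)) u" using C1_onD(4)[OF u(1)] continuous_on_subset by blast
      show "p \<in> closure (- closure \<Omega>)" by (rule smooth_frontier_subset_exterior[OF \<Omega>(1,3) that])
    qed (use ext in auto)
  qed (simp_all add: u F0_def F1_def)
qed

section \<open>The Dirac matrices\<close>

lemma Abs_multiindex_eq_iff:
  assumes "A \<subseteq> {1..CARD('n::finite) div 2}" "B \<subseteq> {1..CARD('n) div 2}"
  shows "(Abs_multiindex A :: 'n multiindex) = Abs_multiindex B \<longleftrightarrow> A = B"
  using assms by (intro Abs_multiindex_inject) auto

lemma Rep_multiindex_subset: "Rep_multiindex (\<alpha> :: 'n::finite multiindex) \<subseteq> {1..CARD('n) div 2}"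
  using Rep_multiindex by blast

lemma Rep_Abs_multiindex: "A \<subseteq> {1..CARD('n::finite) div 2} \<Longrightarrow> Rep_multiindex (Abs_multiindex A :: 'n multiindex) = A"
  by (rule Abs_multiindex_inverse) simp

lemma basis_spinor_component:
  assumes "A \<subseteq> {1..CARD('n::finite) div 2}" "B \<subseteq> {1..CARD('n) div 2}"
  shows "(basis_spinor B :: 'n spinor) $ Abs_multiindex A = (if B = A then 1 else 0)"
  using Abs_multiindex_eq_iff[OF assms] by (auto simp: basis_spinor_def axis_def)

lemma linear_ext_component:
  fixes v :: "'n::finite spinor"
  assumes A: "A \<subseteq> {1..CARD('n) div 2}"
    and \<phi>: "\<And>\<alpha>. \<alpha> \<subseteq> {1..CARD('n) div 2} \<Longrightarrow> \<not> P \<alpha> \<Longrightarrow> \<phi> \<alpha> \<subseteq> {1..CARD('n) div 2}"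
  shows "linear_ext (\<lambda>\<alpha>. if P \<alpha> then 0 else c \<alpha> *s basis_spinor (\<phi> \<alpha>)) v $ Abs_multiindex A
    = (\<Sum>\<alpha>\<in>UNIV. if \<not> P (Rep_multiindex \<alpha>) \<and> \<phi> (Rep_multiindex \<alpha>) = A then v $ \<alpha> * c (Rep_multiindex \<alpha>) else 0)"
  unfolding linear_ext_def sum_component
proof (rule sum.cong[OF refl])
  fix \<alpha> :: "'n multiindex"
  show "(v $ \<alpha> *s (if P (Rep_multiindex \<alpha>) then 0 else c (Rep_multiindex \<alpha>) *s (basis_spinor (\<phi> (Rep_multiindex \<alpha>)) :: 'n spinor))) $ Abs_multiindex A
    = (if \<not> P (Rep_multiindex \<alpha>) \<and> \<phi> (Rep_multiindex \<alpha>) = A then v $ \<alpha> * c (Rep_multiindex \<alpha>) else 0)"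
    using basis_spinor_component[OF A \<phi>[OF Rep_multiindex_subset, of \<alpha>]] by auto
qed

lemma linear_ext_single:
  fixes v :: "'n::finite spinor"
  assumes "A \<subseteq> {1..CARD('n) div 2}" "B \<subseteq> {1..CARD('n) div 2}"
    and "\<And>\<alpha>. \<alpha> \<subseteq> {1..CARD('n) div 2} \<Longrightarrow> \<not> P \<alpha> \<Longrightarrow> \<phi> \<alpha> \<subseteq> {1..CARD('n) div 2}"
    and B: "\<And>\<alpha>. \<alpha> \<subseteq> {1..CARD('n) div 2} \<Longrightarrow> \<not> P \<alpha> \<and> \<phi> \<alpha> = A \<longleftrightarrow> \<alpha> = B"
  shows "linear_ext (\<lambda>\<alpha>. if P \<alpha> then 0 else c \<alpha> *s basis_spinor (\<phi> \<alpha>)) v $ Abs_multiindex A = c B * v $ Abs_multiindex B"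
proof -
  have "\<not> P (Rep_multiindex \<alpha>) \<and> \<phi> (Rep_multiindex \<alpha>) = A \<longleftrightarrow> \<alpha> = Abs_multiindex B" for \<alpha> :: "'n multiindex"
    unfolding B[OF Rep_multiindex_subset]
    using Rep_Abs_multiindex[OF assms(2)] Rep_multiindex_inverse[of \<alpha>] by auto
  then show ?thesis
    using linear_ext_component[OF assms(1), of P \<phi> c v] assms(3) Rep_Abs_multiindex[OF assms(2)]
    by (simp add: if_distrib cong: if_cong)
qed

lemma linear_ext_none:
  fixes v :: "'n::finite spinor"
  assumes "A \<subseteq> {1..CARD('n) div 2}"
    and "\<And>\<alpha>. \<alpha> \<subseteq> {1..CARD('n) div 2} \<Longrightarrow> \<not> P \<alpha> \<Longrightarrow> \<phi> \<alpha> \<subseteq> {1..CARD('n) div 2}"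
    and B: "\<And>\<alpha>. \<alpha> \<subseteq> {1..CARD('n) div 2} \<Longrightarrow> \<not> (\<not> P \<alpha> \<and> \<phi> \<alpha> = A)"
  shows "linear_ext (\<lambda>\<alpha>. if P \<alpha> then 0 else c \<alpha> *s basis_spinor (\<phi> \<alpha>)) v $ Abs_multiindex A = 0"
  using linear_ext_component[OF assms(1), of P \<phi> c v] assms(2) B[OF Rep_multiindex_subset] by simp

definition toggle :: "nat \<Rightarrow> nat set \<Rightarrow> nat set" where
  "toggle j A = (if j \<in> A then A - {j} else insert j A)"

definition wsign :: "nat \<Rightarrow> nat set \<Rightarrow> complex" where
  "wsign j A = (- 1) ^ card {i \<in> A. i < j}"

lemma wedge_component:
  fixes v :: "'n::finite spinor"
  assumes A: "A \<subseteq> {1..CARD('n) div 2}" and j: "j \<in> {1..CARD('n) div 2}"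
  shows "wedge j v $ Abs_multiindex A = (if j \<in> A then wsign j A * v $ Abs_multiindex (toggle j A) else 0)"
proof (cases "j \<in> A")
  case True
  have "wedge j v $ Abs_multiindex A = (- 1) ^ card {i \<in> A - {j}. i < j} * v $ Abs_multiindex (A - {j})"
    unfolding wedge_def by (rule linear_ext_single) (use A j True in auto)
  moreover have "{i \<in> A - {j}. i < j} = {i \<in> A. i < j}" by auto
  ultimately show ?thesis using True by (simp add: toggle_def wsign_def)
next
  case False
  have "wedge j v $ Abs_multiindex A = 0"
    unfolding wedge_def by (rule linear_ext_none) (use A j False in auto)
  then show ?thesis using False by simp
qed

lemma contract_component:
  fixes v :: "'n::finite spinor"
  assumes A: "A \<subseteq> {1..CARD('n) div 2}" and j: "j \<in> {1..CARD('n) div 2}"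
  shows "contract j v $ Abs_multiindex A = (if j \<in> A then 0 else wsign j A * v $ Abs_multiindex (toggle j A))"
proof (cases "j \<in> A")
  case True
  have "contract j v $ Abs_multiindex A = 0"
    unfolding contract_def by (rule linear_ext_none) (use A j True in auto)
  then show ?thesis using True by simp
next
  case False
  have "contract j v $ Abs_multiindex A = (- 1) ^ (card {i \<in> insert j A. i \<le> j} + 1) * v $ Abs_multiindex (insert j A)"
    unfolding contract_def by (rule linear_ext_single) (use A j False in auto)
  moreover have "{i \<in> insert j A. i \<le> j} = insert j {i \<in> A. i < j}" using False by (auto simp: le_less)
  then have "card {i \<in> insert j A. i \<le> j} = Suc (card {i \<in> A. i < j})"
    using finite_subset[OF A] by (simp add: card_insert_if)
  ultimately show ?thesis using False by (simp add: toggle_def wsign_def)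
qed

text \<open>
  Each Dirac matrix is a monomial matrix: its row \<open>A\<close> has the single entry \<open>dirac_sign\<close>, in the column
  \<open>dirac_toggle\<close>. The Clifford relations thus reduce to a rule of signs. The matrices \<open>\<gamma>\<^sub>2\<^sub>j\<^sub>-\<^sub>1\<close> and \<open>\<gamma>\<^sub>2\<^sub>j\<close> both
  toggle the membership of \<open>j = (k + 1) div 2\<close>.
\<close>

definition dirac_sign :: "nat \<Rightarrow> nat \<Rightarrow> nat set \<Rightarrow> complex" where
  "dirac_sign n k A = (if odd n \<and> k = n then - \<i> * (- 1) ^ card A
     else if odd k then (if (k + 1) div 2 \<in> A then 1 else - 1) * wsign ((k + 1) div 2) A
     else - \<i> * wsign ((k + 1) div 2) A)"

definition dirac_toggle :: "nat \<Rightarrow> nat \<Rightarrow> nat set \<Rightarrow> nat set" where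
  "dirac_toggle n k A = (if odd n \<and> k = n then A else toggle ((k + 1) div 2) A)"

lemma dirac_index: "(k::nat) \<in> {1..n} \<Longrightarrow> \<not> (odd n \<and> k = n) \<Longrightarrow> (k + 1) div 2 \<in> {1..n div 2}"
  by (auto elim!: oddE evenE)

lemma toggle_subset: "A \<subseteq> M \<Longrightarrow> j \<in> M \<Longrightarrow> toggle j A \<subseteq> M"
  by (auto simp: toggle_def)

lemma dirac_toggle_subset: "A \<subseteq> {1..n div 2} \<Longrightarrow> k \<in> {1..n} \<Longrightarrow> dirac_toggle n k A \<subseteq> {1..n div 2}"
  unfolding dirac_toggle_def using toggle_subset[OF _ dirac_index] by auto

lemma dirac_matrix_component:
  fixes v :: "'n::finite spinor"
  assumes A: "A \<subseteq> {1..CARD('n) div 2}" and k: "k \<in> {1..CARD('n)}"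
  shows "dirac_matrix k v $ Abs_multiindex A = dirac_sign CARD('n) k A * v $ Abs_multiindex (dirac_toggle CARD('n) k A)"
proof (cases "odd CARD('n) \<and> k = CARD('n)")
  case True
  have "linear_ext (\<lambda>\<alpha>. if False then 0 else (- \<i> * (- 1) ^ card \<alpha>) *s basis_spinor \<alpha>) v $ Abs_multiindex A
    = (- \<i> * (- 1) ^ card A) * v $ Abs_multiindex A"
    by (rule linear_ext_single) (use A in auto)
  then show ?thesis using True by (simp add: dirac_matrix_def dirac_sign_def dirac_toggle_def)
next
  case False
  note j = dirac_index[OF k False]
  have "k div 2 = (k + 1) div 2" if "even k" using that by simp
  then show ?thesis
    using False wedge_component[OF A j, of v] contract_component[OF A j, of v]
    by (auto simp: dirac_matrix_def dirac_sign_def dirac_toggle_def)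
qed

lemma spinor_eqI:
  fixes v w :: "'n::finite spinor"
  assumes "\<And>A. A \<subseteq> {1..CARD('n) div 2} \<Longrightarrow> v $ Abs_multiindex A = w $ Abs_multiindex A"
  shows "v = w"
  unfolding vec_eq_iff using assms[OF Rep_multiindex_subset] by (simp add: Rep_multiindex_inverse)

lemma linear_dirac_matrix:
  assumes k: "k \<in> {1..CARD('n::finite)}"
  shows "linear (dirac_matrix k :: 'n spinor \<Rightarrow> 'n spinor)"
  by (rule linearI; rule spinor_eqI)
    (simp_all add: dirac_matrix_component[OF _ k] distrib_left)

lemma toggle_toggle: "toggle j (toggle j A) = A" "toggle j (toggle l A) = toggle l (toggle j A)"
  by (auto simp: toggle_def)

lemma mem_toggle: "j \<in> toggle l A \<longleftrightarrow> (if j = l then j \<notin> A else j \<in> A)"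
  by (auto simp: toggle_def)

lemma card_toggle:
  assumes "finite A"
  shows "(- 1 :: complex) ^ card (toggle j A) = - ((- 1) ^ card A)"
proof (cases "j \<in> A")
  case True
  have "(- 1 :: complex) ^ card A = - ((- 1) ^ card (A - {j}))"
    unfolding card.remove[OF assms True] by (simp only: power_Suc mult_minus_left mult_1_left)
  then show ?thesis using True by (simp only: toggle_def if_True minus_minus)
qed (use assms in \<open>simp add: toggle_def\<close>)

lemma wsign_toggle:
  assumes "finite A"
  shows "wsign j (toggle l A) = (if l < j then - wsign j A else wsign j A)"
proof (cases "l < j")
  case True
  then have "{i \<in> toggle l A. i < j} = toggle l {i \<in> A. i < j}" by (auto simp: toggle_def)
  then show ?thesis using True assms by (simp add: wsign_def card_toggle)
next
  case False
  then have "{i \<in> toggle l A. i < j} = {i \<in> A. i < j}" by (auto simp: toggle_def)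
  then show ?thesis using False by (simp add: wsign_def)
qed

lemma wsign_square: "wsign j A * wsign j A = 1"
  by (simp add: wsign_def power_mult_distrib[symmetric])

lemma dirac_square_sign:
  assumes "finite A"
  shows "dirac_sign n k A * dirac_sign n k (dirac_toggle n k A) = - 1"
    "dirac_toggle n k (dirac_toggle n k A) = A"
proof -
  have p: "(- 1 :: complex) ^ c * (- 1) ^ c = 1" for c by (simp add: power_mult_distrib[symmetric])
  show "dirac_sign n k A * dirac_sign n k (dirac_toggle n k A) = - 1"
  proof -
    have "(- \<i> * x) * (- \<i> * x) = (\<i> * \<i>) * (x * x)" for x by (simp only: mult_minus_left mult_minus_right minus_minus mult_ac)
    then have i: "(- \<i> * x) * (- \<i> * x) = - 1" if "x * x = 1" for x using that by simp
    let ?j = "(k + 1) div 2"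
    have w: "wsign ?j (toggle ?j A) = wsign ?j A" by (simp add: wsign_toggle[OF assms])
    consider "odd n \<and> k = n" | "\<not> (odd n \<and> k = n)" "even k" | "\<not> (odd n \<and> k = n)" "odd k" by blast
    then show ?thesis
    proof cases
      case 1
      then show ?thesis unfolding dirac_sign_def dirac_toggle_def using i[OF p[of "card A"]] by (simp only: if_True simp_thms)
    next
      case 2
      then show ?thesis unfolding dirac_sign_def dirac_toggle_def using i[OF wsign_square[of ?j A]] by (simp only: if_False w simp_thms)
    next
      case 3
      have "dirac_sign n k A * dirac_sign n k (dirac_toggle n k A) = - (wsign ?j A * wsign ?j A)"
        using 3 unfolding dirac_sign_def dirac_toggle_def by (simp only: if_False if_True w simp_thms mem_toggle) simp
      then show ?thesis by (simp only: wsign_square)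
    qed
  qed
  show "dirac_toggle n k (dirac_toggle n k A) = A"
    by (simp add: dirac_toggle_def toggle_toggle)
qed

text \<open>
  The factor of \<open>dirac_sign\<close> that depends on the membership of the toggled index only. For \<open>k < l\<close> exactly
  one sign changes when the two toggles are exchanged: that of \<open>plain_sign k\<close> if both toggle the same index,
  and otherwise that of the \<open>wsign\<close> of the larger index, which counts the smaller one.
\<close>

definition plain_sign :: "nat \<Rightarrow> nat set \<Rightarrow> complex" where
  "plain_sign k A = (if odd k then (if (k + 1) div 2 \<in> A then 1 else - 1) else - \<i>)"

lemma dirac_sign_plain:
  assumes "\<not> (odd n \<and> k = n)"
  shows "dirac_sign n k A = plain_sign k A * wsign ((k + 1) div 2) A"
    "dirac_toggle n k A = toggle ((k + 1) div 2) A"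
  using assms by (auto simp: dirac_sign_def dirac_toggle_def plain_sign_def)

lemma dirac_anticommute_sign:
  assumes "finite A" "k \<noteq> l" "k \<in> {1..n}" "l \<in> {1..n}"
  shows "dirac_sign n k A * dirac_sign n l (dirac_toggle n k A) = - (dirac_sign n l A * dirac_sign n k (dirac_toggle n l A))"
    "dirac_toggle n k (dirac_toggle n l A) = dirac_toggle n l (dirac_toggle n k A)"
proof -
  show "dirac_toggle n k (dirac_toggle n l A) = dirac_toggle n l (dirac_toggle n k A)"
    by (simp add: dirac_toggle_def toggle_toggle(2))
  have *: "dirac_sign n k A * dirac_sign n l (dirac_toggle n k A) = - (dirac_sign n l A * dirac_sign n k (dirac_toggle n l A))"
    if kl: "k < l" "k \<in> {1..n}" "l \<in> {1..n}" for k l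
  proof -
    let ?i = "(k + 1) div 2" and ?j = "(l + 1) div 2"
    have k: "\<not> (odd n \<and> k = n)" using kl by auto
    show ?thesis
    proof (cases "odd n \<and> l = n")
      case True
      then have l: "dirac_sign n l B = - \<i> * (- 1) ^ card B" "dirac_toggle n l B = B" for B
        by (simp_all add: dirac_sign_def dirac_toggle_def)
      show ?thesis unfolding dirac_sign_plain[OF k] l card_toggle[OF assms(1)] by (simp add: mult_ac)
    next
      case l: False
      note e = dirac_sign_plain[OF k] dirac_sign_plain[OF l]
      show ?thesis
      proof (cases "?i = ?j")
        case True
        then have "odd k" "even l" using kl by presburger+
        then have p: "plain_sign l B = - \<i>" "plain_sign k (toggle ?j B) = - plain_sign k B" for B
          using True by (simp_all add: plain_sign_def mem_toggle)
        have "wsign ?j (toggle ?j A) = wsign ?j A" by (simp add: wsign_toggle[OF assms(1)])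
        then show ?thesis unfolding e True p by (simp add: mult_ac)
      next
        case False
        then have ij: "?i < ?j" using kl div_le_mono[of "k + 1" "l + 1" 2] by simp
        then have "wsign ?j (toggle ?i A) = - wsign ?j A" "wsign ?i (toggle ?j A) = wsign ?i A"
          by (simp_all add: wsign_toggle[OF assms(1)])
        moreover have "plain_sign l (toggle ?i A) = plain_sign l A" "plain_sign k (toggle ?j A) = plain_sign k A"
        proof -
          have "?j \<in> toggle ?i A \<longleftrightarrow> ?j \<in> A" "?i \<in> toggle ?j A \<longleftrightarrow> ?i \<in> A"
            unfolding mem_toggle using ij by auto
          then show "plain_sign l (toggle ?i A) = plain_sign l A" "plain_sign k (toggle ?j A) = plain_sign k A"
            unfolding plain_sign_def by (simp_all only:)
        qed
        ultimately show ?thesis unfolding e by (simp add: mult_ac)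
      qed
    qed
  qed
  show "dirac_sign n k A * dirac_sign n l (dirac_toggle n k A) = - (dirac_sign n l A * dirac_sign n k (dirac_toggle n l A))"
    using *[of k l] *[of l k] assms(2-4) by (cases k l rule: linorder_cases) auto
qed

lemma dirac_matrix_clifford:
  fixes v :: "'n::finite spinor"
  assumes k: "k \<in> {1..CARD('n)}" and l: "l \<in> {1..CARD('n)}"
  shows "dirac_matrix k (dirac_matrix l v) + dirac_matrix l (dirac_matrix k v) = (if k = l then - (2 *\<^sub>R v) else 0)"
proof (rule spinor_eqI)
  fix A assume A: "A \<subseteq> {1..CARD('n) div 2}"
  have f: "finite A" using A finite_subset by blast
  let ?n = "CARD('n)"
  have c: "dirac_matrix k (dirac_matrix l v) $ Abs_multiindex A
    = dirac_sign ?n k A * dirac_sign ?n l (dirac_toggle ?n k A) * v $ Abs_multiindex (dirac_toggle ?n l (dirac_toggle ?n k A))"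
    if "k \<in> {1..?n}" "l \<in> {1..?n}" for k l
    using dirac_matrix_component[OF A that(1)] dirac_matrix_component[OF dirac_toggle_subset[OF A that(1)] that(2)]
    by (simp add: mult.assoc)
  show "(dirac_matrix k (dirac_matrix l v) + dirac_matrix l (dirac_matrix k v)) $ Abs_multiindex A
    = (if k = l then - (2 *\<^sub>R v) else 0) $ Abs_multiindex A"
  proof (cases "k = l")
    case True
    then show ?thesis using c[OF k l] dirac_square_sign[OF f, of ?n k] by (simp add: scaleR_conv_of_real)
  next
    case False
    then show ?thesis using c[OF k l] c[OF l k] dirac_anticommute_sign[OF f False k l] by simp
  qed
qed

subsection \<open>Half spinors\<close>

text \<open>
  The two spinor modules as kernels of linear maps, which commute with derivatives and integrals.
\<close>

definition half :: "bool \<Rightarrow> 'n::finite spinor \<Rightarrow> 'n spinor" where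
  "half p v = (\<chi> \<alpha>. if even CARD('n) \<and> (even (card (Rep_multiindex \<alpha>)) = p) then v $ \<alpha> else 0)"

lemma linear_half: "linear (half p)"
  by (rule linearI) (auto simp: half_def vec_eq_iff)

lemma half_eq_0_iff:
  "half True v = 0 \<longleftrightarrow> v \<in> spinors_minus" "half False v = 0 \<longleftrightarrow> v \<in> spinors_plus"
  by (auto simp: half_def vec_eq_iff spinors_minus_def spinors_plus_def)

lemma half_dirac_matrix:
  fixes v :: "'n::finite spinor"
  assumes k: "k \<in> {1..CARD('n)}" and v: "half p v = 0"
  shows "half (\<not> p) (dirac_matrix k v) = 0"
proof (rule spinor_eqI)
  fix A assume A: "A \<subseteq> {1..CARD('n) div 2}"
  have f: "finite A" using A finite_subset by blast
  let ?B = "dirac_toggle CARD('n) k A"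
  show "half (\<not> p) (dirac_matrix k v) $ Abs_multiindex A = 0 $ Abs_multiindex A"
  proof (cases "even CARD('n) \<and> (even (card A) = (\<not> p))")
    case True
    have "(- 1 :: complex) ^ card ?B = - ((- 1) ^ card A)"
      using True by (simp add: dirac_toggle_def card_toggle[OF f])
    then have "even (card ?B) \<longleftrightarrow> odd (card A)"
      by (cases "even (card A)"; cases "even (card ?B)") auto
    then have "v $ Abs_multiindex ?B = half p v $ Abs_multiindex ?B"
      using True by (auto simp: half_def Rep_Abs_multiindex[OF dirac_toggle_subset[OF A k]])
    then have "v $ Abs_multiindex ?B = 0" using v by simp
    then show ?thesis using dirac_matrix_component[OF A k, of v] by (simp add: half_def)
  next
    case False
    then show ?thesis by (auto simp: half_def Rep_Abs_multiindex[OF A])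
  qed
qed

section \<open>The theorem\<close>

lemma coord_number_range: "coord_number (i :: 'n::{finite,linorder}) \<in> {1..CARD('n)}"
proof -
  have "card {..i} > 0" by (simp add: card_gt_0_iff)
  moreover have "card {..i} \<le> CARD('n)" by (rule card_mono) auto
  ultimately show ?thesis by (simp add: coord_number_def)
qed

lemma coord_number_inject: "coord_number i = coord_number (j :: 'n::{finite,linorder}) \<longleftrightarrow> i = j"
proof
  assume e: "coord_number i = coord_number j"
  have "\<not> a < b" if "coord_number a = coord_number b" for a b :: 'n
  proof
    assume "a < b"
    then have "{..a} \<subset> {..b}" by (auto simp: psubset_eq)
    then have "card {..a} < card {..b}" by (intro psubset_card_mono) auto
    then show False using that by (simp add: coord_number_def)
  qed
  then show "i = j" using e by (metis linorder_neqE)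
qed simp

text \<open>
  The linear extension of the Dirac matrices from the coordinate vectors to all vectors.
\<close>

definition clifford :: "(real, 'n::{finite,linorder}) vec \<Rightarrow> 'n spinor \<Rightarrow> 'n spinor" where
  "clifford x s = (\<Sum>i\<in>UNIV. (x $ i) *\<^sub>R dirac_matrix (coord_number i) s)"

lemma clifford_axis: "clifford (axis i 1) s = dirac_matrix (coord_number i) s"
proof -
  have "clifford (axis i 1) s = (\<Sum>j\<in>UNIV. if j = i then dirac_matrix (coord_number j) s else 0)"
    unfolding clifford_def by (intro sum.cong refl) (simp add: axis_def)
  then show ?thesis by simp
qed

lemma Basis_real_vec: "(Basis :: (real, 'n::finite) vec set) = (\<lambda>i. axis i 1) ` UNIV"
  by (auto simp: Basis_vec_def)

lemma sum_Basis_real_vec: "(\<Sum>b\<in>Basis. h b) = (\<Sum>i\<in>UNIV. h (axis i 1 :: (real, 'n::finite) vec))"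
  unfolding Basis_real_vec by (subst sum.reindex) (auto simp: inj_on_def axis_eq_axis)

lemma clifford_map_clifford: "clifford_map (clifford :: (real, 'n::{finite,linorder}) vec \<Rightarrow> 'n spinor \<Rightarrow> 'n spinor)"
  unfolding clifford_map_def
proof (intro conjI allI ballI)
  show "linear (clifford b :: 'n spinor \<Rightarrow> 'n spinor)" for b
    unfolding clifford_def[abs_def]
    by (intro linear_compose_sum ballI linear_compose_scale_right linear_dirac_matrix coord_number_range)
  fix b c :: "(real, 'n) vec" and s :: "'n spinor" assume "b \<in> Basis" "c \<in> Basis"
  then obtain i j where "b = axis i 1" "c = axis j 1" unfolding Basis_real_vec by auto
  then show "clifford b (clifford c s) + clifford c (clifford b s) = (if b = c then - (2 *\<^sub>R s) else 0)"
    using dirac_matrix_clifford[OF coord_number_range coord_number_range, of i j s]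
    by (simp add: clifford_axis axis_eq_axis coord_number_inject)
qed

lemma nabla_clifford:
  "nabla0 u x = (\<Sum>b\<in>Basis. clifford b (frechet_derivative u (at x) (b, 0)))"
  "nabla1 u x = (\<Sum>b\<in>Basis. clifford b (frechet_derivative u (at x) (0, b)))"
  by (simp_all add: nabla0_def nabla1_def sum_Basis_real_vec clifford_axis)

theorem theorem1p4:
  fixes \<Omega> :: "('n::{finite,linorder}) domain_space set"
    and f :: "'n domain_space \<Rightarrow> 'n spinor"
  assumes "open \<Omega>" and "connected \<Omega>" and "\<Omega> \<noteq> {}" and "bounded \<Omega>"
    and "smooth_boundary \<Omega>"
    and "connected (- closure \<Omega>)"
    and "f ` closure \<Omega> \<subseteq> spinors_plus"
    and "continuous_on (closure \<Omega>) f"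
    and "Ck_on 2 \<Omega> f"
    and "vanishes_on_boundary 2 \<Omega> (D0 f)"
    and moment: "\<And>G. G \<in> ker_D0_adj \<Longrightarrow>
      (LINT x|surface_measure \<Omega>. spinor_inner (f x) (normal_action \<Omega> x (G x))) = 0"
  shows "\<exists>f'. monogenic_on \<Omega> f' \<and> continuous_on (closure \<Omega>) f' \<and> (\<forall>x\<in>frontier \<Omega>. f' x = f x)"
proof -
  let ?f1 = "\<lambda>x. frechet_derivative f (at x)"
  let ?f2 = "\<lambda>a x. frechet_derivative (\<lambda>y. ?f1 y a) (at x)"
  have C2: "Ck_on (Suc (Suc 0)) \<Omega> f" using assms(9) by (simp only: numeral_2_eq_2)
  have f2: "C1_on \<Omega> (\<lambda>x. ?f1 x a) (?f2 a)" if "a \<in> Basis" for a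
    using C2 that Ck_on_1_iff_C1_on[OF assms(1), of "\<lambda>x. ?f1 x a"] by simp
  have f1: "C1_on \<Omega> f ?f1"
  proof -
    have "continuous_on \<Omega> (\<lambda>x. ?f1 x a)" if "a \<in> Basis" for a by (rule C1_onD(4)[OF f2[OF that]])
    then show ?thesis using C2 Ck_on_1_iff_C1_on[OF assms(1), of f] by simp
  qed
  have lin: "linear (clifford b :: 'n spinor \<Rightarrow> 'n spinor)" for b
    by (rule clifford_map_linear[OF clifford_map_clifford])
  have B: "(b, 0) \<in> Basis" "(0, b) \<in> Basis" if "b \<in> Basis" for b :: "(real, 'n) vec"
    using that by (auto simp: Basis_prod_def)
  let ?N0 = "\<lambda>x. \<Sum>b\<in>Basis. clifford b (?f1 x (b, 0))" and ?N1 = "\<lambda>x. \<Sum>b\<in>Basis. clifford b (?f1 x (0, b))"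
  let ?N0' = "\<lambda>x v. \<Sum>b\<in>Basis. clifford b (?f2 (b, 0) x v)" and ?N1' = "\<lambda>x v. \<Sum>b\<in>Basis. clifford b (?f2 (0, b) x v)"
  have D0f: "D0 f = (\<lambda>x. (?N0 x, ?N1 x))" by (simp add: D0_def nabla_clifford fun_eq_iff)
  have C0: "C1_on \<Omega> ?N0 ?N0'" and C1: "C1_on \<Omega> ?N1 ?N1'"
    by (rule C1_on_sum, rule C1_on_linear_image[OF _ lin], rule f2, erule B)+
  have D0': "frechet_derivative (D0 f) (at x) v = (?N0' x v, ?N1' x v)" if "x \<in> \<Omega>" for x v
  proof -
    have "(D0 f has_derivative (\<lambda>v. (?N0' x v, ?N1' x v))) (at x)"
      unfolding D0f by (intro has_derivative_Pair C1_onD(1)[OF C0 that] C1_onD(1)[OF C1 that])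
    from fun_cong[OF frechet_derivative_at[OF this], of v] show ?thesis by simp
  qed
  have van: "vanishes_on_boundary (Suc (Suc 0)) \<Omega> (D0 f)" using assms(10) by (simp only: numeral_2_eq_2)
  have v0: "((\<lambda>x. (?N0 x, ?N1 x)) \<longlongrightarrow> 0) (at p within \<Omega>)" if "p \<in> frontier \<Omega>" for p
    using van that by (simp add: D0f)
  have v1: "((\<lambda>x. (?N0' x a, ?N1' x a)) \<longlongrightarrow> 0) (at p within \<Omega>)" if p: "p \<in> frontier \<Omega>" "a \<in> Basis" for p a
  proof -
    have "((\<lambda>x. frechet_derivative (D0 f) (at x) a) \<longlongrightarrow> 0) (at p within \<Omega>)" using van p by simp
    moreover have "\<forall>\<^sub>F x in at p within \<Omega>. frechet_derivative (D0 f) (at x) a = (?N0' x a, ?N1' x a)"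
      using D0' by (auto simp: eventually_at intro!: exI[of _ 1])
    ultimately show ?thesis by (rule Lim_transform_eventually)
  qed
  \<comment> \<open>The values of the derivatives of \<open>f\<close> are positive spinors, so those of \<open>?N0\<close> are negative ones.\<close>
  have par: "half True (?N0 x) = 0" if x: "x \<in> \<Omega>" for x
  proof -
    have h: "half False (?f1 x v) = 0" for v
    proof -
      have "bounded_linear (half False :: 'n spinor \<Rightarrow> 'n spinor)" using linear_half by (simp add: linear_conv_bounded_linear)
      from bounded_linear.has_derivative[OF this C1_onD(1)[OF f1 x]]
      have "((\<lambda>y. half False (f y)) has_derivative (\<lambda>v. half False (?f1 x v))) (at x)" .
      moreover have "((\<lambda>y. half False (f y)) has_derivative (\<lambda>v. 0)) (at x)"
      proof (rule has_derivative_transform_within_open[OF has_derivative_const assms(1) x])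
        show "0 = half False (f y)" if "y \<in> \<Omega>" for y
          using half_eq_0_iff(2)[of "f y"] assms(7) closure_subset[of \<Omega>] that by auto
      qed
      ultimately show ?thesis using has_derivative_unique by metis
    qed
    have "half True (clifford b (?f1 x (b, 0))) = 0" if "b \<in> Basis" for b
    proof -
      obtain i where "b = axis i 1" using \<open>b \<in> Basis\<close> unfolding Basis_real_vec by auto
      then show ?thesis using half_dirac_matrix[OF coord_number_range h] by (simp add: clifford_axis)
    qed
    then show ?thesis by (simp add: linear_sum[OF linear_half])
  qed
  have par2: "half False (clifford b s) = 0" if b: "b \<in> Basis" "half True s = 0" for b and s :: "'n spinor"
  proof -
    obtain i where "b = axis i 1" using b(1) unfolding Basis_real_vec by auto
    then show ?thesis using half_dirac_matrix[OF coord_number_range b(2)] by (simp add: clifford_axis)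
  qed
  obtain u u' where u: "C1_on UNIV u u'" "\<And>x. half False (u x) = 0" "\<And>x. x \<in> frontier \<Omega> \<Longrightarrow> u x = 0"
    "\<And>x. x \<in> \<Omega> \<Longrightarrow> (\<Sum>b\<in>Basis. clifford b (u' x (b, 0))) = ?N0 x"
    "\<And>x. x \<in> \<Omega> \<Longrightarrow> (\<Sum>b\<in>Basis. clifford b (u' x (0, b))) = ?N1 x"
  proof (rule hartogs_correction[OF clifford_map_clifford assms(1,4,5,6) f1 f2 _ _ _ _ linear_half linear_half par par2])
    fix p assume p: "p \<in> frontier \<Omega>"
    show "(?N0 \<longlongrightarrow> 0) (at p within \<Omega>)" using tendsto_fst[OF v0[OF p]] by simp
    show "(?N1 \<longlongrightarrow> 0) (at p within \<Omega>)" using tendsto_snd[OF v0[OF p]] by simp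
    fix a :: "'n domain_space" assume a: "a \<in> Basis"
    show "((\<lambda>x. ?N0' x a) \<longlongrightarrow> 0) (at p within \<Omega>)" using tendsto_fst[OF v1[OF p a]] by simp
    show "((\<lambda>x. ?N1' x a) \<longlongrightarrow> 0) (at p within \<Omega>)" using tendsto_snd[OF v1[OF p a]] by simp
  qed blast+
  let ?h = "\<lambda>x. f x - u x"
  have Ch: "C1_on \<Omega> ?h (\<lambda>x v. ?f1 x v - u' x v)"
    by (rule C1_on_diff[OF f1 C1_on_subset[OF u(1) subset_UNIV]])
  show ?thesis
  proof (intro exI[of _ ?h] conjI)
    show "continuous_on (closure \<Omega>) ?h"
      by (intro continuous_on_diff assms(8) continuous_on_subset[OF C1_onD(4)[OF u(1)] subset_UNIV])
    show "\<forall>x\<in>frontier \<Omega>. ?h x = f x" using u(3) by simp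
    show "monogenic_on \<Omega> ?h" unfolding monogenic_on_def
    proof (intro conjI ballI)
      show "Ck_on 1 \<Omega> ?h" by (rule C1_on_imp_Ck_on_1[OF assms(1) Ch])
      show "?h ` \<Omega> \<subseteq> spinors_plus"
      proof (rule image_subsetI)
        fix x assume "x \<in> \<Omega>"
        then have "half False (f x) = 0" using half_eq_0_iff(2)[of "f x"] assms(7) closure_subset[of \<Omega>] by auto
        then have "half False (?h x) = 0" by (simp add: linear_diff[OF linear_half] u(2))
        then show "?h x \<in> spinors_plus" by (simp only: half_eq_0_iff(2))
      qed
      fix x assume x: "x \<in> \<Omega>"
      have d: "frechet_derivative ?h (at x) v = ?f1 x v - u' x v" for v
        using fun_cong[OF frechet_derivative_at[OF C1_onD(1)[OF Ch x]], of v] by simp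
      show "D0 ?h x = 0"
        using u(4,5)[OF x] by (simp add: D0_def nabla_clifford d linear_diff[OF lin] sum_subtractf zero_prod_def)
    qed
  qed
qed

end
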